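(* Let $q=p_1^{r_1}\cdots p_t^{r_t}$ be an odd number, where $t\ge 1$, $p_1,\ldots,p_t$ are distinct odd primes and $r_i\ge1$, and let $n=\sum_{i=1}^tp_i^{r_i}$. Let $\Gamma_q$ be the Bieberbach subgroup of $B_n/[P_n,P_n]$ of dimension $n(n-1)/2$ with holonomy group $\mathbb{Z}_q$ defined in the context. Then the center $\mathcal{Z}(\Gamma_q)$ of $\Gamma_q$ is the free abelian group of rank $\displaystyle\sum_{i=1}^t\frac{p_i^{r_i}-1}{2}+\frac{t(t-1)}{2}$ given by $$\mathcal{Z}(\Gamma_q)=\left(\bigoplus_{1\le j\le t}\mathbb{Z}[e_{j,0,1}]\right)\oplus\left(\bigoplus_{\substack{1\le j\le t\\1\le h\le\frac{p_j^{r_j}-3}{2}}}\mathbb{Z}\left[\prod_{1\le k\le p_j^{r_j}}e_{j,h,k}\right]\right)\oplus\left(\bigoplus_{1\le j<h\le t}\mathbb{Z}\left[\prod_{1\le k\le p_j^{r_j}p_h^{r_h}}e_{t+j,t+h,k}\right]\right),$$ where $\mathbb{Z}[x]$ denotes the infinite cyclic subgroup generated by $x$ and the elements $e_{*,*,*}$ are those defined in the context.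
   Context: $B_n$ is the Artin braid group with standard generators $\sigma_1,\ldots,\sigma_{n-1}$, $P_n$ is the pure braid group (kernel of $\sigma\colon B_n\to S_n$, $\sigma_i\mapsto(i,\,i+1)$), and $[P_n,P_n]$ its commutator subgroup. For $1\le i<j\le n$, $A_{i,j}=\sigma_{j-1}\cdots\sigma_{i+1}\sigma_i^2\sigma_{i+1}^{-1}\cdots\sigma_{j-1}^{-1}$; the same symbol denotes its class in $B_n/[P_n,P_n]$. The classes $A_{i,j}$ form a basis of the free abelian group $P_n/[P_n,P_n]\cong\mathbb{Z}^{n(n-1)/2}$. Definition of $\Gamma_q$: put $n_0=0$, $n_l=\sum_{i=1}^l p_i^{r_i}$ (so $n=n_t$). For $0\le l\le t-1$, with $m=p_{l+1}^{r_{l+1}}$, let $$\delta_{n_l,m}=\sigma_{n_l+m-1}\cdots\sigma_{n_l+\frac{m+1}{2}}\,\sigma_{n_l+\frac{m-1}{2}}^{-1}\cdots\sigma_{n_l+1}^{-1}\in B_n/[P_n,P_n].$$ $\Gamma_q$ is the subgroup of $B_n/[P_n,P_n]$ generated by $A_{n_l+1,n_l+2}\,\delta_{n_l,p_{l+1}^{r_{l+1}}}$ for $0\le l\le t-1$ together with $A_{a,b}^{q}$ for $1\le a<b\le n$. It is a Bieberbach group (torsion-free crystallographic group) of dimension $n(n-1)/2$ with holonomy group $\mathbb{Z}_q$, and $L=\Gamma_q\cap P_n/[P_n,P_n]$ is its translation lattice, free abelian of rank $n(n-1)/2$. Let $\delta=\prod_{0\le l\le t-1}\delta_{n_l,p_{l+1}^{r_{l+1}}}$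 (the factors commute). The following elements form a basis $\mathcal{B}$ of $L$: - for $1\le j\le t$: $e_{j,0,1}=\left(A_{n_{j-1}+1,n_{j-1}+2}\,\delta_{n_{j-1},p_j^{r_j}}\right)^{p_j^{r_j}}$, and $e_{j,0,k+1}=\delta^{k-1}A_{n_{j-1}+2,n_{j-1}+3}^{q}\delta^{-(k-1)}$ for $1\le k\le p_j^{r_j}-1$; - for $1\le j\le t$, $1\le h\le\frac{p_j^{r_j}-3}{2}$, $1\le k\le p_j^{r_j}$: $e_{j,h,k}=\delta^{k-1}A_{n_{j-1}+1,n_{j-1}+h+2}^{q}\delta^{-(k-1)}$; - for $1\le j<h\le t$, $1\le k\le p_j^{r_j}p_h^{r_h}$: $e_{t+j,t+h,k}=\delta^{k-1}A_{n_{j-1}+1,n_{h-1}+1}^{q}\delta^{-(k-1)}$. *)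

theory Defs
  imports "HOL-Algebra.Sym_Groups" "HOL-Algebra.Free_Abelian_Groups"
    "HOL-Computational_Algebra.Primes"
begin

section \<open>Groups given by generators and relations\<close>

text \<open>
  A letter \<open>(x, True)\<close> stands for the generator \<open>x\<close> and \<open>(x, False)\<close> for its inverse.
\<close>

type_synonym 'a word = "('a \<times> bool) list"

definition words :: "'a set \<Rightarrow> 'a word set"
  where "words S = lists (S \<times> UNIV)"

inductive_set word_eq :: "'a set \<Rightarrow> ('a word \<times> 'a word) set \<Rightarrow> ('a word \<times> 'a word) set"
  for S R where
    refl: "w \<in> words S \<Longrightarrow> (w, w) \<in> word_eq S R"
  | sym: "(u, v) \<in> word_eq S R \<Longrightarrow> (v, u) \<in> word_eq S R"
  | trans: "(u, v) \<in> word_eq S R \<Longrightarrow> (v, w) \<in> word_eq S R \<Longrightarrow> (u, w) \<in> word_eq S R"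
  | append: "(u, u') \<in> word_eq S R \<Longrightarrow> (v, v') \<in> word_eq S R \<Longrightarrow> (u @ v, u' @ v') \<in> word_eq S R"
  | cancel: "x \<in> S \<Longrightarrow> ([(x, b), (x, \<not> b)], []) \<in> word_eq S R"
  | rel: "(u, v) \<in> R \<Longrightarrow> u \<in> words S \<Longrightarrow> v \<in> words S \<Longrightarrow> (u, v) \<in> word_eq S R"

definition presented_group :: "'a set \<Rightarrow> ('a word \<times> 'a word) set \<Rightarrow> 'a word set monoid"
  where "presented_group S R =
    \<lparr> carrier = words S // word_eq S R,
      monoid.mult = (\<lambda>U V. \<Union>u\<in>U. \<Union>v\<in>V. word_eq S R `` {u @ v}),
      one = word_eq S R `` {[]} \<rparr>"

definition inv_word :: "'a word \<Rightarrow> 'a word"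
  where "inv_word w = rev (map (\<lambda>(x, b). (x, \<not> b)) w)"

lemma words_simps [simp]:
  "[] \<in> words S"
  "a # w \<in> words S \<longleftrightarrow> fst a \<in> S \<and> w \<in> words S"
  "u @ v \<in> words S \<longleftrightarrow> u \<in> words S \<and> v \<in> words S"
  by (auto simp: words_def mem_Times_iff)

lemma inv_word_in_words: "w \<in> words S \<Longrightarrow> inv_word w \<in> words S"
  by (induction w) (auto simp: inv_word_def split: prod.splits)

lemma word_eq_words:
  "(u, v) \<in> word_eq S R \<Longrightarrow> u \<in> words S \<and> v \<in> words S"
  by (induction rule: word_eq.induct) auto

lemma equiv_word_eq: "equiv (words S) (word_eq S R)"
proof (rule equivI)
  show "word_eq S R \<subseteq> words S \<times> words S"
    using word_eq_words by fastforce
  show "refl_on (words S) (word_eq S R)"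
    by (auto intro!: refl_onI word_eq.refl dest: word_eq_words)
qed (auto intro!: symI transI intro: word_eq.sym word_eq.trans)

lemma word_class_eq_iff:
  "u \<in> words S \<Longrightarrow> v \<in> words S \<Longrightarrow>
    word_eq S R `` {u} = word_eq S R `` {v} \<longleftrightarrow> (u, v) \<in> word_eq S R"
  by (rule eq_equiv_class_iff[OF equiv_word_eq])

lemma inv_word_left:
  "w \<in> words S \<Longrightarrow> (inv_word w @ w, []) \<in> word_eq S R"
proof (induction w)
  case Nil
  then show ?case by (simp add: inv_word_def word_eq.refl)
next
  case (Cons a w)
  obtain x b where a: "a = (x, b)" by force
  have w: "w \<in> words S" and x: "x \<in> S" using Cons.prems a by auto
  have "([(x, \<not> b), (x, b)], []) \<in> word_eq S R"
    using word_eq.cancel[OF x, of "\<not> b" R] by simp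
  then have "([(x, \<not> b), (x, b)] @ w, [] @ w) \<in> word_eq S R"
    using w by (blast intro: word_eq.append word_eq.refl)
  then have "(inv_word w @ ([(x, \<not> b), (x, b)] @ w), inv_word w @ ([] @ w)) \<in> word_eq S R"
    using inv_word_in_words[OF w] by (blast intro: word_eq.append word_eq.refl)
  then show ?case
    using Cons.IH[OF w] by (auto simp: inv_word_def a intro: word_eq.trans)
qed

lemma presented_group_mult:
  assumes "u \<in> words S" "v \<in> words S"
  shows "word_eq S R `` {u} \<otimes>\<^bsub>presented_group S R\<^esub> word_eq S R `` {v} = word_eq S R `` {u @ v}"
proof -
  have 1: "word_eq S R `` {u' @ v'} = word_eq S R `` {u @ v}"
    if "u' \<in> word_eq S R `` {u}" "v' \<in> word_eq S R `` {v}" for u' v'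
  proof -
    have "(u @ v, u' @ v') \<in> word_eq S R"
      using that by (intro word_eq.append) auto
    then show ?thesis
      by (rule equiv_class_eq[OF equiv_word_eq, symmetric])
  qed
  have ne: "word_eq S R `` {u} \<noteq> {}" "word_eq S R `` {v} \<noteq> {}"
    using assms word_eq.refl by fast+
  have "(\<Union>u'\<in>word_eq S R `` {u}. \<Union>v'\<in>word_eq S R `` {v}. word_eq S R `` {u' @ v'})
      = (\<Union>u'\<in>word_eq S R `` {u}. \<Union>v'\<in>word_eq S R `` {v}. word_eq S R `` {u @ v})"
    by (intro SUP_cong HOL.refl 1)
  also have "\<dots> = word_eq S R `` {u @ v}"
    using ne by (simp only: UN_constant if_False)
  finally show ?thesis
    by (simp add: presented_group_def)
qed

lemma group_presented_group: "group (presented_group S R)"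
proof (rule groupI)
  let ?G = "presented_group S R"
  have car: "x \<in> carrier ?G \<longleftrightarrow> (\<exists>w\<in>words S. x = word_eq S R `` {w})" for x
    by (auto simp: presented_group_def quotient_def)
  have one: "\<one>\<^bsub>?G\<^esub> = word_eq S R `` {[]}"
    by (simp add: presented_group_def)
  show "\<one>\<^bsub>?G\<^esub> \<in> carrier ?G"
    unfolding car one by (rule bexI[of _ "[]"]) auto
  show "x \<otimes>\<^bsub>?G\<^esub> y \<in> carrier ?G" if xy: "x \<in> carrier ?G" "y \<in> carrier ?G" for x y
  proof -
    obtain u v where "u \<in> words S" "v \<in> words S"
      "x = word_eq S R `` {u}" "y = word_eq S R `` {v}"
      using xy unfolding car by blast
    then show ?thesis
      unfolding car by (intro bexI[of _ "u @ v"]) (auto simp: presented_group_mult)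
  qed
  show "x \<otimes>\<^bsub>?G\<^esub> y \<otimes>\<^bsub>?G\<^esub> z = x \<otimes>\<^bsub>?G\<^esub> (y \<otimes>\<^bsub>?G\<^esub> z)"
    if "x \<in> carrier ?G" "y \<in> carrier ?G" "z \<in> carrier ?G" for x y z
    using that unfolding car by (auto simp: presented_group_mult)
  show "\<one>\<^bsub>?G\<^esub> \<otimes>\<^bsub>?G\<^esub> x = x" if "x \<in> carrier ?G" for x
    using that unfolding car one by (auto simp: presented_group_mult)
  show "\<exists>y\<in>carrier ?G. y \<otimes>\<^bsub>?G\<^esub> x = \<one>\<^bsub>?G\<^esub>" if x: "x \<in> carrier ?G" for x
  proof -
    obtain w where w: "w \<in> words S" "x = word_eq S R `` {w}" using x car by auto
    have "word_eq S R `` {inv_word w} \<otimes>\<^bsub>?G\<^esub> x = \<one>\<^bsub>?G\<^esub>"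
      using w inv_word_left[OF w(1), of R] inv_word_in_words[OF w(1)]
      by (simp add: presented_group_mult one word_class_eq_iff)
    moreover have "word_eq S R `` {inv_word w} \<in> carrier ?G"
      using car inv_word_in_words[OF w(1)] by blast
    ultimately show ?thesis by blast
  qed
qed


section \<open>Braid groups and pure braid groups\<close>

definition pos_word :: "'a list \<Rightarrow> 'a word"
  where "pos_word xs = map (\<lambda>x. (x, True)) xs"

definition braid_relations :: "nat \<Rightarrow> (nat word \<times> nat word) set"
  where "braid_relations n =
    {(pos_word [i, i + 1, i], pos_word [i + 1, i, i + 1]) | i. 1 \<le> i \<and> i + 1 < n} \<union>
    {(pos_word [i, j], pos_word [j, i]) | i j. 1 \<le> i \<and> i + 2 \<le> j \<and> j < n}"

definition braid_group :: "nat \<Rightarrow> nat word set monoid"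
  where "braid_group n = presented_group {1..<n} (braid_relations n)"

definition braid_gen :: "nat \<Rightarrow> nat \<Rightarrow> nat word set"
  where "braid_gen n i = word_eq {1..<n} (braid_relations n) `` {[(i, True)]}"

definition word_perm :: "nat word \<Rightarrow> nat \<Rightarrow> nat"
  where "word_perm w = foldr (\<lambda>(i, b) f. transpose i (i + 1) \<circ> f) w id"

text \<open>
  All words in a class have the same image under \<open>word_perm\<close>, see \<open>braid_perm_class\<close> below.
\<close>

definition braid_perm :: "nat word set \<Rightarrow> nat \<Rightarrow> nat"
  where "braid_perm U = the_elem (word_perm ` U)"

definition pure_braid_group :: "nat \<Rightarrow> nat word set set"
  where "pure_braid_group n = kernel (braid_group n) (sym_group n) braid_perm"

lemma group_braid_group: "group (braid_group n)"
  unfolding braid_group_def by (rule group_presented_group)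

lemma word_perm_append: "word_perm (u @ v) = word_perm u \<circ> word_perm v"
  by (induction u) (auto simp: word_perm_def fun_eq_iff)

lemma word_perm_permutes: "w \<in> words {1..<n} \<Longrightarrow> word_perm w permutes {1..n}"
proof (induction w)
  case Nil
  then show ?case by (simp add: word_perm_def permutes_id flip: id_def del: One_nat_def)
next
  case (Cons a w)
  have "transpose (fst a) (fst a + 1) permutes {1..n}"
    using Cons.prems by (intro permutes_swap_id) auto
  moreover have "word_perm w permutes {1..n}"
    using Cons by simp
  ultimately have "transpose (fst a) (fst a + 1) \<circ> word_perm w permutes {1..n}"
    by (rule permutes_compose[rotated])
  moreover have "word_perm (a # w) = transpose (fst a) (fst a + 1) \<circ> word_perm w"
    by (simp add: word_perm_def case_prod_beta)
  ultimately show ?case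
    by (simp only:)
qed

lemma word_perm_cong:
  "(u, v) \<in> word_eq {1..<n} (braid_relations n) \<Longrightarrow> word_perm u = word_perm v"
proof (induction rule: word_eq.induct)
  case (rel u v)
  then show ?case
    by (auto simp: braid_relations_def pos_word_def word_perm_def fun_eq_iff transpose_def)
qed (auto simp: word_perm_append, auto simp: word_perm_def fun_eq_iff)

lemma braid_perm_class:
  assumes "w \<in> words {1..<n}"
  shows "braid_perm (word_eq {1..<n} (braid_relations n) `` {w}) = word_perm w"
proof -
  have "word_perm ` (word_eq {1..<n} (braid_relations n) `` {w}) = {word_perm w}"
    using word_perm_cong word_eq.refl[OF assms] by (fastforce simp: image_iff)
  then show ?thesis
    by (simp add: braid_perm_def)
qed

lemma braid_perm_hom: "braid_perm \<in> hom (braid_group n) (sym_group n)"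
proof (rule homI)
  have car: "x \<in> carrier (braid_group n) \<longleftrightarrow>
      (\<exists>w\<in>words {1..<n}. x = word_eq {1..<n} (braid_relations n) `` {w})" for x
    by (auto simp: braid_group_def presented_group_def quotient_def)
  show "braid_perm x \<in> carrier (sym_group n)" if "x \<in> carrier (braid_group n)" for x
    using that unfolding car 
    by (auto simp: braid_perm_class sym_group_carrier word_perm_permutes simp del: One_nat_def)
  show "braid_perm (x \<otimes>\<^bsub>braid_group n\<^esub> y) = braid_perm x \<otimes>\<^bsub>sym_group n\<^esub> braid_perm y"
    if "x \<in> carrier (braid_group n)" "y \<in> carrier (braid_group n)" for x y
    using that unfolding car
    by (auto simp: braid_perm_class braid_group_def presented_group_mult sym_group_mult
        word_perm_append simp del: One_nat_def)
qed

lemma braid_perm_gen: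
  "i \<in> {1..<n} \<Longrightarrow> braid_perm (braid_gen n i) = transpose i (i + 1)"
  by (simp add: braid_gen_def braid_perm_class word_perm_def del: One_nat_def)


section \<open>The quotient by the commutator subgroup of the pure braid group\<close>

definition braid_quot :: "nat \<Rightarrow> nat word set set monoid"
  where "braid_quot n = braid_group n Mod derived (braid_group n) (pure_braid_group n)"

definition quot_class :: "nat \<Rightarrow> nat word set \<Rightarrow> nat word set set"
  where "quot_class n x = derived (braid_group n) (pure_braid_group n) #>\<^bsub>braid_group n\<^esub> x"

lemma derived_pure_normal: "derived (braid_group n) (pure_braid_group n) \<lhd> braid_group n"
proof -
  have "group_hom (braid_group n) (sym_group n) braid_perm"
    by (simp add: group_hom_def group_hom_axioms_def group_braid_group sym_group_is_group
        braid_perm_hom)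
  then have "pure_braid_group n \<lhd> braid_group n"
    unfolding pure_braid_group_def by (rule group_hom.normal_kernel)
  then show ?thesis
    by (rule group.derived_is_normal[OF group_braid_group])
qed

lemma group_braid_quot: "group (braid_quot n)"
  unfolding braid_quot_def by (rule normal.factorgroup_is_group[OF derived_pure_normal])

definition list_mult :: "('a, 'b) monoid_scheme \<Rightarrow> 'a list \<Rightarrow> 'a"
  where "list_mult G xs = foldr (\<lambda>x y. x \<otimes>\<^bsub>G\<^esub> y) xs \<one>\<^bsub>G\<^esub>"

definition pure_gen :: "nat \<Rightarrow> nat \<Rightarrow> nat \<Rightarrow> nat word set"
  where "pure_gen n i j = (let B = braid_group n; s = braid_gen n in
    list_mult B (map s (rev [i + 1..<j])) \<otimes>\<^bsub>B\<^esub> (s i [^]\<^bsub>B\<^esub> (2::nat)) \<otimes>\<^bsub>B\<^esub>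
    list_mult B (map (\<lambda>k. inv\<^bsub>B\<^esub> (s k)) [i + 1..<j]))"

definition A_cls :: "nat \<Rightarrow> nat \<Rightarrow> nat \<Rightarrow> nat word set set"
  where "A_cls n i j = quot_class n (pure_gen n i j)"

text \<open>
  The element written \<open>\<delta>\<close> with indices \<open>N\<close>, \<open>m\<close>, for odd \<open>m\<close>.
\<close>

definition delta_block :: "nat \<Rightarrow> nat \<Rightarrow> nat \<Rightarrow> nat word set set"
  where "delta_block n N m = (let Q = braid_quot n; s = (\<lambda>i. quot_class n (braid_gen n i)) in
    list_mult Q (map s (rev [N + (m + 1) div 2..<N + m])) \<otimes>\<^bsub>Q\<^esub>
    list_mult Q (map (\<lambda>k. inv\<^bsub>Q\<^esub> (s k)) (rev [N + 1..<N + (m + 1) div 2])))"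


section \<open>The group \<open>\<Gamma>\<^sub>q\<close> and the elements \<open>e\<close>\<close>

text \<open>
  From here on \<open>m j\<close> is the size of the \<open>j\<close>-th block of strands, \<open>1 \<le> j \<le> t\<close>
  (a power of an odd prime in the application), \<open>n\<close> is the total number of strands and
  \<open>q\<close> is the product of the block sizes.
\<close>

definition offset :: "(nat \<Rightarrow> nat) \<Rightarrow> nat \<Rightarrow> nat"
  where "offset m l = (\<Sum>i = 1..l. m i)"

definition total :: "nat \<Rightarrow> (nat \<Rightarrow> nat) \<Rightarrow> nat"
  where "total t m = offset m t"

definition hol_order :: "nat \<Rightarrow> (nat \<Rightarrow> nat) \<Rightarrow> nat"
  where "hol_order t m = (\<Prod>i = 1..t. m i)"

definition delta :: "nat \<Rightarrow> (nat \<Rightarrow> nat) \<Rightarrow> nat word set set"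
  where "delta t m = (let n = total t m in
    list_mult (braid_quot n) (map (\<lambda>l. delta_block n (offset m l) (m (l + 1))) [0..<t]))"

definition Gamma :: "nat \<Rightarrow> (nat \<Rightarrow> nat) \<Rightarrow> nat word set set monoid"
  where "Gamma t m = (let n = total t m; q = hol_order t m; Q = braid_quot n in
    subgroup_generated Q
      ({A_cls n (offset m l + 1) (offset m l + 2) \<otimes>\<^bsub>Q\<^esub> delta_block n (offset m l) (m (l + 1)) | l.
          l < t} \<union>
       {A_cls n a b [^]\<^bsub>Q\<^esub> q | a b. 1 \<le> a \<and> a < b \<and> b \<le> n}))"

definition delta_conj :: "nat \<Rightarrow> (nat \<Rightarrow> nat) \<Rightarrow> nat \<Rightarrow> nat word set set \<Rightarrow> nat word set set"
  where "delta_conj t m k x = (let Q = braid_quot (total t m); d = delta t m [^]\<^bsub>Q\<^esub> k in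
    d \<otimes>\<^bsub>Q\<^esub> x \<otimes>\<^bsub>Q\<^esub> inv\<^bsub>Q\<^esub> d)"

text \<open>
  The three families \<open>e\<^bsub>j,0,k\<^esub>\<close>, \<open>e\<^bsub>j,h,k\<^esub>\<close> (with \<open>1 \<le> h\<close>) and
  \<open>e\<^bsub>t+j,t+h,k\<^esub>\<close> (with \<open>1 \<le> j < h \<le> t\<close>) share the indices \<open>a\<close>, \<open>b\<close>, \<open>k\<close>; they are told
  apart by \<open>b = 0\<close> and by \<open>a \<le> t\<close>. For \<open>b = 0\<close> the conjugating exponent is \<open>k - 2\<close>, since
  \<open>e\<^bsub>j,0,k+1\<^esub>\<close> is obtained by conjugating with the power \<open>k - 1\<close>.
\<close>

definition e_elt :: "nat \<Rightarrow> (nat \<Rightarrow> nat) \<Rightarrow> nat \<Rightarrow> nat \<Rightarrow> nat \<Rightarrow> nat word set set"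
  where "e_elt t m a b k = (let n = total t m; q = hol_order t m; Q = braid_quot n in
    if b = 0 then
      (let N = offset m (a - 1) in
       if k = 1 then (A_cls n (N + 1) (N + 2) \<otimes>\<^bsub>Q\<^esub> delta_block n N (m a)) [^]\<^bsub>Q\<^esub> m a
       else delta_conj t m (k - 2) (A_cls n (N + 2) (N + 3) [^]\<^bsub>Q\<^esub> q))
    else if a \<le> t then
      (let N = offset m (a - 1) in
       delta_conj t m (k - 1) (A_cls n (N + 1) (N + b + 2) [^]\<^bsub>Q\<^esub> q))
    else
      delta_conj t m (k - 1)
        (A_cls n (offset m (a - t - 1) + 1) (offset m (b - t - 1) + 1) [^]\<^bsub>Q\<^esub> q))"


section \<open>Centers and internal direct sums\<close>

definition center :: "('a, 'b) monoid_scheme \<Rightarrow> 'a set"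
  where "center G = {z \<in> carrier G. \<forall>x\<in>carrier G. z \<otimes>\<^bsub>G\<^esub> x = x \<otimes>\<^bsub>G\<^esub> z}"

definition internal_direct_sum ::
    "('a, 'b) monoid_scheme \<Rightarrow> 'a set \<Rightarrow> 'i set \<Rightarrow> ('i \<Rightarrow> 'a set) \<Rightarrow> bool"
  where "internal_direct_sum G K I H \<longleftrightarrow>
    subgroup K G \<and>
    (\<forall>i\<in>I. H i \<lhd> G\<lparr>carrier := K\<rparr>) \<and>
    K = generate G (\<Union>i\<in>I. H i) \<and>
    (\<forall>i\<in>I. H i \<inter> generate G (\<Union>j\<in>I - {i}. H j) = {\<one>\<^bsub>G\<^esub>})"

definition infinite_cyclic_on :: "('a, 'b) monoid_scheme \<Rightarrow> 'a \<Rightarrow> bool"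
  where "infinite_cyclic_on G x \<longleftrightarrow> x \<in> carrier G \<and> infinite (generate G {x})"

end

theory Submission
  imports Defs "HOL-Number_Theory.Cong"
begin

text \<open>
Two quantities of a braid survive in \<open>B\<^sub>n/[P\<^sub>n,P\<^sub>n]\<close>: its permutation, and for every pair of strands
the number of their crossings counted with sign. Together they map the quotient to the semidirect
product of the integer functions on pairs with the symmetric group, and \<open>A\<^bsub>i,j\<^esub>\<close> goes to
twice the indicator of \<open>{i, j}\<close>. This map is injective (\<open>braid_quot_eqI\<close>): the subgroup generated by the
\<open>A\<^bsub>i,j\<^esub>\<close> is normal, dividing by it makes the Coxeter relations hold, and so it contains every pure
element, while crossing numbers separate its elements. Every later statement about group elements
is therefore a computation with permutations and crossing numbers.

Each block element \<open>\<delta>\<close> rotates its block of strands cyclically, and its crossing numbers are a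
coboundary: they equal \<open>w - \<delta> w\<close>, where \<open>w\<close> is the indicator of the pairs of strands whose
positions in the block differ by at most half the block size. Subtracting the coboundary of \<open>w\<close>
gives a second cocycle, the reduced crossing numbers, which vanishes on the \<open>\<delta>\<close> and agrees
with the crossing numbers on pure elements. On the generators of \<open>\<Gamma>\<^sub>q\<close> it is twice an indicator of a
cyclically adjacent pair, or \<open>2 q\<close> times an indicator of a pair. Since
rotations preserve cyclic adjacency, all reduced crossing numbers in \<open>\<Gamma>\<^sub>q\<close> are even, and those of
non-adjacent pairs are divisible by \<open>2 q\<close> (\<open>Gamma_like_Gamma\<close>).

An element that commutes with all \<open>A\<^bsub>a,b\<^esub>\<^bsup>q\<^esup>\<close> preserves every pair of strands, hence is pure. A pure element
of \<open>\<Gamma>\<^sub>q\<close> is central iff its crossing numbers are invariant under rotating any single block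
(\<open>center_iff\<close>). The orbits of pairs are: in each block, the pairs at cyclic distance
\<open>1, \<dots>, (p\<^sub>j\<^bsup>r\<^sub>j\<^esup> - 1)/2\<close>, and for each two blocks, all pairs between them. So a central element
amounts to one even integer for each block (distance one) and one multiple of \<open>2 q\<close> for every
other orbit. The listed elements take the least positive value on one orbit and vanish on the others;
for two blocks this is the Chinese remainder theorem, because the block sizes are coprime. Thus
the values on orbits, divided by \<open>2\<close> or by \<open>2 q\<close>, are coordinates dual to the listed elements, and
the theorem follows from \<open>coordinates_imp_free_abelian\<close>.
\<close>

section \<open>Crossing numbers of braid words\<close>

text \<open>
The position that the strand starting at a given position reaches when the word is read from the
left. This is the inverse of \<open>word_perm\<close>, which composes transpositions in the opposite order.
\<close>

fun track :: "nat word \<Rightarrow> nat \<Rightarrow> nat" where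
  "track [] a = a"
| "track ((i, s) # w) a = track w (transpose i (i + 1) a)"

text \<open>
The strands are named by their starting positions, so both indices are transported along the word.
\<close>

fun crossings :: "nat word \<Rightarrow> nat \<Rightarrow> nat \<Rightarrow> int" where
  "crossings [] a b = 0"
| "crossings ((i, s) # w) a b =
    (if {a, b} = {i, i + 1} then if s then 1 else -1 else 0) +
    crossings w (transpose i (i + 1) a) (transpose i (i + 1) b)"

lemma track_append [simp]: "track (u @ v) a = track v (track u a)"
  by (induction u a rule: track.induct) auto

text \<open>
This is the cocycle rule: the crossing numbers form a crossed homomorphism for the action of braids
on pairs of strands.
\<close>

lemma crossings_append [simp]:
  "crossings (u @ v) a b = crossings u a b + crossings v (track u a) (track u b)"
  by (induction u a b rule: crossings.induct) auto

lemma bij_track: "bij (track w)"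
proof (induction w)
  case Nil
  then show ?case by (simp add: bij_def inj_on_def surj_def)
next
  case (Cons x w)
  obtain i s where x: "x = (i, s)" by force
  have "track (x # w) = track w \<circ> transpose i (i + 1)"
    by (auto simp: x)
  then show ?case
    using bij_comp[OF bij_transpose Cons] by (simp only:)
qed

lemma track_eq_iff [simp]: "track w a = track w b \<longleftrightarrow> a = b"
  using bij_track[of w] by (auto simp: bij_def inj_def)

lemma track_notin: "w \<in> words {1..<n} \<Longrightarrow> a \<notin> {1..n} \<Longrightarrow> track w a = a"
  by (induction w a rule: track.induct) (auto simp: transpose_def)

lemma track_in: "w \<in> words {1..<n} \<Longrightarrow> track w a \<in> {1..n} \<longleftrightarrow> a \<in> {1..n}"
  by (induction w a rule: track.induct) (auto simp: transpose_def)

lemma crossings_sym: "crossings w a b = crossings w b a"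
  by (induction w a b rule: crossings.induct) (simp_all add: insert_commute)

lemma track_inv_word [simp]: "track (inv_word w) (track w a) = a"
  by (induction w a rule: track.induct) (auto simp: inv_word_def)

lemma track_inv_word' [simp]: "track w (track (inv_word w) a) = a"
  by (metis bij_track bij_pointE track_inv_word)

lemma crossings_inv_word:
  "crossings (inv_word w) (track w a) (track w b) = - crossings w a b"
proof (induction w a b rule: crossings.induct)
  case (2 i s w a b)
  have *: "{transpose i (i + 1) a, transpose i (i + 1) b} = {i, i + 1} \<longleftrightarrow> {a, b} = {i, i + 1}"
    by (auto simp: transpose_def doubleton_eq_iff)
  have "inv_word ((i, s) # w) = inv_word w @ [(i, \<not> s)]"
    by (simp add: inv_word_def)
  then show ?case
    using 2 * by auto
qed (simp add: inv_word_def)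

lemma word_perm_track: "word_perm w (track w a) = a"
  by (induction w a rule: track.induct) (auto simp: word_perm_def)

lemma word_perm_id_iff: "word_perm w = id \<longleftrightarrow> track w = id"
proof
  assume "word_perm w = id"
  then show "track w = id"
    using word_perm_track[of w] by (auto simp: fun_eq_iff)
next
  assume "track w = id"
  then show "word_perm w = id"
    using word_perm_track[of w] by (auto simp: fun_eq_iff)
qed

text \<open>
The crossing numbers are invariant because both sides of a braid relation let the same pairs cross,
each once and positively, and cancellation removes a crossing of a pair together with its inverse.
\<close>

lemma word_eq_track_crossings:
  "(u, v) \<in> word_eq {1..<n} (braid_relations n) \<Longrightarrow>
    track u = track v \<and> crossings u = crossings v"
proof (induction rule: word_eq.induct)
  case (rel u v)
  consider (braid) i where "u = pos_word [i, i + 1, i]" "v = pos_word [i + 1, i, i + 1]"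
    | (far) i j where "i + 2 \<le> j" "u = pos_word [i, j]" "v = pos_word [j, i]"
    using rel.hyps(1) by (auto simp: braid_relations_def)
  then show ?case
  proof cases
    case braid
    then show ?thesis
      by (auto simp: pos_word_def fun_eq_iff transpose_def doubleton_eq_iff)
  next
    case far
    then show ?thesis
      by (auto simp: pos_word_def fun_eq_iff transpose_def doubleton_eq_iff)
  qed
qed (auto simp: fun_eq_iff transpose_def doubleton_eq_iff)

section \<open>Permutation and crossing numbers of a class\<close>

\<comment> \<open>Otherwise the simplifier rewrites the index sets \<open>{1..<n}\<close> and the rules about them no longer apply.\<close>
declare One_nat_def [simp del]

definition word_class :: "nat \<Rightarrow> nat word \<Rightarrow> nat word set set" where
  "word_class n w = quot_class n (word_eq {1..<n} (braid_relations n) `` {w})"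

lemma carrier_braid_group:
  "x \<in> carrier (braid_group n) \<longleftrightarrow>
    (\<exists>w\<in>words {1..<n}. x = word_eq {1..<n} (braid_relations n) `` {w})"
  by (auto simp: braid_group_def presented_group_def quotient_def)

lemma word_class_append:
  assumes "u \<in> words {1..<n}" "v \<in> words {1..<n}"
  shows "word_class n (u @ v) = word_class n u \<otimes>\<^bsub>braid_quot n\<^esub> word_class n v"
proof -
  have "word_eq {1..<n} (braid_relations n) `` {u} \<in> carrier (braid_group n)"
    "word_eq {1..<n} (braid_relations n) `` {v} \<in> carrier (braid_group n)"
    using assms carrier_braid_group by blast+
  from hom_mult[OF normal.r_coset_hom_Mod[OF derived_pure_normal] this]
  show ?thesis
    using presented_group_mult[OF assms, of "braid_relations n"]
    by (simp add: word_class_def quot_class_def braid_quot_def braid_group_def)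
qed

lemma word_class_Nil: "word_class n [] = \<one>\<^bsub>braid_quot n\<^esub>"
proof -
  have "word_eq {1..<n} (braid_relations n) `` {[]} = \<one>\<^bsub>braid_group n\<^esub>"
    by (simp add: braid_group_def presented_group_def)
  then show ?thesis
    using normal_imp_subgroup[OF derived_pure_normal, of n]
    by (simp add: word_class_def quot_class_def braid_quot_def
        group.coset_mult_one[OF group_braid_group] subgroup.subset)
qed

lemma carrier_braid_quot:
  "X \<in> carrier (braid_quot n) \<longleftrightarrow> (\<exists>w\<in>words {1..<n}. X = word_class n w)"
proof -
  have "X \<in> carrier (braid_quot n) \<longleftrightarrow> (\<exists>x\<in>carrier (braid_group n). X = quot_class n x)"
    by (auto simp: braid_quot_def carrier_FactGroup quot_class_def)
  then show ?thesis
    unfolding Bex_def carrier_braid_group word_class_def by blast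
qed

lemma word_class_closed [simp]:
  "w \<in> words {1..<n} \<Longrightarrow> word_class n w \<in> carrier (braid_quot n)"
  using carrier_braid_quot by blast

lemma word_class_cong:
  "(u, v) \<in> word_eq {1..<n} (braid_relations n) \<Longrightarrow> word_class n u = word_class n v"
  by (simp add: word_class_def equiv_class_eq[OF equiv_word_eq])

lemma word_class_inv_word:
  assumes "w \<in> words {1..<n}"
  shows "word_class n (inv_word w) = inv\<^bsub>braid_quot n\<^esub> word_class n w"
proof (rule group.inv_equality[OF group_braid_quot, symmetric])
  show "word_class n (inv_word w) \<otimes>\<^bsub>braid_quot n\<^esub> word_class n w = \<one>\<^bsub>braid_quot n\<^esub>"
    using assms inv_word_in_words[OF assms] word_class_cong[OF inv_word_left[OF assms]]
    by (simp flip: word_class_append word_class_Nil)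
qed (use assms inv_word_in_words[OF assms] in auto)

lemma inv_word_class_braid_group:
  assumes "w \<in> words {1..<n}"
  shows "inv\<^bsub>braid_group n\<^esub> (word_eq {1..<n} (braid_relations n) `` {w})
    = word_eq {1..<n} (braid_relations n) `` {inv_word w}"
proof (rule group.inv_equality[OF group_braid_group])
  show "word_eq {1..<n} (braid_relations n) `` {inv_word w} \<otimes>\<^bsub>braid_group n\<^esub>
      word_eq {1..<n} (braid_relations n) `` {w} = \<one>\<^bsub>braid_group n\<^esub>"
    using assms inv_word_in_words[OF assms] inv_word_left[OF assms, of "braid_relations n"]
    by (simp add: braid_group_def presented_group_mult word_class_eq_iff)
      (simp add: presented_group_def equiv_class_eq[OF equiv_word_eq])
qed (use assms inv_word_in_words carrier_braid_group in blast)+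

text \<open>
On pure braids the cocycle rule has no twist, so crossing numbers are additive and vanish on
commutators. This is why they descend to the quotient.
\<close>

lemma derived_pure_track_crossings:
  assumes "x \<in> derived (braid_group n) (pure_braid_group n)"
  shows "\<exists>w\<in>words {1..<n}. x = word_eq {1..<n} (braid_relations n) `` {w} \<and>
    track w = id \<and> crossings w = (\<lambda>_ _. 0)"
proof -
  have commutator: "\<exists>w\<in>words {1..<n}. x = word_eq {1..<n} (braid_relations n) `` {w} \<and>
      track w = id \<and> crossings w = (\<lambda>_ _. 0)"
    if x: "x \<in> derived_set (braid_group n) (pure_braid_group n)" for x
  proof -
    obtain h1 h2 where h: "h1 \<in> pure_braid_group n" "h2 \<in> pure_braid_group n"
      "x = h1 \<otimes>\<^bsub>braid_group n\<^esub> h2 \<otimes>\<^bsub>braid_group n\<^esub> (inv\<^bsub>braid_group n\<^esub> h1)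
        \<otimes>\<^bsub>braid_group n\<^esub> (inv\<^bsub>braid_group n\<^esub> h2)"
      using x by blast
    have pure: "\<exists>w\<in>words {1..<n}. h = word_eq {1..<n} (braid_relations n) `` {w} \<and> track w = id"
      if "h \<in> pure_braid_group n" for h
      using that
      by (auto simp: pure_braid_group_def kernel_def carrier_braid_group braid_perm_class
          sym_group_one word_perm_id_iff)
    obtain u v where uv: "u \<in> words {1..<n}" "track u = id"
      "h1 = word_eq {1..<n} (braid_relations n) `` {u}" "v \<in> words {1..<n}" "track v = id"
      "h2 = word_eq {1..<n} (braid_relations n) `` {v}"
      using pure[OF h(1)] pure[OF h(2)] by blast
    have inv: "track (inv_word w) = id" "crossings (inv_word w) = - crossings w"
      if "track w = id" for w
      using that track_inv_word[of w] crossings_inv_word[of w] by (auto simp: fun_eq_iff)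
    show ?thesis
    proof (intro bexI conjI)
      show "u @ v @ inv_word u @ inv_word v \<in> words {1..<n}"
        using uv inv_word_in_words by auto
      show "x = word_eq {1..<n} (braid_relations n) `` {u @ v @ inv_word u @ inv_word v}"
        using uv inv_word_in_words[OF uv(1)] inv_word_in_words[OF uv(4)]
        by (simp add: h(3) inv_word_class_braid_group)
          (simp add: braid_group_def presented_group_mult)
    qed (use uv inv in \<open>auto simp: fun_eq_iff\<close>)
  qed
  show ?thesis
    using assms unfolding derived_def
proof (induction rule: generate.induct)
  case one
  have "\<one>\<^bsub>braid_group n\<^esub> = word_eq {1..<n} (braid_relations n) `` {[]}"
    by (simp add: braid_group_def presented_group_def)
  then show ?case
    by (intro bexI[of _ "[]"]) (auto simp: fun_eq_iff)
next
  case (incl h)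
  then show ?case
    by (rule commutator)
next
  case (inv h)
  then obtain w where w: "w \<in> words {1..<n}" "h = word_eq {1..<n} (braid_relations n) `` {w}"
    "track w = id" "crossings w = (\<lambda>_ _. 0)"
    using commutator by blast
  have "track (inv_word w) = id" "crossings (inv_word w) = (\<lambda>_ _. 0)"
    using w track_inv_word[of w] crossings_inv_word[of w] by (auto simp: fun_eq_iff)
  then show ?case
    using w inv_word_in_words[OF w(1)] by (auto simp: inv_word_class_braid_group)
next
  case (eng h1 h2)
  then obtain u v where uv: "u \<in> words {1..<n}" "v \<in> words {1..<n}"
    "h1 = word_eq {1..<n} (braid_relations n) `` {u}" "track u = id" "crossings u = (\<lambda>_ _. 0)"
    "h2 = word_eq {1..<n} (braid_relations n) `` {v}" "track v = id" "crossings v = (\<lambda>_ _. 0)"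
    by blast
  then show ?case
    by (intro bexI[of _ "u @ v"])
      (auto simp: braid_group_def presented_group_mult fun_eq_iff)
qed
qed

lemma word_class_eqD:
  assumes "word_class n u = word_class n v" "u \<in> words {1..<n}" "v \<in> words {1..<n}"
  shows "track u = track v" "crossings u = crossings v"
proof -
  have *: "word_eq {1..<n} (braid_relations n) `` {w} \<in> carrier (braid_group n)"
    if "w \<in> words {1..<n}" for w
    using that carrier_braid_group by blast
  have "word_eq {1..<n} (braid_relations n) `` {u} \<in> word_class n u"
    using group.rcos_self[OF group_braid_group * normal_imp_subgroup[OF derived_pure_normal]]
      assms(2) by (simp add: word_class_def quot_class_def)
  then have "word_eq {1..<n} (braid_relations n) `` {u} \<in> word_class n v"
    by (simp only: assms(1))
  then obtain d where d: "d \<in> derived (braid_group n) (pure_braid_group n)"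
    "word_eq {1..<n} (braid_relations n) `` {u} =
      d \<otimes>\<^bsub>braid_group n\<^esub> word_eq {1..<n} (braid_relations n) `` {v}"
    unfolding word_class_def quot_class_def r_coset_def by blast
  obtain w where w: "w \<in> words {1..<n}" "d = word_eq {1..<n} (braid_relations n) `` {w}"
    "track w = id" "crossings w = (\<lambda>_ _. 0)"
    using derived_pure_track_crossings[OF d(1)] by blast
  have "(u, w @ v) \<in> word_eq {1..<n} (braid_relations n)"
    using d(2) assms w(1)
    by (simp add: w(2) braid_group_def presented_group_mult word_class_eq_iff)
  then show "track u = track v" "crossings u = crossings v"
    using word_eq_track_crossings[of u "w @ v" n] w by (auto simp: fun_eq_iff)
qed

text \<open>
By \<open>word_class_eqD\<close> the chosen representative does not matter; the same holds for \<open>crs\<close>.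
\<close>

definition trk :: "nat \<Rightarrow> nat word set set \<Rightarrow> nat \<Rightarrow> nat" where
  "trk n X = track (SOME w. w \<in> words {1..<n} \<and> X = word_class n w)"

definition crs :: "nat \<Rightarrow> nat word set set \<Rightarrow> nat \<Rightarrow> nat \<Rightarrow> int" where
  "crs n X = crossings (SOME w. w \<in> words {1..<n} \<and> X = word_class n w)"

lemma trk_crs_word_class [simp]:
  assumes "w \<in> words {1..<n}"
  shows "trk n (word_class n w) = track w" "crs n (word_class n w) = crossings w"
proof -
  have "\<exists>v. v \<in> words {1..<n} \<and> word_class n w = word_class n v"
    using assms by blast
  from someI_ex[OF this] word_class_eqD[OF _ assms]
  show "trk n (word_class n w) = track w" "crs n (word_class n w) = crossings w"
    unfolding trk_def crs_def by metis+
qed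

context
  fixes n :: nat
begin

interpretation Q: group "braid_quot n"
  by (rule group_braid_quot)

lemma trk_one [simp]: "trk n \<one>\<^bsub>braid_quot n\<^esub> a = a"
  and crs_one [simp]: "crs n \<one>\<^bsub>braid_quot n\<^esub> a b = 0"
  by (simp_all flip: word_class_Nil)

lemma trk_mult [simp]:
  assumes "X \<in> carrier (braid_quot n)" "Y \<in> carrier (braid_quot n)"
  shows "trk n (X \<otimes>\<^bsub>braid_quot n\<^esub> Y) a = trk n Y (trk n X a)"
  using assms by (auto simp: carrier_braid_quot simp flip: word_class_append)

lemma crs_mult [simp]:
  assumes "X \<in> carrier (braid_quot n)" "Y \<in> carrier (braid_quot n)"
  shows "crs n (X \<otimes>\<^bsub>braid_quot n\<^esub> Y) a b = crs n X a b + crs n Y (trk n X a) (trk n X b)"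
  using assms by (auto simp: carrier_braid_quot simp flip: word_class_append)

lemma trk_eq_iff [simp]:
  assumes "X \<in> carrier (braid_quot n)"
  shows "trk n X a = trk n X b \<longleftrightarrow> a = b"
  using assms by (auto simp: carrier_braid_quot)

lemma trk_in:
  assumes "X \<in> carrier (braid_quot n)"
  shows "trk n X a \<in> {1..n} \<longleftrightarrow> a \<in> {1..n}"
  using assms by (auto simp: carrier_braid_quot track_in simp del: atLeastAtMost_iff)

lemma trk_notin:
  assumes "X \<in> carrier (braid_quot n)" "a \<notin> {1..n}"
  shows "trk n X a = a"
  using assms by (auto simp: carrier_braid_quot track_notin simp del: atLeastAtMost_iff)

lemma crs_sym:
  assumes "X \<in> carrier (braid_quot n)"
  shows "crs n X a b = crs n X b a"
  using assms by (auto simp: carrier_braid_quot intro: crossings_sym)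

lemma trk_inv [simp]:
  assumes "X \<in> carrier (braid_quot n)"
  shows "trk n (inv\<^bsub>braid_quot n\<^esub> X) (trk n X a) = a"
    and "trk n X (trk n (inv\<^bsub>braid_quot n\<^esub> X) a) = a"
  using assms
  by (auto simp: carrier_braid_quot inv_word_in_words simp flip: word_class_inv_word)

lemma crs_inv [simp]:
  assumes "X \<in> carrier (braid_quot n)"
  shows "crs n (inv\<^bsub>braid_quot n\<^esub> X) a b =
    - crs n X (trk n (inv\<^bsub>braid_quot n\<^esub> X) a) (trk n (inv\<^bsub>braid_quot n\<^esub> X) b)"
  using crs_mult[of "inv\<^bsub>braid_quot n\<^esub> X" X a b] assms by simp

lemma trk_conj:
  assumes "X \<in> carrier (braid_quot n)" "Y \<in> carrier (braid_quot n)" "trk n X = id"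
  shows "trk n (Y \<otimes>\<^bsub>braid_quot n\<^esub> X \<otimes>\<^bsub>braid_quot n\<^esub> inv\<^bsub>braid_quot n\<^esub> Y) = id"
  using assms by (auto simp: fun_eq_iff)

lemma crs_conj:
  assumes "X \<in> carrier (braid_quot n)" "Y \<in> carrier (braid_quot n)" "trk n X = id"
  shows "crs n (Y \<otimes>\<^bsub>braid_quot n\<^esub> X \<otimes>\<^bsub>braid_quot n\<^esub> inv\<^bsub>braid_quot n\<^esub> Y) a b =
    crs n X (trk n Y a) (trk n Y b)"
  using assms by simp

lemma crs_pow:
  assumes "X \<in> carrier (braid_quot n)" "trk n X = id"
  shows "trk n (X [^]\<^bsub>braid_quot n\<^esub> (k::nat)) = id"
    and "crs n (X [^]\<^bsub>braid_quot n\<^esub> k) a b = int k * crs n X a b"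
  using assms by (induction k) (auto simp: fun_eq_iff algebra_simps)

end

section \<open>Coxeter relations and the symmetric group\<close>

text \<open>
Equality of products of simple transpositions that follows from the Coxeter relations of the
symmetric group on \<open>{1..n}\<close>.
\<close>

inductive coxeter_eq :: "nat \<Rightarrow> nat list \<Rightarrow> nat list \<Rightarrow> bool" for n where
  refl: "set u \<subseteq> {1..<n} \<Longrightarrow> coxeter_eq n u u"
| sym: "coxeter_eq n u v \<Longrightarrow> coxeter_eq n v u"
| trans: "coxeter_eq n u v \<Longrightarrow> coxeter_eq n v w \<Longrightarrow> coxeter_eq n u w"
| append: "coxeter_eq n u u' \<Longrightarrow> coxeter_eq n v v' \<Longrightarrow> coxeter_eq n (u @ v) (u' @ v')"
| square: "i \<in> {1..<n} \<Longrightarrow> coxeter_eq n [i, i] []"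
| braid: "1 \<le> i \<Longrightarrow> i + 1 < n \<Longrightarrow> coxeter_eq n [i, i + 1, i] [i + 1, i, i + 1]"
| far: "1 \<le> i \<Longrightarrow> i + 2 \<le> j \<Longrightarrow> j < n \<Longrightarrow> coxeter_eq n [i, j] [j, i]"

lemma coxeter_eq_subset: "coxeter_eq n u v \<Longrightarrow> set u \<subseteq> {1..<n} \<and> set v \<subseteq> {1..<n}"
  by (induction rule: coxeter_eq.induct) auto

lemma coxeter_eq_track: "coxeter_eq n u v \<Longrightarrow> track (pos_word u) = track (pos_word v)"
proof (induction rule: coxeter_eq.induct)
  case (append u u' v v')
  then show ?case by (simp add: pos_word_def fun_eq_iff)
qed (auto simp: pos_word_def fun_eq_iff transpose_def)

lemma coxeter_eq_far_list:
  assumes "\<And>x. x \<in> set xs \<Longrightarrow> i + 2 \<le> x \<or> x + 2 \<le> i" "set xs \<subseteq> {1..<n}" "i \<in> {1..<n}"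
  shows "coxeter_eq n (xs @ [i]) (i # xs)"
  using assms(1,2)
proof (induction xs)
  case Nil
  then show ?case using assms(3) by (auto intro: coxeter_eq.refl)
next
  case (Cons x xs)
  have "coxeter_eq n [x] [x]" "coxeter_eq n (xs @ [i]) (i # xs)" "coxeter_eq n xs xs"
    using Cons by (auto intro: coxeter_eq.refl)
  moreover have "coxeter_eq n [x, i] [i, x]"
    using Cons.prems assms(3) coxeter_eq.far[of i x n] coxeter_eq.far[of x i n]
    by (auto intro: coxeter_eq.sym)
  ultimately have "coxeter_eq n ([x] @ (xs @ [i])) ([x] @ (i # xs))"
    "coxeter_eq n ([x, i] @ xs) ([i, x] @ xs)"
    by (blast intro: coxeter_eq.append)+
  then show ?case
    by (auto intro: coxeter_eq.trans)
qed

text \<open>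
Multiplying a descending run by one more generator either lengthens the run, shortens it, or lets
the generator pass through, where it comes out unchanged or lowered by one.
\<close>

lemma coxeter_descending_append:
  assumes "1 \<le> c" "c \<le> Suc k" "i \<in> {1..k}" "k < n"
  shows "\<exists>v c'. set v \<subseteq> {1..<k} \<and> 1 \<le> c' \<and> c' \<le> Suc k \<and>
    coxeter_eq n (rev [c..<Suc k] @ [i]) (v @ rev [c'..<Suc k])"
proof -
  have refl: "coxeter_eq n u u" if "set u \<subseteq> {1..k}" for u
    using that assms(4) by (intro coxeter_eq.refl) auto
  consider "i + 1 = c" | "i = c" | "i + 1 < c" | "c < i" by linarith
  then show ?thesis
  proof cases
    case 1
    then have "rev [c..<Suc k] @ [i] = [] @ rev [i..<Suc k]"
      using assms by (simp add: upt_conv_Cons del: upt_Suc flip: 1) (simp only: Suc_eq_plus1)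
    then show ?thesis
      using assms 1 by (intro exI[of _ "[]"] exI[of _ i]) (auto intro!: refl)
  next
    case 2
    then have "rev [c..<Suc k] @ [i] = rev [Suc c..<Suc k] @ [c, c]"
      using assms by (simp add: upt_conv_Cons del: upt_Suc)
    moreover have "coxeter_eq n (rev [Suc c..<Suc k] @ [c, c]) (rev [Suc c..<Suc k] @ [])"
      using assms 2 by (intro coxeter_eq.append coxeter_eq.square refl) auto
    ultimately show ?thesis
      using assms 2 by (intro exI[of _ "[]"] exI[of _ "Suc c"]) auto
  next
    case 3
    then have "coxeter_eq n (rev [c..<Suc k] @ [i]) (i # rev [c..<Suc k])"
      using assms by (intro coxeter_eq_far_list) auto
    then show ?thesis
      using assms 3 by (intro exI[of _ "[i]"] exI[of _ c]) (auto simp del: upt_Suc)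
  next
    case 4
    \<comment> \<open>The generator commutes with the lower part, turns into \<open>i - 1\<close> by a braid relation, and then commutes with the upper part.\<close>
    let ?h = "rev [Suc i..<Suc k]" and ?l = "rev [c..<i - 1]"
    have "[c..<Suc k] = [c..<i - 1] @ [i - 1..<Suc k]"
      using assms 4 upt_add_eq_append[of c "i - 1" "Suc k - (i - 1)"] by simp
    also have "[i - 1..<Suc k] = [i - 1, i] @ [Suc i..<Suc k]"
      using assms 4 by (simp add: upt_conv_Cons del: upt_Suc)
    finally have split: "rev [c..<Suc k] = ?h @ [i, i - 1] @ ?l"
      by simp
    have sub: "set ?h \<subseteq> {1..k}" "set ?l \<subseteq> {1..k}"
      using assms 4 by auto
    have 1: "coxeter_eq n (?l @ [i]) (i # ?l)"
      using assms 4 by (intro coxeter_eq_far_list) auto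
    have 2: "coxeter_eq n [i, i - 1, i] [i - 1, i, i - 1]"
      using assms 4 coxeter_eq.sym[OF coxeter_eq.braid[of "i - 1" n]] by auto
    have 3: "coxeter_eq n (?h @ [i - 1]) ((i - 1) # ?h)"
      using assms 4 by (intro coxeter_eq_far_list) auto
    have "coxeter_eq n ((?h @ [i, i - 1]) @ (?l @ [i])) ((?h @ [i, i - 1]) @ (i # ?l))"
      using assms 4 sub by (intro coxeter_eq.append refl 1) auto
    moreover have "coxeter_eq n (?h @ [i, i - 1, i] @ ?l) (?h @ [i - 1, i, i - 1] @ ?l)"
      using assms 4 sub by (intro coxeter_eq.append refl 2) auto
    moreover have "coxeter_eq n ((?h @ [i - 1]) @ ([i, i - 1] @ ?l)) (((i - 1) # ?h) @ ([i, i - 1] @ ?l))"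
      using assms 4 sub by (intro coxeter_eq.append refl 3) auto
    ultimately have "coxeter_eq n (rev [c..<Suc k] @ [i]) ([i - 1] @ rev [c..<Suc k])"
      unfolding split by (simp del: upt_Suc) (meson coxeter_eq.trans)
    then show ?thesis
      using assms 4 by (intro exI[of _ "[i - 1]"] exI[of _ c]) auto
  qed
qed

text \<open>
The descending runs represent the cosets of the subgroup that fixes the last point.
\<close>

lemma coxeter_normal_form:
  assumes "set u \<subseteq> {1..k}" "k < n"
  shows "\<exists>v c. set v \<subseteq> {1..<k} \<and> 1 \<le> c \<and> c \<le> Suc k \<and>
    coxeter_eq n u (v @ rev [c..<Suc k])"
  using assms(1)
proof (induction u rule: rev_induct)
  case Nil
  show ?case
    by (intro exI[of _ "[]"] exI[of _ "Suc k"]) (auto intro: coxeter_eq.refl)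
next
  case (snoc i u)
  then obtain v c where v: "set v \<subseteq> {1..<k}" "1 \<le> c" "c \<le> Suc k"
    "coxeter_eq n u (v @ rev [c..<Suc k])"
    by auto
  obtain v' c' where v': "set v' \<subseteq> {1..<k}" "1 \<le> c'" "c' \<le> Suc k"
    "coxeter_eq n (rev [c..<Suc k] @ [i]) (v' @ rev [c'..<Suc k])"
    using coxeter_descending_append[OF v(2,3) _ assms(2), of i] snoc.prems by auto
  have "coxeter_eq n [i] [i]" "coxeter_eq n v v"
    using snoc.prems assms(2) v(1) by (auto intro!: coxeter_eq.refl)
  then have "coxeter_eq n (u @ [i]) ((v @ rev [c..<Suc k]) @ [i])"
    "coxeter_eq n (v @ (rev [c..<Suc k] @ [i])) (v @ (v' @ rev [c'..<Suc k]))"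
    using v v' by (blast intro: coxeter_eq.append)+
  then have "coxeter_eq n (u @ [i]) ((v @ v') @ rev [c'..<Suc k])"
    by (auto intro: coxeter_eq.trans simp del: upt_Suc)
  moreover have "set (v @ v') \<subseteq> {1..<k}"
    using v v' by auto
  ultimately show ?case
    using v' by blast
qed

lemma track_descending:
  "c \<le> d \<Longrightarrow> track (map (\<lambda>i. (i, s)) (rev [c..<d])) a =
    (if a = d then c else if c \<le> a \<and> a < d then a + 1 else a)"
proof (induction d arbitrary: a)
  case (Suc d)
  show ?case
  proof (cases "c = Suc d")
    case False
    then show ?thesis
      using Suc by (auto simp: transpose_def)
  qed auto
qed auto

text \<open>
A permutation determines its normal form: the last point goes to the lower end of the descending
run, so for the identity the run is empty and one strand can be dropped.
\<close>

lemma coxeter_eq_Nil: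
  assumes "set u \<subseteq> {1..<k}" "k \<le> n" "track (pos_word u) = id"
  shows "coxeter_eq n u []"
  using assms
proof (induction k arbitrary: u)
  case 0
  then show ?case by (auto intro: coxeter_eq.refl)
next
  case (Suc k)
  have "set u \<subseteq> {1..k}" using Suc.prems by auto
  then obtain v c where v: "set v \<subseteq> {1..<k}" "1 \<le> c" "c \<le> Suc k"
    "coxeter_eq n u (v @ rev [c..<Suc k])"
    using coxeter_normal_form[of u k n] Suc.prems by auto
  have "pos_word v \<in> words {1..<k}"
    using v(1) by (induction v) (auto simp: pos_word_def)
  then have "track (pos_word v) (Suc k) = Suc k"
    by (rule track_notin) auto
  then have "track (pos_word (v @ rev [c..<Suc k])) (Suc k) = c"
    using track_descending[OF v(3), of True "Suc k"] by (simp add: pos_word_def del: upt_Suc)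
  then have c: "c = Suc k"
    using coxeter_eq_track[OF v(4)] Suc.prems(3) by (metis id_apply)
  then have uv: "coxeter_eq n u v"
    using v(4) by simp
  then have "coxeter_eq n v []"
    using Suc.IH[OF v(1)] Suc.prems coxeter_eq_track[OF uv] by simp
  then show ?case
    using uv by (blast intro: coxeter_eq.trans)
qed

section \<open>Conjugation of the generators of the pure braid group\<close>

definition conj_by :: "('a, 'b) monoid_scheme \<Rightarrow> 'a \<Rightarrow> 'a \<Rightarrow> 'a" where
  "conj_by G x y = x \<otimes>\<^bsub>G\<^esub> y \<otimes>\<^bsub>G\<^esub> inv\<^bsub>G\<^esub> x"

context group
begin

lemma conj_by_closed [simp]:
  "x \<in> carrier G \<Longrightarrow> y \<in> carrier G \<Longrightarrow> conj_by G x y \<in> carrier G"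
  by (simp add: conj_by_def)

lemma conj_by_mult_left:
  "\<lbrakk>x \<in> carrier G; y \<in> carrier G; z \<in> carrier G\<rbrakk> \<Longrightarrow> conj_by G (x \<otimes> y) z = conj_by G x (conj_by G y z)"
  by (simp add: conj_by_def inv_mult_group m_assoc)

lemma conj_by_mult:
  "\<lbrakk>x \<in> carrier G; y \<in> carrier G; z \<in> carrier G\<rbrakk> \<Longrightarrow>
    conj_by G x (y \<otimes> z) = conj_by G x y \<otimes> conj_by G x z"
  by (simp add: conj_by_def m_assoc inv_solve_left)

lemma conj_by_square:
  "\<lbrakk>x \<in> carrier G; y \<in> carrier G; x \<otimes> y = y \<otimes> x\<rbrakk> \<Longrightarrow> conj_by G x (y \<otimes> y) = y \<otimes> y"
  by (simp add: conj_by_mult) (simp add: conj_by_def m_assoc)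

lemma conj_by_inv_cancel:
  "\<lbrakk>x \<in> carrier G; y \<in> carrier G\<rbrakk> \<Longrightarrow> conj_by G (inv x) (conj_by G x y) = y"
  by (simp add: conj_by_def m_assoc inv_solve_left')

lemma conj_by_eq_iff:
  "\<lbrakk>x \<in> carrier G; y \<in> carrier G; z \<in> carrier G\<rbrakk> \<Longrightarrow> conj_by G x y = z \<longleftrightarrow> x \<otimes> y = z \<otimes> x"
  by (auto simp: conj_by_def inv_solve_right')

end

text \<open>
Applied to the braid group and to its quotient, this evaluates the products in the definitions of
\<open>pure_gen\<close> and \<open>delta_block\<close>.
\<close>

lemma list_mult_map_letters:
  assumes "\<And>u v. u \<in> words S \<Longrightarrow> v \<in> words S \<Longrightarrow> f (u @ v) = f u \<otimes>\<^bsub>G\<^esub> f v" "f [] = \<one>\<^bsub>G\<^esub>"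
    and "set xs \<subseteq> S"
  shows "list_mult G (map (\<lambda>k. f [(k, b)]) xs) = f (map (\<lambda>k. (k, b)) xs)"
  using assms(3)
proof (induction xs)
  case (Cons x xs)
  have "map (\<lambda>k. (k, b)) xs \<in> words S"
    using Cons.prems by (auto simp: words_def)
  then show ?case
    using Cons assms(1)[of "[(x, b)]" "map (\<lambda>k. (k, b)) xs"] by (auto simp: list_mult_def)
qed (simp add: list_mult_def assms(2))

lemma map_letters_in_words: "set xs \<subseteq> S \<Longrightarrow> map (\<lambda>k. (k, b)) xs \<in> words S"
  by (auto simp: words_def)

definition pure_word :: "nat \<Rightarrow> nat \<Rightarrow> nat word" where
  "pure_word i j = map (\<lambda>k. (k, True)) (rev [i + 1..<j]) @ [(i, True), (i, True)] @
    map (\<lambda>k. (k, False)) [i + 1..<j]"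

lemma pure_word_in_words: "1 \<le> i \<Longrightarrow> i < j \<Longrightarrow> j \<le> n \<Longrightarrow> pure_word i j \<in> words {1..<n}"
  by (auto simp: pure_word_def intro!: map_letters_in_words)

abbreviation letter :: "nat \<Rightarrow> nat \<Rightarrow> nat word set set" where
  "letter n k \<equiv> word_class n [(k, True)]"

lemma quot_class_braid_gen: "quot_class n (braid_gen n i) = word_class n [(i, True)]"
  by (simp add: braid_gen_def word_class_def)

lemma pure_gen_eq:
  assumes "1 \<le> i" "i < j" "j \<le> n"
  shows "pure_gen n i j = word_eq {1..<n} (braid_relations n) `` {pure_word i j}"
proof -
  let ?c = "\<lambda>w. word_eq {1..<n} (braid_relations n) `` {w}"
  let ?B = "braid_group n"
  interpret B: group ?B by (rule group_braid_group)
  have mult: "?c (u @ v) = ?c u \<otimes>\<^bsub>?B\<^esub> ?c v" if "u \<in> words {1..<n}" "v \<in> words {1..<n}" for u v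
    using that by (simp add: braid_group_def presented_group_mult)
  have one: "?c [] = \<one>\<^bsub>?B\<^esub>"
    by (simp add: braid_group_def presented_group_def)
  have lm: "list_mult ?B (map (\<lambda>k. ?c [(k, b)]) xs) = ?c (map (\<lambda>k. (k, b)) xs)"
    if "set xs \<subseteq> {1..<n}" for b xs
    by (rule list_mult_map_letters[OF mult one that])
  have car: "?c w \<in> carrier ?B" if "w \<in> words {1..<n}" for w
    using that carrier_braid_group by blast
  have "inv\<^bsub>?B\<^esub> ?c [(k, True)] = ?c [(k, False)]" if "k \<in> {1..<n}" for k
    using inv_word_class_braid_group[of "[(k, True)]" n] that by (simp add: inv_word_def)
  then have "map (\<lambda>k. inv\<^bsub>?B\<^esub> ?c [(k, True)]) [i + 1..<j] = map (\<lambda>k. ?c [(k, False)]) [i + 1..<j]"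
    using assms by (intro map_cong) auto
  moreover have "?c [(i, True)] [^]\<^bsub>?B\<^esub> (2::nat) = ?c [(i, True), (i, True)]"
    using car[of "[(i, True)]"] mult[of "[(i, True)]" "[(i, True)]"] assms
    by (simp add: numeral_2_eq_2)
  moreover have "braid_gen n = (\<lambda>k. ?c [(k, True)])"
    by (simp add: fun_eq_iff braid_gen_def)
  moreover have "set [i + 1..<j] \<subseteq> {1..<n}" "set (rev [i + 1..<j]) \<subseteq> {1..<n}"
    using assms by auto
  ultimately have "pure_gen n i j = ?c (map (\<lambda>k. (k, True)) (rev [i + 1..<j])) \<otimes>\<^bsub>?B\<^esub>
      ?c [(i, True), (i, True)] \<otimes>\<^bsub>?B\<^esub> ?c (map (\<lambda>k. (k, False)) [i + 1..<j])"
    unfolding pure_gen_def Let_def by (simp only: lm)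
  also have "\<dots> = ?c (pure_word i j)"
    using assms mult[of "map (\<lambda>k. (k, True)) (rev [i + 1..<j])" "[(i, True), (i, True)]"]
      mult[of "map (\<lambda>k. (k, True)) (rev [i + 1..<j]) @ [(i, True), (i, True)]"
        "map (\<lambda>k. (k, False)) [i + 1..<j]"] pure_word_in_words[OF assms]
    by (simp add: pure_word_def)
  finally show ?thesis .
qed

lemma A_cls_eq:
  assumes "1 \<le> i" "i < j" "j \<le> n"
  shows "A_cls n i j = word_class n (pure_word i j)"
  using assms by (simp add: A_cls_def pure_gen_eq word_class_def)

lemma pure_commute:
  assumes "X \<in> carrier (braid_quot n)" "Y \<in> carrier (braid_quot n)" "trk n X = id" "trk n Y = id"
  shows "X \<otimes>\<^bsub>braid_quot n\<^esub> Y = Y \<otimes>\<^bsub>braid_quot n\<^esub> X"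
proof -
  let ?c = "\<lambda>w. word_eq {1..<n} (braid_relations n) `` {w}"
  let ?B = "braid_group n"
  let ?D = "derived ?B (pure_braid_group n)"
  interpret B: group ?B by (rule group_braid_group)
  obtain u v where uv: "u \<in> words {1..<n}" "X = word_class n u" "v \<in> words {1..<n}" "Y = word_class n v"
    using assms(1,2) by (auto simp: carrier_braid_quot)
  have car: "?c w \<in> carrier ?B" if "w \<in> words {1..<n}" for w
    using that carrier_braid_group by blast
  have "?c u \<in> pure_braid_group n" "?c v \<in> pure_braid_group n"
    using uv assms(3,4) car
    by (auto simp: pure_braid_group_def kernel_def braid_perm_class sym_group_one word_perm_id_iff)
  then have "?c u \<otimes>\<^bsub>?B\<^esub> ?c v \<otimes>\<^bsub>?B\<^esub> inv\<^bsub>?B\<^esub> ?c u \<otimes>\<^bsub>?B\<^esub> inv\<^bsub>?B\<^esub> ?c v \<in> ?D"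
    unfolding derived_def by (intro generate.incl) blast
  then have "?D #>\<^bsub>?B\<^esub> (?c u \<otimes>\<^bsub>?B\<^esub> ?c v \<otimes>\<^bsub>?B\<^esub> inv\<^bsub>?B\<^esub> ?c u \<otimes>\<^bsub>?B\<^esub> inv\<^bsub>?B\<^esub> ?c v) = ?D"
    using normal_imp_subgroup[OF derived_pure_normal] car uv
    by (intro B.coset_join2) auto
  then have "word_class n (u @ v @ inv_word u @ inv_word v) = \<one>\<^bsub>braid_quot n\<^esub>"
    using uv inv_word_in_words[OF uv(1)] inv_word_in_words[OF uv(3)]
    by (simp add: inv_word_class_braid_group word_class_def quot_class_def braid_quot_def)
      (simp add: braid_group_def presented_group_mult)
  then have "X \<otimes>\<^bsub>braid_quot n\<^esub> Y \<otimes>\<^bsub>braid_quot n\<^esub> (inv\<^bsub>braid_quot n\<^esub> X \<otimes>\<^bsub>braid_quot n\<^esub> inv\<^bsub>braid_quot n\<^esub> Y)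
      = \<one>\<^bsub>braid_quot n\<^esub>"
    using uv inv_word_in_words[OF uv(1)] inv_word_in_words[OF uv(3)]
    by (simp add: word_class_append word_class_inv_word group.is_monoid[OF group_braid_quot]
        monoid.m_assoc[OF group.is_monoid[OF group_braid_quot]]
        group.inv_closed[OF group_braid_quot] monoid.m_closed[OF group.is_monoid[OF group_braid_quot]])
  moreover have "inv\<^bsub>braid_quot n\<^esub> X \<otimes>\<^bsub>braid_quot n\<^esub> inv\<^bsub>braid_quot n\<^esub> Y = inv\<^bsub>braid_quot n\<^esub> (Y \<otimes>\<^bsub>braid_quot n\<^esub> X)"
    using assms by (simp add: group.inv_mult_group[OF group_braid_quot])
  ultimately show ?thesis
    using assms group_braid_quot[of n]
    by (simp add: group.inv_solve_right' group.is_monoid monoid.m_closed)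
qed

context
  fixes n :: nat
begin

interpretation Q: group "braid_quot n"
  by (rule group_braid_quot)

lemma letter_closed [simp]: "k \<in> {1..<n} \<Longrightarrow> word_class n [(k, s)] \<in> carrier (braid_quot n)"
  by (intro word_class_closed) auto

lemma inv_letter: "k \<in> {1..<n} \<Longrightarrow> inv\<^bsub>braid_quot n\<^esub> word_class n [(k, True)] = word_class n [(k, False)]"
  using word_class_inv_word[of "[(k, True)]" n] by (simp add: inv_word_def)

lemma A_cls_closed [simp]:
  "1 \<le> i \<Longrightarrow> i < j \<Longrightarrow> j \<le> n \<Longrightarrow> A_cls n i j \<in> carrier (braid_quot n)"
  by (simp add: A_cls_eq pure_word_in_words)

lemma A_cls_Suc_same:
  assumes "1 \<le> i" "i < n"
  shows "A_cls n i (Suc i) = word_class n [(i, True)] \<otimes>\<^bsub>braid_quot n\<^esub> word_class n [(i, True)]"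
  using assms by (simp add: A_cls_eq pure_word_def flip: word_class_append)

lemma A_cls_Suc:
  assumes "1 \<le> i" "i < j" "j < n"
  shows "A_cls n i (Suc j) = conj_by (braid_quot n) (word_class n [(j, True)]) (A_cls n i j)"
proof -
  have "pure_word i (Suc j) = [(j, True)] @ pure_word i j @ [(j, False)]"
    using assms by (simp add: pure_word_def)
  then show ?thesis
    using assms pure_word_in_words[of i j n]
    by (simp add: A_cls_eq conj_by_def inv_letter word_class_append Q.m_assoc
        del: append_Cons append_Nil)
qed

text \<open>
Conjugation by \<open>\<sigma>\<^sub>j\<close> moves the pair \<open>{i, j}\<close>, on which the two strands twist once around each
other, to \<open>{i, j + 1}\<close>.
\<close>

lemma crs_A_cls:
  assumes "1 \<le> i" "i < j" "j \<le> n"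
  shows "trk n (A_cls n i j) = id"
    and "crs n (A_cls n i j) a b = (if {a, b} = {i, j} then 2 else 0)"
proof -
  have "trk n (A_cls n i j) = id \<and> (\<forall>a b. crs n (A_cls n i j) a b = (if {a, b} = {i, j} then 2 else 0))"
    using Suc_leI[OF assms(2)] assms
  proof (induction j rule: dec_induct)
    case base
    then show ?case
      by (auto simp: A_cls_Suc_same fun_eq_iff transpose_def doubleton_eq_iff)
  next
    case (step j)
    have id: "trk n (A_cls n i j) = id"
      by (rule conjunct1[OF step.IH]) (use step in auto)
    have "crs n (A_cls n i (Suc j)) a b = crs n (A_cls n i j) (transpose j (Suc j) a) (transpose j (Suc j) b)" for a b
      using step crs_conj[OF _ _ id, of "word_class n [(j, True)]" a b]
      by (simp add: A_cls_Suc conj_by_def del: crs_mult flip: Suc_eq_plus1)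
    moreover have "trk n (A_cls n i (Suc j)) = id"
      using step trk_conj[OF _ _ id] by (simp add: A_cls_Suc conj_by_def)
    moreover have "{transpose j (Suc j) a, transpose j (Suc j) b} = {i, j} \<longleftrightarrow> {a, b} = {i, Suc j}" for a b
      using step by (auto simp: transpose_def doubleton_eq_iff split: if_splits)
    ultimately show ?case
      using step by simp
  qed
  then show "trk n (A_cls n i j) = id"
    "crs n (A_cls n i j) a b = (if {a, b} = {i, j} then 2 else 0)"
    by auto
qed

lemma letter_far_commute:
  assumes "i \<in> {1..<n}" "j \<in> {1..<n}" "i + 2 \<le> j"
  shows "word_class n [(i, True)] \<otimes>\<^bsub>braid_quot n\<^esub> word_class n [(j, True)] =
    word_class n [(j, True)] \<otimes>\<^bsub>braid_quot n\<^esub> word_class n [(i, True)]"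
proof -
  have "(pos_word [i, j], pos_word [j, i]) \<in> braid_relations n"
    using assms by (auto simp: braid_relations_def)
  then have "(pos_word [i, j], pos_word [j, i]) \<in> word_eq {1..<n} (braid_relations n)"
    using assms by (intro word_eq.rel) (auto simp: pos_word_def)
  from word_class_cong[OF this] show ?thesis
    using assms by (simp add: pos_word_def flip: word_class_append)
qed

lemma letter_braid:
  assumes "1 \<le> i" "i + 1 < n"
  shows "word_class n [(i, True)] \<otimes>\<^bsub>braid_quot n\<^esub> word_class n [(i + 1, True)] \<otimes>\<^bsub>braid_quot n\<^esub> word_class n [(i, True)] =
    word_class n [(i + 1, True)] \<otimes>\<^bsub>braid_quot n\<^esub> word_class n [(i, True)] \<otimes>\<^bsub>braid_quot n\<^esub> word_class n [(i + 1, True)]"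
proof -
  have "(pos_word [i, i + 1, i], pos_word [i + 1, i, i + 1]) \<in> braid_relations n"
    using assms by (auto simp: braid_relations_def)
  then have "(pos_word [i, i + 1, i], pos_word [i + 1, i, i + 1]) \<in> word_eq {1..<n} (braid_relations n)"
    using assms by (intro word_eq.rel) (auto simp: pos_word_def)
  from word_class_cong[OF this] show ?thesis
    using assms by (simp add: pos_word_def flip: word_class_append)
qed

text \<open>
The square of \<open>\<sigma>\<^sub>k\<close> is pure and pure classes commute, so on the \<open>A\<^bsub>i,j\<^esub>\<close> conjugation by
\<open>\<sigma>\<^sub>k\<close> is an involution. The lemmas below determine which permutation of the \<open>A\<^bsub>i,j\<^esub>\<close> it is.
\<close>

lemma conj_letter_square:
  assumes "k \<in> {1..<n}" "1 \<le> i" "i < j" "j \<le> n"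
  shows "conj_by (braid_quot n) (letter n k) (conj_by (braid_quot n) (letter n k) (A_cls n i j)) = A_cls n i j"
proof -
  have "trk n (letter n k \<otimes>\<^bsub>braid_quot n\<^esub> letter n k) = id"
    using assms by (auto simp: fun_eq_iff)
  then have "conj_by (braid_quot n) (letter n k \<otimes>\<^bsub>braid_quot n\<^esub> letter n k) (A_cls n i j) = A_cls n i j"
    using assms crs_A_cls(1)[of i j] by (simp add: Q.conj_by_eq_iff pure_commute)
  then show ?thesis
    using assms by (simp add: Q.conj_by_mult_left)
qed

lemma conj_letter_swap:
  assumes "k \<in> {1..<n}" "l \<in> {1..<n}" "k + 2 \<le> l \<or> l + 2 \<le> k" "X \<in> carrier (braid_quot n)"
  shows "conj_by (braid_quot n) (letter n k) (conj_by (braid_quot n) (letter n l) X) = conj_by (braid_quot n) (letter n l) (conj_by (braid_quot n) (letter n k) X)"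
  using assms letter_far_commute[of k l] letter_far_commute[of l k]
  by (auto simp flip: Q.conj_by_mult_left)

lemma conj_letter_above:
  assumes "1 \<le> i" "i < j" "j < k" "k < n"
  shows "conj_by (braid_quot n) (letter n k) (A_cls n i j) = A_cls n i j"
  using Suc_leI[OF assms(2)] assms
proof (induction j rule: dec_induct)
  case base
  then show ?case
    using letter_far_commute[of i k]
    by (simp add: A_cls_Suc_same Q.conj_by_square)
next
  case (step j)
  then show ?case
    by (simp add: A_cls_Suc conj_letter_swap)
qed

lemma conj_letter_below:
  assumes "1 \<le> k" "k + 1 < i" "i < j" "j \<le> n"
  shows "conj_by (braid_quot n) (letter n k) (A_cls n i j) = A_cls n i j"
  using Suc_leI[OF assms(3)] assms
proof (induction j rule: dec_induct)
  case base
  then show ?case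
    using letter_far_commute[of k i]
    by (simp add: A_cls_Suc_same Q.conj_by_square)
next
  case (step j)
  then show ?case
    by (simp add: A_cls_Suc conj_letter_swap)
qed

text \<open>
Moving \<open>\<sigma>\<^sub>k\<close> past \<open>\<sigma>\<^bsub>k+1\<^esub> \<sigma>\<^sub>k\<close> by the braid relation turns it into \<open>\<sigma>\<^bsub>k+1\<^esub>\<close>, which commutes with
\<open>A\<^bsub>i,k\<^esub>\<close>.
\<close>

lemma conj_letter_between:
  assumes "1 \<le> i" "i < k" "k + 1 < j" "j \<le> n"
  shows "conj_by (braid_quot n) (letter n k) (A_cls n i j) = A_cls n i j"
proof -
  have "k + 2 \<le> j" using assms by simp
  then show ?thesis
    using assms
  proof (induction j rule: dec_induct)
    case base
    have 1: "A_cls n i (k + 2) = conj_by (braid_quot n) (letter n (k + 1)) (conj_by (braid_quot n) (letter n k) (A_cls n i k))"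
      using base by (simp add: A_cls_Suc flip: Suc_eq_plus1)
    have "conj_by (braid_quot n) (letter n k) (A_cls n i (k + 2)) = conj_by (braid_quot n) (letter n k \<otimes>\<^bsub>braid_quot n\<^esub> letter n (k + 1) \<otimes>\<^bsub>braid_quot n\<^esub> letter n k) (A_cls n i k)"
      using base unfolding 1 by (simp add: Q.conj_by_mult_left)
    also have "\<dots> = conj_by (braid_quot n) (letter n (k + 1) \<otimes>\<^bsub>braid_quot n\<^esub> letter n k \<otimes>\<^bsub>braid_quot n\<^esub> letter n (k + 1)) (A_cls n i k)"
      using base by (simp only: letter_braid)
    also have "\<dots> = conj_by (braid_quot n) (letter n (k + 1)) (conj_by (braid_quot n) (letter n k) (conj_by (braid_quot n) (letter n (k + 1)) (A_cls n i k)))"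
      using base by (simp add: Q.conj_by_mult_left)
    also have "\<dots> = A_cls n i (k + 2)"
      using base unfolding 1 by (simp add: conj_letter_above)
    finally show ?case .
  next
    case (step j)
    then show ?case
      by (simp add: A_cls_Suc conj_letter_swap)
  qed
qed

text \<open>
The braid relation says that conjugation by \<open>\<sigma>\<^bsub>i-1\<^esub> \<sigma>\<^sub>i\<close> takes \<open>\<sigma>\<^bsub>i-1\<^esub>\<close> to \<open>\<sigma>\<^sub>i\<close>, hence
takes the square of one to the square of the other; conjugating once more by \<open>\<sigma>\<^bsub>i-1\<^esub>\<close> and using
the involution gives the claim.
\<close>

lemma conj_letter_pred:
  assumes "1 < i" "i < j" "j \<le> n"
  shows "conj_by (braid_quot n) (letter n (i - 1)) (A_cls n i j) = A_cls n (i - 1) j"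
  using Suc_leI[OF assms(2)] assms
proof (induction j rule: dec_induct)
  case base
  let ?x = "letter n (i - 1)" and ?y = "letter n i"
  have c: "?x \<in> carrier (braid_quot n)" "?y \<in> carrier (braid_quot n)"
    using base by (auto intro!: letter_closed)
  have "?x \<otimes>\<^bsub>braid_quot n\<^esub> ?y \<otimes>\<^bsub>braid_quot n\<^esub> ?x = ?y \<otimes>\<^bsub>braid_quot n\<^esub> ?x \<otimes>\<^bsub>braid_quot n\<^esub> ?y"
    using base letter_braid[of "i - 1"] by simp
  then have y: "conj_by (braid_quot n) ?x (conj_by (braid_quot n) ?y ?x) = ?y"
    using c by (simp add: Q.conj_by_eq_iff Q.m_assoc flip: Q.conj_by_mult_left)
  have 1: "A_cls n (i - 1) (Suc i) = conj_by (braid_quot n) ?y (?x \<otimes>\<^bsub>braid_quot n\<^esub> ?x)"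
    using base A_cls_Suc[of "i - 1" i] A_cls_Suc_same[of "i - 1"] by simp
  have "conj_by (braid_quot n) ?x (A_cls n (i - 1) (Suc i)) = A_cls n i (Suc i)"
    using base c y unfolding 1 by (simp add: Q.conj_by_mult A_cls_Suc_same)
  then have "conj_by (braid_quot n) ?x (A_cls n i (Suc i)) = conj_by (braid_quot n) ?x (conj_by (braid_quot n) ?x (A_cls n (i - 1) (Suc i)))"
    by simp
  then show ?case
    using base conj_letter_square[of "i - 1" "i - 1" "Suc i"] by simp
next
  case (step j)
  then show ?case
    using conj_letter_swap[of "i - 1" j "A_cls n i j"] le_diff_conv2[of 1 i 1]
    by (simp add: A_cls_Suc)
qed

lemma conj_letter_A_cls:
  assumes "k \<in> {1..<n}" "1 \<le> i" "i < j" "j \<le> n"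
  shows "\<exists>i' j'. 1 \<le> i' \<and> i' < j' \<and> j' \<le> n \<and> conj_by (braid_quot n) (letter n k) (A_cls n i j) = A_cls n i' j'"
proof -
  have witness: ?thesis
    if "conj_by (braid_quot n) (letter n k) (A_cls n i j) = A_cls n i' j'" "1 \<le> i'" "i' < j'" "j' \<le> n" for i' j'
    using that by blast
  consider "j < k" | "j = k" | "k + 1 = j" "i < k" | "k + 1 = j" "i = k" | "i < k" "k + 1 < j"
    | "i = k" "k + 1 < j" | "k + 1 = i" | "k + 1 < i"
    using assms by linarith
  then show ?thesis
  proof cases
    case 1
    then show ?thesis using assms by (intro witness[of i j] conj_letter_above) auto
  next
    case 2
    then show ?thesis using assms by (intro witness[of i "Suc j"]) (auto simp: A_cls_Suc)
  next
    case 3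
    then have "A_cls n i j = conj_by (braid_quot n) (letter n k) (A_cls n i k)"
      using assms A_cls_Suc[of i k] by (simp flip: 3(1) Suc_eq_plus1)
    then show ?thesis
      using assms 3 by (intro witness[of i k]) (auto simp: conj_letter_square)
  next
    case 4
    then have "A_cls n i j = letter n k \<otimes>\<^bsub>braid_quot n\<^esub> letter n k"
      using assms A_cls_Suc_same[of k] by (simp flip: 4(1) Suc_eq_plus1)
    then have "conj_by (braid_quot n) (letter n k) (A_cls n i j) = A_cls n i j"
      using assms by (simp add: Q.conj_by_square)
    then show ?thesis using assms by (intro witness[of i j])
  next
    case 5
    then show ?thesis using assms by (intro witness[of i j] conj_letter_between) auto
  next
    case 6
    then have "A_cls n i j = conj_by (braid_quot n) (letter n k) (A_cls n (k + 1) j)"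
      using assms conj_letter_pred[of "k + 1" j] by simp
    then show ?thesis
      using assms 6 by (intro witness[of "k + 1" j]) (auto simp: conj_letter_square)
  next
    case 7
    then have "conj_by (braid_quot n) (letter n k) (A_cls n i j) = A_cls n k j"
      using assms conj_letter_pred[of i j] by (simp flip: 7)
    then show ?thesis
      using assms 7 by (intro witness[of k j]) auto
  next
    case 8
    then show ?thesis using assms by (intro witness[of i j] conj_letter_below) auto
  qed
qed

end

context
  fixes n :: nat
begin

interpretation Q: group "braid_quot n"
  by (rule group_braid_quot)

section \<open>Crossing numbers determine the class\<close>

definition band_gens :: "nat word set set set" where
  "band_gens = {A_cls n i j | i j. 1 \<le> i \<and> i < j \<and> j \<le> n}"

lemma band_gens_closed: "band_gens \<subseteq> carrier (braid_quot n)"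
  by (auto simp: band_gens_def)

lemma conj_letter_band_gens:
  assumes "k \<in> {1..<n}" "x \<in> band_gens"
  shows "conj_by (braid_quot n) (word_class n [(k, b)]) x \<in> band_gens"
proof -
  obtain i j where ij: "1 \<le> i" "i < j" "j \<le> n" "x = A_cls n i j"
    using assms(2) by (auto simp: band_gens_def)
  let ?s = "word_class n [(k, True)]"
  have pos: "conj_by (braid_quot n) ?s x \<in> band_gens"
    using conj_letter_A_cls[OF assms(1) ij(1-3)] unfolding ij(4) band_gens_def by blast
  have "conj_by (braid_quot n) (inv\<^bsub>braid_quot n\<^esub> ?s) x = conj_by (braid_quot n) (inv\<^bsub>braid_quot n\<^esub> ?s)
      (conj_by (braid_quot n) ?s (conj_by (braid_quot n) ?s x))"
    using conj_letter_square[OF assms(1) ij(1-3)] ij(4) by simp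
  also have "\<dots> = conj_by (braid_quot n) ?s x"
    using assms(1) ij by (simp add: Q.conj_by_inv_cancel)
  finally have "conj_by (braid_quot n) (word_class n [(k, False)]) x = conj_by (braid_quot n) ?s x"
    using assms(1) by (simp add: inv_letter)
  then show ?thesis
    using pos by (cases b) auto
qed

lemma normal_band_subgroup: "generate (braid_quot n) band_gens \<lhd> braid_quot n"
proof (rule Q.normal_generateI[OF band_gens_closed])
  fix h g
  assume h: "h \<in> band_gens" and "g \<in> carrier (braid_quot n)"
  then obtain w where w: "w \<in> words {1..<n}" "g = word_class n w"
    by (auto simp: carrier_braid_quot)
  have "conj_by (braid_quot n) (word_class n w) h \<in> band_gens"
    using w(1)
  proof (induction w)
    case Nil
    then show ?case
      using h band_gens_closed by (auto simp: word_class_Nil conj_by_def)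
  next
    case (Cons a w)
    then have "word_class n (a # w) = word_class n [a] \<otimes>\<^bsub>braid_quot n\<^esub> word_class n w"
      using word_class_append[of "[a]" n w] by simp
    moreover have "word_class n [a] \<in> carrier (braid_quot n)" "h \<in> carrier (braid_quot n)"
      using Cons.prems h band_gens_closed by auto
    ultimately show ?case
      using Cons conj_letter_band_gens[of "fst a" _ "snd a"] by (simp add: Q.conj_by_mult_left)
  qed
  then show "g \<otimes>\<^bsub>braid_quot n\<^esub> h \<otimes>\<^bsub>braid_quot n\<^esub> inv\<^bsub>braid_quot n\<^esub> g \<in> band_gens"
    using w by (simp add: conj_by_def)
qed

text \<open>
The subgroup \<open>N\<close> generated by the \<open>A\<^bsub>i,j\<^esub>\<close> is normal and contains \<open>\<sigma>\<^sub>k\<^sup>2 = A\<^bsub>k,k+1\<^esub>\<close>. So the classes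
of the \<open>\<sigma>\<^sub>k\<close> modulo \<open>N\<close> satisfy the Coxeter relations, and a word with trivial permutation becomes trivial
modulo \<open>N\<close>.
\<close>

lemma pure_in_band_subgroup:
  assumes "X \<in> carrier (braid_quot n)" "trk n X = id"
  shows "X \<in> generate (braid_quot n) band_gens"
proof -
  let ?N = "generate (braid_quot n) band_gens"
  interpret N: normal ?N "braid_quot n"
    by (rule normal_band_subgroup)
  define \<rho> where "\<rho> w = ?N #>\<^bsub>braid_quot n\<^esub> word_class n w" for w
  let ?H = "braid_quot n Mod ?N"
  interpret H: group ?H
    by (rule N.factorgroup_is_group)
  have hom: "\<rho> (u @ v) = \<rho> u \<otimes>\<^bsub>?H\<^esub> \<rho> v" if "u \<in> words {1..<n}" "v \<in> words {1..<n}" for u v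
    using that hom_mult[OF N.r_coset_hom_Mod, of "word_class n u" "word_class n v"]
    by (simp add: \<rho>_def word_class_append)
  have closed [simp]: "\<rho> w \<in> carrier ?H" if "w \<in> words {1..<n}" for w
    using that by (auto simp: \<rho>_def carrier_FactGroup)
  have one: "\<rho> [] = \<one>\<^bsub>?H\<^esub>"
    by (simp add: \<rho>_def word_class_Nil N.subset)
  have sq: "\<rho> [(k, True), (k, True)] = \<one>\<^bsub>?H\<^esub>" if "k \<in> {1..<n}" for k
  proof -
    have eq: "word_class n [(k, True), (k, True)] = A_cls n k (Suc k)"
      using that A_cls_Suc_same[of k n] word_class_append[of "[(k, True)]" n "[(k, True)]"] by auto
    have "A_cls n k (Suc k) \<in> band_gens"
      using that unfolding band_gens_def by (intro CollectI exI[of _ k] exI[of _ "Suc k"]) auto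
    then have "word_class n [(k, True), (k, True)] \<in> ?N"
      unfolding eq by (rule generate.incl)
    then show ?thesis
      using that by (simp add: \<rho>_def Q.coset_join2 N.subgroup_axioms)
  qed
  have cong: "\<rho> u = \<rho> v" if "(u, v) \<in> word_eq {1..<n} (braid_relations n)" for u v
    using word_class_cong[OF that] by (simp add: \<rho>_def)
  have cox: "\<rho> (pos_word u) = \<rho> (pos_word v)" if "coxeter_eq n u v" for u v
    using that
  proof (induction rule: coxeter_eq.induct)
    case (append u u' v v')
    then have "pos_word u \<in> words {1..<n}" "pos_word v \<in> words {1..<n}"
      "pos_word u' \<in> words {1..<n}" "pos_word v' \<in> words {1..<n}"
      unfolding pos_word_def using coxeter_eq_subset by (blast intro!: map_letters_in_words)+
    then show ?case
      using append by (simp add: pos_word_def hom)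
  next
    case (square i)
    then show ?case using sq one by (simp add: pos_word_def)
  next
    case (braid i)
    have "(pos_word [i, i + 1, i], pos_word [i + 1, i, i + 1]) \<in> braid_relations n"
      using braid by (auto simp: braid_relations_def)
    then show ?case
      using braid by (intro cong word_eq.rel) (auto simp: pos_word_def)
  next
    case (far i j)
    have "(pos_word [i, j], pos_word [j, i]) \<in> braid_relations n"
      using far by (auto simp: braid_relations_def)
    then show ?case
      using far by (intro cong word_eq.rel) (auto simp: pos_word_def)
  qed auto
  have pos: "\<rho> w = \<rho> (pos_word (map fst w)) \<and> track w = track (pos_word (map fst w))"
    if "w \<in> words {1..<n}" for w
    using that
  proof (induction w)
    case (Cons a w)
    obtain k b where a: "a = (k, b)" by force
    have k: "k \<in> {1..<n}" "w \<in> words {1..<n}" using Cons.prems a by auto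
    \<comment> \<open>Modulo \<open>N\<close> the signs of the letters do not matter, because squares are trivial.\<close>
    have "\<rho> [(k, False)] = \<rho> [(k, True)]"
    proof -
      have "([(k, False), (k, True)] @ [(k, True)], [] @ [(k, True)]) \<in> word_eq {1..<n} (braid_relations n)"
        using word_eq.cancel[OF k(1), of False "braid_relations n"] k(1)
        by (intro word_eq.append word_eq.refl) simp_all
      from cong[OF this] have "\<rho> [(k, True)] = \<rho> ([(k, False)] @ [(k, True), (k, True)])"
        by simp
      also have "\<dots> = \<rho> [(k, False)] \<otimes>\<^bsub>?H\<^esub> \<rho> [(k, True), (k, True)]"
        using k(1) by (intro hom) simp_all
      also have "\<dots> = \<rho> [(k, False)]"
        unfolding sq[OF k(1)] using k(1) by (intro H.r_one closed) simp
      finally show ?thesis by simp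
    qed
    then have "\<rho> [a] = \<rho> [(k, True)]"
      using a by (cases b) simp_all
    moreover have "\<rho> ([a] @ w) = \<rho> [a] \<otimes>\<^bsub>?H\<^esub> \<rho> w"
      using k a by (intro hom) simp_all
    moreover have "\<rho> ([(k, True)] @ pos_word (map fst w)) = \<rho> [(k, True)] \<otimes>\<^bsub>?H\<^esub> \<rho> (pos_word (map fst w))"
      using k unfolding pos_word_def
      by (intro hom map_letters_in_words) (auto simp: words_def)
    ultimately have "\<rho> (a # w) = \<rho> (pos_word (map fst (a # w)))"
      using Cons.IH[OF k(2)] by (simp add: a pos_word_def)
    moreover have "track (a # w) = track (pos_word (map fst (a # w)))"
      using Cons.IH[OF k(2)] by (simp add: a pos_word_def fun_eq_iff)
    ultimately show ?case
      by blast
  qed (simp add: pos_word_def)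
  obtain w where w: "w \<in> words {1..<n}" "X = word_class n w"
    using assms(1) by (auto simp: carrier_braid_quot)
  have "set (map fst w) \<subseteq> {1..<n}"
    using w(1) by (auto simp: words_def)
  moreover have "track (pos_word (map fst w)) = id"
    using assms(2) w pos by auto
  ultimately have "coxeter_eq n (map fst w) []"
    by (intro coxeter_eq_Nil) auto
  then have "\<rho> (pos_word (map fst w)) = \<rho> (pos_word [])"
    by (rule cox)
  then have "\<rho> w = \<one>\<^bsub>?H\<^esub>"
    using pos[OF w(1)] one by (simp add: pos_word_def)
  then have "?N #>\<^bsub>braid_quot n\<^esub> X = ?N"
    by (simp add: \<rho>_def w(2))
  then show ?thesis
    using assms(1) Q.coset_join1[of ?N X] N.subgroup_axioms by (simp add: N.subset)
qed

definition pure_quot :: "nat word set set monoid" where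
  "pure_quot = (braid_quot n)\<lparr>carrier := {X \<in> carrier (braid_quot n). trk n X = id}\<rparr>"

lemma comm_group_pure: "comm_group pure_quot"
proof -
  have inv: "trk n (inv\<^bsub>braid_quot n\<^esub> X) = id" if "X \<in> carrier (braid_quot n)" "trk n X = id" for X
    using trk_inv(2)[OF that(1)] that(2) by (auto simp: fun_eq_iff)
  have "subgroup {X \<in> carrier (braid_quot n). trk n X = id} (braid_quot n)"
    by (rule Q.subgroupI) (auto simp: inv fun_eq_iff intro: exI[of _ "\<one>\<^bsub>braid_quot n\<^esub>"])
  then have "group pure_quot"
    unfolding pure_quot_def by (rule Q.subgroup_imp_group)
  then show ?thesis
  proof (rule group.group_comm_groupI)
    fix x y assume "x \<in> carrier pure_quot" "y \<in> carrier pure_quot"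
    then show "x \<otimes>\<^bsub>pure_quot\<^esub> y = y \<otimes>\<^bsub>pure_quot\<^esub> x"
      using pure_commute[of x n y] by (simp add: pure_quot_def)
  qed
qed

text \<open>
The map \<open>E\<close> that sends integer exponents to the corresponding product of the \<open>A\<^bsub>i,j\<^esub>\<close> is a homomorphism. It
inverts half the crossing numbers on each \<open>A\<^bsub>i,j\<^esub>\<close>, hence on the subgroup they generate, which
is everything pure.
\<close>

lemma pure_eq_one:
  assumes "X \<in> carrier (braid_quot n)" "trk n X = id"
    "\<And>i j. 1 \<le> i \<Longrightarrow> i < j \<Longrightarrow> j \<le> n \<Longrightarrow> crs n X i j = 0"
  shows "X = \<one>\<^bsub>braid_quot n\<^esub>"
proof -
  interpret P: comm_group pure_quot by (rule comm_group_pure)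
  define I where "I = {(i, j). 1 \<le> i \<and> i < j \<and> j \<le> n}"
  have fin: "finite I"
    by (rule finite_subset[of _ "{1..n} \<times> {1..n}"]) (auto simp: I_def)
  have P: "Y \<in> carrier pure_quot \<longleftrightarrow> Y \<in> carrier (braid_quot n) \<and> trk n Y = id"
    "Y \<otimes>\<^bsub>pure_quot\<^esub> Z = Y \<otimes>\<^bsub>braid_quot n\<^esub> Z" "\<one>\<^bsub>pure_quot\<^esub> = \<one>\<^bsub>braid_quot n\<^esub>" for Y Z
    by (auto simp: pure_quot_def)
  have A: "A_cls n i j \<in> carrier pure_quot" if "(i, j) \<in> I" for i j
    using that crs_A_cls(1)[of i j n] by (auto simp: I_def P)
  define E where "E c = finprod pure_quot (\<lambda>(i, j). A_cls n i j [^]\<^bsub>pure_quot\<^esub> (c i j :: int)) I" for c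
  have E_closed: "E c \<in> carrier pure_quot" for c
    unfolding E_def using A by (intro P.finprod_closed) (auto simp: Pi_def intro!: P.int_pow_closed)
  have E_add: "E (\<lambda>i j. c i j + d i j) = E c \<otimes>\<^bsub>pure_quot\<^esub> E d" for c d
  proof -
    let ?f = "\<lambda>c ij. case ij of (i, j) \<Rightarrow> A_cls n i j [^]\<^bsub>pure_quot\<^esub> (c i j :: int)"
    have closed: "?f c \<in> I \<rightarrow> carrier pure_quot" for c
      using A by (auto intro: P.int_pow_closed)
    have "E (\<lambda>i j. c i j + d i j) = finprod pure_quot (\<lambda>ij. ?f c ij \<otimes>\<^bsub>pure_quot\<^esub> ?f d ij) I"
      unfolding E_def
    proof (rule P.finprod_cong'[OF HOL.refl])
      show "(\<lambda>ij. ?f c ij \<otimes>\<^bsub>pure_quot\<^esub> ?f d ij) \<in> I \<rightarrow> carrier pure_quot"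
        using closed by (intro Pi_I P.m_closed) (blast dest: funcset_mem)+
      fix ij assume "ij \<in> I"
      then show "?f (\<lambda>i j. c i j + d i j) ij = ?f c ij \<otimes>\<^bsub>pure_quot\<^esub> ?f d ij"
        using A P.int_pow_mult by (cases ij) (simp only: prod.case)
    qed
    also have "\<dots> = E c \<otimes>\<^bsub>pure_quot\<^esub> E d"
      unfolding E_def by (rule P.finprod_multf[OF closed closed])
    finally show ?thesis .
  qed
  have E_zero: "E c = \<one>\<^bsub>pure_quot\<^esub>" if "\<And>i j. (i, j) \<in> I \<Longrightarrow> c i j = 0" for c
    unfolding E_def using that by (intro P.finprod_one_eqI) auto
  have E_A: "E (\<lambda>a b. crs n (A_cls n i j) a b div 2) = A_cls n i j" if "(i, j) \<in> I" for i j
  proof -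
    have "A_cls n a b [^]\<^bsub>pure_quot\<^esub> (crs n (A_cls n i j) a b div 2) =
        (if (i, j) = (a, b) then A_cls n i j else \<one>\<^bsub>pure_quot\<^esub>)" if "(a, b) \<in> I" for a b
    proof -
      have "crs n (A_cls n i j) a b = (if (i, j) = (a, b) then 2 else 0)"
        using that \<open>(i, j) \<in> I\<close> by (auto simp: I_def crs_A_cls doubleton_eq_iff)
      then show ?thesis
        using A[OF that] by simp
    qed
    note power = this
    have "E (\<lambda>a b. crs n (A_cls n i j) a b div 2) =
        finprod pure_quot (\<lambda>ab. if (i, j) = ab then A_cls n i j else \<one>\<^bsub>pure_quot\<^esub>) I"
      unfolding E_def
    proof (rule P.finprod_cong'[OF HOL.refl])
      show "(\<lambda>ab. if (i, j) = ab then A_cls n i j else \<one>\<^bsub>pure_quot\<^esub>) \<in> I \<rightarrow> carrier pure_quot"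
        using A[OF that] by simp
      fix ab assume "ab \<in> I"
      then show "(case ab of (a, b) \<Rightarrow> A_cls n a b [^]\<^bsub>pure_quot\<^esub> (crs n (A_cls n i j) a b div 2)) =
          (if (i, j) = ab then A_cls n i j else \<one>\<^bsub>pure_quot\<^esub>)"
        using power by (cases ab) (simp only: prod.case)
    qed
    also have "\<dots> = A_cls n i j"
      using that A fin by (subst P.finprod_singleton) auto
    finally show ?thesis .
  qed
  have "X \<in> generate (braid_quot n) band_gens"
    using assms by (intro pure_in_band_subgroup)
  then have "X \<in> carrier pure_quot \<and> (\<forall>i j. even (crs n X i j)) \<and> X = E (\<lambda>a b. crs n X a b div 2)"
  proof (induction rule: generate.induct)
    case one
    have "E (\<lambda>a b. crs n \<one>\<^bsub>braid_quot n\<^esub> a b div 2) = \<one>\<^bsub>pure_quot\<^esub>"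
      by (intro E_zero) simp
    then show ?case
      using P.one_closed by (simp only: P(3)) simp
  next
    case (incl h)
    then obtain i j where h: "(i, j) \<in> I" "h = A_cls n i j"
      by (auto simp: band_gens_def I_def)
    have "even (crs n h a b)" for a b
      using h by (auto simp: crs_A_cls I_def)
    then show ?case
      using A[OF h(1)] E_A[OF h(1)] unfolding h(2)[symmetric] by blast
  next
    case (inv h)
    then obtain i j where h: "(i, j) \<in> I" "h = A_cls n i j"
      by (auto simp: band_gens_def I_def)
    have hc: "h \<in> carrier (braid_quot n)" "trk n h = id"
      using A[OF h(1)] h(2) by (auto simp: P)
    have "inv\<^bsub>braid_quot n\<^esub> h = inv\<^bsub>pure_quot\<^esub> h"
    proof (rule Q.inv_equality)
      have Ah: "h \<in> carrier pure_quot" using A[OF h(1)] h(2) by simp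
      show "inv\<^bsub>pure_quot\<^esub> h \<otimes>\<^bsub>braid_quot n\<^esub> h = \<one>\<^bsub>braid_quot n\<^esub>"
        using P.l_inv[OF Ah] by (simp only: P(2,3))
      show "inv\<^bsub>pure_quot\<^esub> h \<in> carrier (braid_quot n)"
        using P.inv_closed[OF Ah] P(1) by blast
    qed (rule hc(1))
    moreover have "trk n (inv\<^bsub>braid_quot n\<^esub> h) = id"
      using trk_inv(2)[OF hc(1)] hc(2) by (auto simp: fun_eq_iff)
    moreover have "crs n (inv\<^bsub>braid_quot n\<^esub> h) a b = - crs n h a b" for a b
      using hc calculation(2) by simp
    moreover have "inv\<^bsub>pure_quot\<^esub> h = E (\<lambda>a b. (- crs n h a b) div 2)"
    proof (rule P.inv_equality)
      have "E (\<lambda>a b. (- crs n h a b) div 2 + crs n h a b div 2) = \<one>\<^bsub>pure_quot\<^esub>"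
        using h by (intro E_zero) (auto simp: crs_A_cls I_def)
      then show "E (\<lambda>a b. (- crs n h a b) div 2) \<otimes>\<^bsub>pure_quot\<^esub> h = \<one>\<^bsub>pure_quot\<^esub>"
        using E_add[of "\<lambda>a b. (- crs n h a b) div 2" "\<lambda>a b. crs n h a b div 2"] E_A[OF h(1)] h(2)
        by simp
    qed (simp_all add: A[OF h(1)] h(2) E_closed)
    moreover have "even (crs n h a b)" for a b
      using h by (auto simp: crs_A_cls I_def)
    ultimately show ?case
      using Q.inv_closed[OF hc(1)] by (simp add: P)
  next
    case (eng h1 h2)
    then have h: "h1 \<in> carrier (braid_quot n)" "h2 \<in> carrier (braid_quot n)" "trk n h1 = id" "trk n h2 = id"
      by (simp_all add: P)
    have crs: "crs n (h1 \<otimes>\<^bsub>braid_quot n\<^esub> h2) a b = crs n h1 a b + crs n h2 a b" for a b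
      using h by simp
    have "h1 \<otimes>\<^bsub>braid_quot n\<^esub> h2 =
        E (\<lambda>a b. crs n h1 a b div 2) \<otimes>\<^bsub>pure_quot\<^esub> E (\<lambda>a b. crs n h2 a b div 2)"
      using eng by (simp add: P)
    also have "\<dots> = E (\<lambda>a b. crs n h1 a b div 2 + crs n h2 a b div 2)"
      by (rule E_add[symmetric])
    also have "\<dots> = E (\<lambda>a b. crs n (h1 \<otimes>\<^bsub>braid_quot n\<^esub> h2) a b div 2)"
      using eng by (simp only: crs div_plus_div_distrib_dvd_left)
    finally have "h1 \<otimes>\<^bsub>braid_quot n\<^esub> h2 = E (\<lambda>a b. crs n (h1 \<otimes>\<^bsub>braid_quot n\<^esub> h2) a b div 2)" .
    moreover have "even (crs n (h1 \<otimes>\<^bsub>braid_quot n\<^esub> h2) a b)" for a b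
      using eng by (simp only: crs) simp
    moreover have "trk n (h1 \<otimes>\<^bsub>braid_quot n\<^esub> h2) = id"
      using h by (simp add: fun_eq_iff)
    ultimately show ?case
      unfolding P(1) using Q.m_closed[OF h(1,2)] by blast
  qed
  then have "X = E (\<lambda>a b. crs n X a b div 2)"
    by blast
  also have "\<dots> = \<one>\<^bsub>pure_quot\<^esub>"
    using assms(3) by (intro E_zero) (simp add: I_def)
  finally show ?thesis
    by (simp only: P)
qed

lemma braid_quot_eqI:
  assumes "X \<in> carrier (braid_quot n)" "Y \<in> carrier (braid_quot n)" "trk n X = trk n Y"
    "\<And>i j. 1 \<le> i \<Longrightarrow> i < j \<Longrightarrow> j \<le> n \<Longrightarrow> crs n X i j = crs n Y i j"
  shows "X = Y"
proof -
  let ?Z = "X \<otimes>\<^bsub>braid_quot n\<^esub> inv\<^bsub>braid_quot n\<^esub> Y"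
  have "trk n ?Z a = a" for a
    using trk_inv(1)[OF assms(2)] assms(1,2) by (simp add: assms(3))
  then have id: "trk n ?Z = id"
    by (simp add: fun_eq_iff)
  have "crs n ?Z i j = crs n X i j - crs n Y i j" for i j
    using assms(1,2) by (simp add: assms(3))
  then have "?Z = \<one>\<^bsub>braid_quot n\<^esub>"
    using assms(1,2,4) id by (intro pure_eq_one) simp_all
  then show ?thesis
    using assms(1,2) Q.inv_solve_right'[of "\<one>\<^bsub>braid_quot n\<^esub>" X Y] by simp
qed

end

section \<open>The crossing numbers of a rotation are a coboundary\<close>

definition delta_word :: "nat \<Rightarrow> nat \<Rightarrow> nat word" where
  "delta_word N M = map (\<lambda>k. (k, True)) (rev [N + (M + 1) div 2..<N + M]) @
    map (\<lambda>k. (k, False)) (rev [N + 1..<N + (M + 1) div 2])"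

lemma delta_word_in_words: "N + M \<le> n \<Longrightarrow> 0 < M \<Longrightarrow> delta_word N M \<in> words {1..<n}"
  unfolding delta_word_def words_simps by (intro conjI map_letters_in_words) auto

lemma delta_block_eq:
  assumes "N + M \<le> n" "0 < M"
  shows "delta_block n N M = word_class n (delta_word N M)"
proof -
  let ?h = "(M + 1) div 2"
  have 1: "set (rev [N + ?h..<N + M]) \<subseteq> {1..<n}" and 2: "set (rev [N + 1..<N + ?h]) \<subseteq> {1..<n}"
    using assms by auto
  have lm: "list_mult (braid_quot n) (map (\<lambda>k. word_class n [(k, b)]) xs) = word_class n (map (\<lambda>k. (k, b)) xs)"
    if "set xs \<subseteq> {1..<n}" for b xs
    by (rule list_mult_map_letters[OF word_class_append word_class_Nil that])
  have inv: "map (\<lambda>k. inv\<^bsub>braid_quot n\<^esub> word_class n [(k, True)]) (rev [N + 1..<N + ?h]) =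
      map (\<lambda>k. word_class n [(k, False)]) (rev [N + 1..<N + ?h])"
    using 2 by (intro map_cong HOL.refl inv_letter) auto
  show ?thesis
    unfolding delta_block_def Let_def quot_class_braid_gen inv lm[OF 1] lm[OF 2] delta_word_def
    by (rule word_class_append[symmetric]) (intro map_letters_in_words 1 2)+
qed

lemma crossings_descending:
  "c \<le> d \<Longrightarrow> crossings (map (\<lambda>i. (i, s)) (rev [c..<d])) a b =
    (if a = d \<and> c \<le> b \<and> b < d \<or> b = d \<and> c \<le> a \<and> a < d then if s then 1 else -1 else 0)"
proof (induction d arbitrary: a b)
  case (Suc d)
  show ?case
  proof (cases "c = Suc d")
    case False
    then have "c \<le> d" using Suc.prems by simp
    then show ?thesis
      unfolding upt_Suc_append[OF \<open>c \<le> d\<close>] using Suc.IH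
      by (auto simp: transpose_def doubleton_eq_iff)
  qed auto
qed auto

text \<open>
The function whose coboundary is the crossing number function of \<open>\<delta>\<close> on the strands
\<open>N + 1, \<dots>, N + M\<close>: it marks the pairs whose positions differ by at most \<open>M div 2\<close>. When the block is rotated,
only pairs containing the last strand change their distance, from \<open>d\<close> to \<open>M - d\<close>; for odd \<open>M\<close> exactly one
of these two is at most \<open>M div 2\<close>.
\<close>

definition near :: "nat \<Rightarrow> nat \<Rightarrow> nat \<Rightarrow> nat \<Rightarrow> int" where
  "near N M a b = (if N < a \<and> a \<le> N + M \<and> N < b \<and> b \<le> N + M \<and>
    a \<le> b + M div 2 \<and> b \<le> a + M div 2 then 1 else 0)"

text \<open>
In \<open>\<delta>\<close> the last strand of the block crosses all others, those of the upper half positively and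
those of the lower half negatively. That sign is \<open>near\<close> before minus \<open>near\<close> after the rotation.
\<close>

lemma delta_block_track_crossings:
  assumes "N + M \<le> n" "odd M"
  shows "delta_block n N M \<in> carrier (braid_quot n)"
    and "trk n (delta_block n N M) a =
      (if a = N + M then N + 1 else if N < a \<and> a < N + M then a + 1 else a)"
    and "crs n (delta_block n N M) a b =
      near N M a b - near N M (trk n (delta_block n N M) a) (trk n (delta_block n N M) b)"
proof -
  have M: "0 < M" using assms(2) by (rule odd_pos)
  note eq = delta_block_eq[OF assms(1) M] and w = delta_word_in_words[OF assms(1) M]
  show "delta_block n N M \<in> carrier (braid_quot n)"
    using w by (simp add: eq)
  obtain h where h: "M = 2 * h + 1" using assms(2) by (auto elim: oddE)
  have dw: "delta_word N M = map (\<lambda>k. (k, True)) (rev [N + h + 1..<N + M]) @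
      map (\<lambda>k. (k, False)) (rev [N + 1..<N + h + 1])"
  proof -
    have "(M + 1) div 2 = h + 1" by (simp add: h)
    then show ?thesis
      by (simp only: delta_word_def add.assoc)
  qed
  have tr: "trk n (delta_block n N M) a =
      (if a = N + M then N + 1 else if N < a \<and> a < N + M then a + 1 else a)" for a
    using w unfolding eq dw by (simp add: track_descending h del: map_map upt_Suc rev_map)
  then show "trk n (delta_block n N M) a =
      (if a = N + M then N + 1 else if N < a \<and> a < N + M then a + 1 else a)" .
  have "crs n (delta_block n N M) a b =
      crossings (map (\<lambda>k. (k, True)) (rev [N + h + 1..<N + M])) a b +
      crossings (map (\<lambda>k. (k, False)) (rev [N + 1..<N + h + 1]))
        (if a = N + M then N + h + 1 else if N + h + 1 \<le> a \<and> a < N + M then a + 1 else a)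
        (if b = N + M then N + h + 1 else if N + h + 1 \<le> b \<and> b < N + M then b + 1 else b)"
    using w unfolding eq dw by (simp add: track_descending h del: upt_Suc)
  also have "\<dots> = near N M a b - near N M (trk n (delta_block n N M) a) (trk n (delta_block n N M) b)"
    unfolding tr near_def by (simp add: crossings_descending h del: upt_Suc) linarith
  finally show "crs n (delta_block n N M) a b =
      near N M a b - near N M (trk n (delta_block n N M) a) (trk n (delta_block n N M) b)" .
qed

text \<open>
The block sizes \<open>p\<^sub>j\<^bsup>r\<^sub>j\<^esup>\<close> enter in three ways: odd sizes make the crossing numbers of \<open>\<delta>\<close> a
coboundary, sizes of at least three give two distinct strands to twist and \<open>n \<ge> 3\<close>, and coprime sizes
make all pairs between two blocks a single orbit of the powers of \<open>\<delta>\<close>.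
\<close>

locale odd_blocks =
  fixes t :: nat and m :: "nat \<Rightarrow> nat"
  assumes t_pos: "1 \<le> t"
    and block_odd: "\<And>j. j \<in> {1..t} \<Longrightarrow> odd (m j)"
    and block_ge_3: "\<And>j. j \<in> {1..t} \<Longrightarrow> 3 \<le> m j"
    and block_coprime: "\<And>i j. i \<in> {1..t} \<Longrightarrow> j \<in> {1..t} \<Longrightarrow> i \<noteq> j \<Longrightarrow> coprime (m i) (m j)"
begin

abbreviation "n \<equiv> total t m"
abbreviation "q \<equiv> hol_order t m"
abbreviation "Q \<equiv> braid_quot n"

sublocale Q: group Q
  by (rule group_braid_quot)

lemma m_pos [simp]: "j \<in> {1..t} \<Longrightarrow> 0 < m j"
  using block_ge_3[of j] by simp

lemma q_pos: "0 < q"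
  unfolding hol_order_def by (intro prod_pos) simp

lemma offset_pred: "1 \<le> j \<Longrightarrow> offset m (j - 1) + m j = offset m j"
  by (cases j) (simp_all add: offset_def)

lemma offset_mono: "i \<le> j \<Longrightarrow> offset m i \<le> offset m j"
  unfolding offset_def by (intro sum_mono2) auto

lemma offset_le_n: "j \<in> {1..t} \<Longrightarrow> offset m (j - 1) + m j \<le> n"
  using offset_mono[of j t] offset_pred[of j] by (simp add: total_def)

text \<open>
Strand number \<open>i\<close> of block \<open>j\<close>, with \<open>i\<close> read cyclically and starting at zero: a rotation of the
block then adds one to \<open>i\<close>.
\<close>

definition strand :: "nat \<Rightarrow> nat \<Rightarrow> nat" where
  "strand j i = offset m (j - 1) + 1 + i mod m j"

lemma strand_bounds:
  assumes "j \<in> {1..t}"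
  shows "offset m (j - 1) < strand j i" "strand j i \<le> offset m j"
proof -
  have "i mod m j < m j" "offset m (j - 1) + m j = offset m j"
    using assms offset_pred by simp_all
  then show "offset m (j - 1) < strand j i" "strand j i \<le> offset m j"
    unfolding strand_def by linarith+
qed

lemma strand_in [simp]: "j \<in> {1..t} \<Longrightarrow> strand j i \<in> {1..n}"
  using strand_bounds[of j i] offset_mono[of j t] by (simp add: total_def)

lemma strand_eq_iff:
  assumes "j \<in> {1..t}" "l \<in> {1..t}"
  shows "strand j i = strand l k \<longleftrightarrow> j = l \<and> i mod m j = k mod m j"
proof (cases "j = l")
  case False
  then consider "j < l" | "l < j" by linarith
  then have "strand j i \<noteq> strand l k"
  proof cases
    case 1
    then have "offset m j \<le> offset m (l - 1)" by (intro offset_mono) simp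
    then show ?thesis
      using strand_bounds(2)[OF assms(1), of i] strand_bounds(1)[OF assms(2), of k] by linarith
  next
    case 2
    then have "offset m l \<le> offset m (j - 1)" by (intro offset_mono) simp
    then show ?thesis
      using strand_bounds(1)[OF assms(1), of i] strand_bounds(2)[OF assms(2), of k] by linarith
  qed
  then show ?thesis using False by simp
qed (simp add: strand_def)

lemma strand_cases:
  assumes "a \<in> {1..n}"
  obtains j i where "j \<in> {1..t}" "i < m j" "a = strand j i"
proof -
  have "\<exists>j\<in>{1..l}. offset m (j - 1) < a \<and> a \<le> offset m j" if "1 \<le> a" "a \<le> offset m l" for l
    using that
  proof (induction l)
    case 0
    then show ?case by (simp add: offset_def)
  next
    case (Suc l)
    show ?case
    proof (cases "a \<le> offset m l")
      case True
      then show ?thesis using Suc by (meson atLeastAtMost_iff le_SucI)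
    next
      case False
      then show ?thesis using Suc.prems by (intro bexI[of _ "Suc l"]) auto
    qed
  qed
  from this[of t] obtain j where j: "j \<in> {1..t}" "offset m (j - 1) < a" "a \<le> offset m j"
    using assms by (auto simp: total_def)
  have "a - (offset m (j - 1) + 1) < m j" "a = strand j (a - (offset m (j - 1) + 1))"
    using j offset_pred[of j] by (auto simp: strand_def)
  then show ?thesis
    using that j(1) by blast
qed

abbreviation D where "D j \<equiv> delta_block n (offset m (j - 1)) (m j)"

lemma D_closed [simp]: "j \<in> {1..t} \<Longrightarrow> D j \<in> carrier Q"
  using delta_block_track_crossings(1)[OF offset_le_n block_odd] by blast

lemma trk_D:
  assumes "j \<in> {1..t}" "l \<in> {1..t}"
  shows "trk n (D j) (strand l i) = strand l (if l = j then i + 1 else i)"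
proof -
  note tr = delta_block_track_crossings(2)[OF offset_le_n[OF assms(1)] block_odd[OF assms(1)]]
  show ?thesis
  proof (cases "l = j")
    case True
    have lt: "i mod m j < m j" using assms by simp
    have "(i + 1) mod m j = (if i mod m j + 1 = m j then 0 else i mod m j + 1)"
      by (simp add: mod_Suc flip: Suc_eq_plus1)
    then show ?thesis
      unfolding tr using True by (simp add: strand_def) (use lt in linarith)
  next
    case False
    then consider "j < l" | "l < j" by linarith
    then have "strand l i \<le> offset m (j - 1) \<or> offset m j < strand l i"
    proof cases
      case 1
      then have "offset m j \<le> offset m (l - 1)" by (intro offset_mono) simp
      then show ?thesis using strand_bounds(1)[OF assms(2), of i] by linarith
    next
      case 2
      then have "offset m l \<le> offset m (j - 1)" by (intro offset_mono) simp
      then show ?thesis using strand_bounds(2)[OF assms(2), of i] by linarith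
    qed
    then show ?thesis
      unfolding tr using False offset_pred[of j] assms m_pos[OF assms(1)] by (auto simp del: m_pos)
  qed
qed

text \<open>
The function of the pairs whose coboundary accounts for the crossing numbers of all blocks at once.
\<close>

definition near_blocks :: "nat \<Rightarrow> nat \<Rightarrow> int" where
  "near_blocks a b = (\<Sum>j\<in>{1..t}. near (offset m (j - 1)) (m j) a b)"

text \<open>
The cocycle \<open>crs\<close> minus the coboundary of \<open>near_blocks\<close>.
\<close>

definition reduced_crs :: "nat word set set \<Rightarrow> nat \<Rightarrow> nat \<Rightarrow> int" where
  "reduced_crs X a b = crs n X a b - near_blocks a b + near_blocks (trk n X a) (trk n X b)"

lemma reduced_crs_mult [simp]:
  "X \<in> carrier Q \<Longrightarrow> Y \<in> carrier Q \<Longrightarrow>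
    reduced_crs (X \<otimes>\<^bsub>Q\<^esub> Y) a b = reduced_crs X a b + reduced_crs Y (trk n X a) (trk n X b)"
  by (simp add: reduced_crs_def)

lemma reduced_crs_pure: "trk n X = id \<Longrightarrow> reduced_crs X a b = crs n X a b"
  by (simp add: reduced_crs_def)

lemma reduced_crs_one [simp]: "reduced_crs \<one>\<^bsub>Q\<^esub> a b = 0"
  by (simp add: reduced_crs_def)

lemma reduced_crs_inv [simp]:
  "X \<in> carrier Q \<Longrightarrow>
    reduced_crs (inv\<^bsub>Q\<^esub> X) a b = - reduced_crs X (trk n (inv\<^bsub>Q\<^esub> X) a) (trk n (inv\<^bsub>Q\<^esub> X) b)"
  by (simp add: reduced_crs_def)

text \<open>
The contributions of the other blocks to the coboundary cancel because \<open>\<delta>\<close> fixes the strands of those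
blocks; the contribution of its own block is its crossing number.
\<close>

lemma reduced_crs_D:
  assumes "l \<in> {1..t}"
  shows "reduced_crs (D l) a b = 0"
proof -
  let ?t = "trk n (D l)"
  note tr = delta_block_track_crossings(2)[OF offset_le_n[OF assms] block_odd[OF assms]]
  have other: "near (offset m (j - 1)) (m j) (?t a) (?t b) = near (offset m (j - 1)) (m j) a b"
    if "j \<in> {1..t}" "j \<noteq> l" for j
  proof -
    have "offset m j \<le> offset m (l - 1) \<or> offset m l \<le> offset m (j - 1)"
    proof (cases "j < l")
      case True
      then show ?thesis by (intro disjI1 offset_mono) simp
    next
      case False
      then show ?thesis using that by (intro disjI2 offset_mono) simp
    qed
    moreover have "offset m (j - 1) + m j = offset m j" "offset m (l - 1) + m l = offset m l"
      using that assms offset_pred by auto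
    moreover have "0 < m j" "0 < m l"
      using that assms by simp_all
    ultimately have keep: "(offset m (j - 1) < ?t c \<and> ?t c \<le> offset m (j - 1) + m j) =
        (offset m (j - 1) < c \<and> c \<le> offset m (j - 1) + m j)"
      and same: "offset m (j - 1) < c \<Longrightarrow> c \<le> offset m (j - 1) + m j \<Longrightarrow> ?t c = c" for c
      unfolding tr by (auto split: if_splits)
    show ?thesis
    proof (cases "offset m (j - 1) < a \<and> a \<le> offset m (j - 1) + m j \<and>
        offset m (j - 1) < b \<and> b \<le> offset m (j - 1) + m j")
      case True
      then show ?thesis using same[of a] same[of b] by simp
    next
      case False
      then show ?thesis using keep[of a] keep[of b] unfolding near_def by (smt (verit))
    qed
  qed
  have "near_blocks a b - near_blocks (?t a) (?t b) =
      (\<Sum>j\<in>{1..t}. near (offset m (j - 1)) (m j) a b - near (offset m (j - 1)) (m j) (?t a) (?t b))"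
    by (simp add: near_blocks_def sum_subtractf)
  also have "\<dots> = (\<Sum>j\<in>{1..t}. if j = l then crs n (D l) a b else 0)"
    using other delta_block_track_crossings(3)[OF offset_le_n[OF assms] block_odd[OF assms]]
    by (intro sum.cong) auto
  also have "\<dots> = crs n (D l) a b"
    using assms by simp
  finally show ?thesis
    by (simp add: reduced_crs_def)
qed

end

section \<open>Central subgroups with dual coordinates\<close>

lemma (in group) commute_inv:
  assumes "x \<in> carrier G" "y \<in> carrier G" "x \<otimes> y = y \<otimes> x"
  shows "inv x \<otimes> y = y \<otimes> inv x"
proof -
  have "inv x \<otimes> (y \<otimes> x) \<otimes> inv x = inv x \<otimes> (x \<otimes> y) \<otimes> inv x"
    using assms(3) by simp
  moreover have "inv x \<otimes> (x \<otimes> y) = y" "(y \<otimes> x) \<otimes> inv x = y"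
    using assms(1,2) by (simp add: m_assoc[symmetric], simp add: m_assoc)
  ultimately show ?thesis
    using assms(1,2) by (simp add: m_assoc[of "inv x"])
qed

lemma (in group) subgroup_center: "subgroup (center G) G"
proof (rule subgroupI)
  show "center G \<noteq> {}"
  proof -
    have "\<one> \<in> center G" by (simp add: center_def)
    then show ?thesis by blast
  qed
next
  fix a assume "a \<in> center G"
  then have a: "a \<in> carrier G" "\<And>x. x \<in> carrier G \<Longrightarrow> a \<otimes> x = x \<otimes> a"
    by (auto simp: center_def)
  have "inv a \<otimes> x = x \<otimes> inv a" if x: "x \<in> carrier G" for x
    by (rule commute_inv[OF a(1) x a(2)[OF x]])
  then show "inv a \<in> center G"
    using a by (simp add: center_def)
next
  fix a b assume "a \<in> center G" "b \<in> center G"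
  then have a: "a \<in> carrier G" "\<And>x. x \<in> carrier G \<Longrightarrow> a \<otimes> x = x \<otimes> a"
    and b: "b \<in> carrier G" "\<And>x. x \<in> carrier G \<Longrightarrow> b \<otimes> x = x \<otimes> b"
    by (simp_all add: center_def)
  have "a \<otimes> b \<otimes> x = x \<otimes> (a \<otimes> b)" if x: "x \<in> carrier G" for x
  proof -
    have "a \<otimes> b \<otimes> x = a \<otimes> (x \<otimes> b)"
      using a(1) b(1) x by (simp add: m_assoc b(2)[OF x])
    also have "\<dots> = x \<otimes> a \<otimes> b"
      using a(1) b(1) x by (simp add: a(2)[OF x] flip: m_assoc)
    finally show ?thesis
      using a(1) b(1) x by (simp add: m_assoc)
  qed
  then show "a \<otimes> b \<in> center G"
    using a(1) b(1) by (simp add: center_def)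
qed (simp add: center_def subset_iff)

text \<open>
Integer coordinates that are jointly injective on a subgroup and dual to a finite family in it make the
family a basis. Joint injectivity also makes the subgroup commutative, since both orders of
a product have the same coordinates.
\<close>

lemma (in group) coordinates_imp_free_abelian:
  fixes c :: "'i \<Rightarrow> 'a \<Rightarrow> int"
  assumes K: "subgroup K G" and T: "finite T"
    and g: "\<And>i. i \<in> T \<Longrightarrow> g i \<in> K"
    and hom: "\<And>i x y. \<lbrakk>i \<in> T; x \<in> K; y \<in> K\<rbrakk> \<Longrightarrow> c i (x \<otimes> y) = c i x + c i y"
    and dual: "\<And>i j. \<lbrakk>i \<in> T; j \<in> T\<rbrakk> \<Longrightarrow> c i (g j) = (if i = j then 1 else 0)"
    and inj: "\<And>x y. \<lbrakk>x \<in> K; y \<in> K; \<And>i. i \<in> T \<Longrightarrow> c i x = c i y\<rbrakk> \<Longrightarrow> x = y"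
  shows "G\<lparr>carrier := K\<rparr> \<cong> free_Abelian_group T"
    and "\<forall>i\<in>T. infinite_cyclic_on G (g i)"
    and "internal_direct_sum G K T (\<lambda>i. generate G {g i})"
proof -
  interpret K: subgroup K G by (rule K)
  have one: "c i \<one> = 0" if "i \<in> T" for i
    using hom[OF that K.one_closed K.one_closed] by simp
  have inverse: "c i (inv x) = - c i x" if "i \<in> T" "x \<in> K" for i x
    using hom[of i "inv x" x] that one by (simp add: l_inv)
  have pow: "g j [^] (k::int) \<in> K \<and> (\<forall>i\<in>T. c i (g j [^] k) = (if i = j then k else 0))"
    if j: "j \<in> T" for j k
  proof -
    have nat: "g j [^] (k::nat) \<in> K \<and> (\<forall>i\<in>T. c i (g j [^] k) = (if i = j then int k else 0))" for k
    proof (induction k)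
      case (Suc k)
      then show ?case using hom g[OF j] dual j by auto
    qed (use one in auto)
    show ?thesis
      using nat inverse g[OF j]
      by (cases k rule: int_cases2) (auto simp: int_pow_int int_pow_neg_int)
  qed
  \<comment> \<open>Every integer vector occurs as the coordinates of a product of powers of the \<open>g i\<close>.\<close>
  have exists: "\<exists>x\<in>K. x \<in> generate G (\<Union>i\<in>T. generate G {g i}) \<and> (\<forall>i\<in>T. c i x = (if i \<in> S then f i else 0))"
    if "S \<subseteq> T" for S f
    using finite_subset[OF that T] that
  proof (induction S)
    case empty
    then show ?case using one by (intro bexI[of _ \<one>]) (auto intro: generate.one)
  next
    case (insert j S)
    then obtain x where x: "x \<in> K" "x \<in> generate G (\<Union>i\<in>T. generate G {g i})"
      "\<forall>i\<in>T. c i x = (if i \<in> S then f i else 0)"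
      by auto
    have j: "j \<in> T" "g j \<in> carrier G" using insert.prems g by auto
    have "g j [^] f j \<in> generate G {g j}"
      using generate_pow[OF j(2)] by auto
    then have "g j [^] f j \<in> generate G (\<Union>i\<in>T. generate G {g i})"
      using j by (blast intro: generate.incl)
    then show ?case
      using x pow[OF j(1), of "f j"] insert.hyps hom j
      by (intro bexI[of _ "x \<otimes> g j [^] f j"]) (auto intro: generate.eng)
  qed
  have comm: "x \<otimes> y = y \<otimes> x" if "x \<in> K" "y \<in> K" for x y
    using that hom by (intro inj) auto
  have comm_K: "comm_group (G\<lparr>carrier := K\<rparr>)"
    using comm by (intro group.group_comm_groupI subgroup_imp_group K) auto
  show "G\<lparr>carrier := K\<rparr> \<cong> free_Abelian_group T"
  proof -
    define \<phi> where "\<phi> x = Abs_poly_mapping (\<lambda>i. if i \<in> T then c i x else 0)" for x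
    have lookup: "Poly_Mapping.lookup (\<phi> x) i = (if i \<in> T then c i x else 0)" for x i
    proof -
      have "finite {i. (if i \<in> T then c i x else 0) \<noteq> 0}"
        by (rule finite_subset[OF _ T]) (auto split: if_splits)
      then show ?thesis
        unfolding \<phi>_def by (simp add: lookup_Abs_poly_mapping)
    qed
    have keys: "Poly_Mapping.keys (\<phi> x) \<subseteq> T" for x
      by (auto simp: in_keys_iff lookup split: if_splits)
    have "\<phi> \<in> hom (G\<lparr>carrier := K\<rparr>) (free_Abelian_group T)"
      by (rule homI) (simp_all add: keys poly_mapping_eq_iff fun_eq_iff lookup lookup_add hom)
    moreover have "bij_betw \<phi> K (carrier (free_Abelian_group T))"
    proof (rule bij_betwI')
      fix x y assume "x \<in> K" "y \<in> K"
      moreover have "c i x = c i y" if "\<phi> x = \<phi> y" "i \<in> T" for i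
        using that lookup[of x i] lookup[of y i] by simp
      ultimately show "\<phi> x = \<phi> y \<longleftrightarrow> x = y"
        using inj by blast
    next
      fix f assume "f \<in> carrier (free_Abelian_group T)"
      then have f: "Poly_Mapping.keys f \<subseteq> T" by simp
      obtain x where x: "x \<in> K" "\<forall>i\<in>T. c i x = Poly_Mapping.lookup f i"
        using exists[of T "Poly_Mapping.lookup f"] by auto
      have "f = \<phi> x"
        using x f by (intro poly_mapping_eqI) (auto simp: lookup in_keys_iff)
      then show "\<exists>x\<in>K. f = \<phi> x"
        using x by blast
    qed (simp add: keys)
    ultimately show ?thesis
      unfolding is_iso_def iso_def by auto
  qed
  show "\<forall>i\<in>T. infinite_cyclic_on G (g i)"
  proof
    fix i assume i: "i \<in> T"
    then have gi: "g i \<in> carrier G" using g by auto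
    have "inj (\<lambda>k::int. g i [^] k)"
      using pow[OF i] i by (intro injI) metis
    then have "infinite (range (\<lambda>k::int. g i [^] k))"
      using infinite_UNIV_int by (simp add: finite_image_iff)
    moreover have "range (\<lambda>k::int. g i [^] k) \<subseteq> generate G {g i}"
      using generate_pow[OF gi] by auto
    ultimately show "infinite_cyclic_on G (g i)"
      using gi unfolding infinite_cyclic_on_def by (blast dest: finite_subset)
  qed
  have H_sub: "generate G {g i} \<subseteq> K" if "i \<in> T" for i
    using g[OF that] by (intro generate_subgroup_incl K) auto
  have gen_sub: "generate G (\<Union>i\<in>S. generate G {g i}) \<subseteq> K" if "S \<subseteq> T" for S
    using H_sub that by (intro generate_subgroup_incl K) blast
  \<comment> \<open>A coordinate that vanishes on a generating set vanishes on the generated subgroup; this separates the summands.\<close>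
  have vanish: "c i x = 0" if "x \<in> generate G A" "A \<subseteq> K" "\<And>a. a \<in> A \<Longrightarrow> c i a = 0" "i \<in> T" for i x A
  proof -
    have "subgroup {x \<in> K. c i x = 0} G"
      using hom one inverse that(4) by (intro subgroupI) (auto intro: exI[of _ \<one>])
    then have "generate G A \<subseteq> {x \<in> K. c i x = 0}"
      using that(2,3) by (intro generate_subgroup_incl) auto
    then show ?thesis using that(1) by blast
  qed
  have vanish_H: "c i x = 0" if "x \<in> generate G {g j}" "j \<in> T" "i \<in> T" "i \<noteq> j" for i j x
    using that g dual by (intro vanish[of x "{g j}" i]) auto
  show "internal_direct_sum G K T (\<lambda>i. generate G {g i})"
    unfolding internal_direct_sum_def
  proof (intro conjI ballI K)
    fix i assume i: "i \<in> T"
    have "subgroup (generate G {g i}) (G\<lparr>carrier := K\<rparr>)"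
      using i g H_sub by (intro subgroup_incl generate_is_subgroup K) auto
    then show "generate G {g i} \<lhd> G\<lparr>carrier := K\<rparr>"
      by (rule comm_group.subgroup_imp_normal[OF comm_K])
    have "x = \<one>" if x: "x \<in> generate G {g i}" "x \<in> generate G (\<Union>j\<in>T - {i}. generate G {g j})" for x
    proof (rule inj)
      show "x \<in> K" using H_sub[OF i] x by blast
      show "\<one> \<in> K" by simp
      fix l assume l: "l \<in> T"
      show "c l x = c l \<one>"
      proof (cases "l = i")
        case True
        have "c l x = 0"
        proof (rule vanish[OF x(2) _ _ l])
          show "(\<Union>j\<in>T - {i}. generate G {g j}) \<subseteq> K"
            using H_sub by blast
          fix a assume "a \<in> (\<Union>j\<in>T - {i}. generate G {g j})"
          then obtain j where "j \<in> T" "j \<noteq> i" "a \<in> generate G {g j}" by blast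
          then show "c l a = 0"
            using vanish_H l True by blast
        qed
        then show ?thesis using one l by simp
      next
        case False
        then show ?thesis using vanish_H[OF x(1) i l] one l by simp
      qed
    qed
    moreover have "\<one> \<in> generate G {g i}" "\<one> \<in> generate G (\<Union>j\<in>T - {i}. generate G {g j})"
      by (auto intro: generate.one)
    ultimately show "generate G {g i} \<inter> generate G (\<Union>j\<in>T - {i}. generate G {g j}) = {\<one>}"
      by blast
  next
    show "K = generate G (\<Union>i\<in>T. generate G {g i})"
    proof
      show "K \<subseteq> generate G (\<Union>i\<in>T. generate G {g i})"
      proof
        fix x assume x: "x \<in> K"
        obtain y where y: "y \<in> K" "y \<in> generate G (\<Union>i\<in>T. generate G {g i})"
          "\<forall>i\<in>T. c i y = c i x"
          using exists[of T "\<lambda>i. c i x"] by auto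
        then have "x = y" using x inj by force
        then show "x \<in> generate G (\<Union>i\<in>T. generate G {g i})" using y by simp
      qed
    qed (rule gen_sub[OF subset_refl])
  qed
qed

context odd_blocks
begin

section \<open>The group and its center in terms of crossing numbers\<close>

abbreviation "\<Gamma> \<equiv> Gamma t m"

text \<open>
The generator \<open>A\<^bsub>n\<^sub>l+1,n\<^sub>l+2\<^esub> \<delta>\<close> of \<open>\<Gamma>\<^sub>q\<close> that belongs to block \<open>j = l + 1\<close>.
\<close>

definition twist :: "nat \<Rightarrow> nat word set set" where
  "twist j = A_cls n (strand j 0) (strand j 1) \<otimes>\<^bsub>Q\<^esub> D j"

lemma strand_0: "strand j 0 = offset m (j - 1) + 1"
  by (simp add: strand_def)

lemma strand_small: "d < m j \<Longrightarrow> strand j d = offset m (j - 1) + 1 + d"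
  by (simp add: strand_def)

lemma strand_0_less:
  assumes "j \<in> {1..t}" "0 < d" "d < m j"
  shows "1 \<le> strand j 0" "strand j 0 < strand j d" "strand j d \<le> n"
  using assms strand_in[OF assms(1), of 0] strand_in[OF assms(1), of d]
  by (simp_all add: strand_small)

lemma cross_less:
  assumes "j \<in> {1..t}" "l \<in> {1..t}" "j < l"
  shows "1 \<le> strand j i" "strand j i < strand l k" "strand l k \<le> n"
proof -
  have "offset m j \<le> offset m (l - 1)"
    using assms by (intro offset_mono) simp
  then show "strand j i < strand l k"
    using strand_bounds(2)[OF assms(1), of i] strand_bounds(1)[OF assms(2), of k] by linarith
qed (use strand_in[OF assms(1), of i] strand_in[OF assms(2), of k] in simp_all)

lemma A_adjacent_closed [simp]: "j \<in> {1..t} \<Longrightarrow> A_cls n (strand j 0) (strand j 1) \<in> carrier Q"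
  using strand_0_less[of j 1] block_ge_3[of j] by (intro A_cls_closed) auto

lemma twist_closed [simp]: "j \<in> {1..t} \<Longrightarrow> twist j \<in> carrier Q"
  by (simp add: twist_def)

lemma trk_A_cls: "1 \<le> a \<Longrightarrow> a < b \<Longrightarrow> b \<le> n \<Longrightarrow> trk n (A_cls n a b) c = c"
  by (simp add: crs_A_cls(1))

lemma trk_twist:
  assumes "j \<in> {1..t}"
  shows "trk n (twist j) a = trk n (D j) a"
  using assms strand_0_less[of j 1] block_ge_3[of j] by (simp add: twist_def trk_A_cls)

lemma trk_twist_strand:
  assumes "j \<in> {1..t}" "l \<in> {1..t}"
  shows "trk n (twist j) (strand l i) = strand l (if l = j then i + 1 else i)"
  using assms by (simp only: trk_twist trk_D)

lemma reduced_crs_twist: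
  assumes "j \<in> {1..t}"
  shows "reduced_crs (twist j) a b = (if {a, b} = {strand j 0, strand j 1} then 2 else 0)"
proof -
  have ab: "1 \<le> strand j 0" "strand j 0 < strand j 1" "strand j 1 \<le> n"
    using assms strand_0_less[of j 1] block_ge_3[of j] by auto
  show ?thesis
    using assms by (simp add: twist_def reduced_crs_D reduced_crs_pure[OF crs_A_cls(1)[OF ab]] crs_A_cls(2)[OF ab])
qed

lemma A_pow:
  assumes "1 \<le> a" "a < b" "b \<le> n"
  shows "A_cls n a b [^]\<^bsub>Q\<^esub> (q::nat) \<in> carrier Q"
    and "trk n (A_cls n a b [^]\<^bsub>Q\<^esub> q) = id"
    and "crs n (A_cls n a b [^]\<^bsub>Q\<^esub> q) c d = (if {c, d} = {a, b} then 2 * int q else 0)"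
  using crs_pow[OF A_cls_closed[OF assms] crs_A_cls(1)[OF assms]] crs_A_cls(2)[OF assms] assms
  by simp_all

definition Gamma_gens :: "nat word set set set" where
  "Gamma_gens = twist ` {1..t} \<union> {A_cls n a b [^]\<^bsub>Q\<^esub> q | a b. 1 \<le> a \<and> a < b \<and> b \<le> n}"

lemma Gamma_gens_closed: "Gamma_gens \<subseteq> carrier Q"
  using A_pow(1) twist_closed unfolding Gamma_gens_def by blast

lemma Gamma_eq: "\<Gamma> = subgroup_generated Q Gamma_gens"
proof -
  have tw: "twist (Suc l) = A_cls n (offset m l + 1) (offset m l + 2) \<otimes>\<^bsub>Q\<^esub> delta_block n (offset m l) (m (l + 1))"
    if "l < t" for l
    using that block_ge_3[of "Suc l"] by (simp add: twist_def strand_small flip: Suc_eq_plus1)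
  have "twist ` {1..t} = {A_cls n (offset m l + 1) (offset m l + 2) \<otimes>\<^bsub>Q\<^esub> delta_block n (offset m l) (m (l + 1)) | l. l < t}"
  proof (intro equalityI subsetI)
    fix x assume "x \<in> twist ` {1..t}"
    then obtain j where j: "j \<in> {1..t}" "x = twist j" by blast
    then have "x = twist (Suc (j - 1))" "j - 1 < t" by auto
    then show "x \<in> {A_cls n (offset m l + 1) (offset m l + 2) \<otimes>\<^bsub>Q\<^esub> delta_block n (offset m l) (m (l + 1)) | l. l < t}"
      using tw[of "j - 1"] by blast
  next
    fix x assume "x \<in> {A_cls n (offset m l + 1) (offset m l + 2) \<otimes>\<^bsub>Q\<^esub> delta_block n (offset m l) (m (l + 1)) | l. l < t}"
    then obtain l where l: "l < t" "x = twist (Suc l)"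
      using tw by auto
    then show "x \<in> twist ` {1..t}"
      by (intro image_eqI[of _ _ "Suc l"]) auto
  qed
  then show ?thesis
    by (simp only: Gamma_def Let_def Gamma_gens_def)
qed

lemma carrier_Gamma: "carrier \<Gamma> = generate Q Gamma_gens"
  using Gamma_gens_closed by (simp add: Gamma_eq carrier_subgroup_generated Int_absorb1)

lemma mult_Gamma [simp]: "x \<otimes>\<^bsub>\<Gamma>\<^esub> y = x \<otimes>\<^bsub>Q\<^esub> y"
  by (simp add: Gamma_eq)

lemma one_Gamma [simp]: "\<one>\<^bsub>\<Gamma>\<^esub> = \<one>\<^bsub>Q\<^esub>"
  by (simp add: Gamma_eq)

sublocale G: group \<Gamma>
  unfolding Gamma_eq by (rule Q.group_subgroup_generated)

lemma Gamma_closed: "x \<in> carrier \<Gamma> \<Longrightarrow> x \<in> carrier Q"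
  using Q.generate_in_carrier[OF Gamma_gens_closed] by (simp add: carrier_Gamma)

lemma twist_in_Gamma: "j \<in> {1..t} \<Longrightarrow> twist j \<in> carrier \<Gamma>"
  unfolding carrier_Gamma by (rule generate.incl) (simp add: Gamma_gens_def)

lemma A_pow_in_Gamma: "1 \<le> a \<Longrightarrow> a < b \<Longrightarrow> b \<le> n \<Longrightarrow> A_cls n a b [^]\<^bsub>Q\<^esub> q \<in> carrier \<Gamma>"
  unfolding carrier_Gamma by (rule generate.incl) (unfold Gamma_gens_def, blast)

text \<open>
The permutation rotates each block by some amount, the amount depending on the block only.
\<close>

definition rotates :: "(nat \<Rightarrow> nat) \<Rightarrow> bool" where
  "rotates f \<longleftrightarrow> (\<exists>k. \<forall>j\<in>{1..t}. \<forall>i. f (strand j i) = strand j (i + k j))"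

definition adjacent :: "nat \<Rightarrow> nat \<Rightarrow> bool" where
  "adjacent a b \<longleftrightarrow> (\<exists>j\<in>{1..t}. \<exists>i. {a, b} = {strand j i, strand j (i + 1)})"

lemma adjacent_rotate: "rotates f \<Longrightarrow> adjacent a b \<Longrightarrow> adjacent (f a) (f b)"
proof -
  assume "rotates f" "adjacent a b"
  then obtain k j i where k: "\<forall>j\<in>{1..t}. \<forall>i. f (strand j i) = strand j (i + k j)"
    and j: "j \<in> {1..t}" "{a, b} = {strand j i, strand j (i + 1)}"
    unfolding rotates_def adjacent_def by blast
  have "{f a, f b} = f ` {a, b}" by simp
  also have "\<dots> = {strand j (i + k j), strand j (i + k j + 1)}"
    using k j by (simp add: add.commute add.left_commute)
  finally show ?thesis
    unfolding adjacent_def using j(1) by blast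
qed

lemma rotates_inv:
  assumes "X \<in> carrier Q" "rotates (trk n X)"
  shows "rotates (trk n (inv\<^bsub>Q\<^esub> X))"
proof -
  obtain k where k: "\<forall>j\<in>{1..t}. \<forall>i. trk n X (strand j i) = strand j (i + k j)"
    using assms(2) unfolding rotates_def by blast
  \<comment> \<open>Rotating back by \<open>k j\<close> steps is rotating on by \<open>(m j - 1) * k j\<close> steps, which stays within the natural numbers.\<close>
  have "trk n (inv\<^bsub>Q\<^esub> X) (strand j i) = strand j (i + (m j - 1) * k j)" if j: "j \<in> {1..t}" for j i
  proof -
    have "(m j - 1) * k j + k j = m j * k j"
      using m_pos[OF j] by (cases "m j") simp_all
    then have "(i + (m j - 1) * k j + k j) mod m j = i mod m j"
      by (simp add: add.assoc)
    then have "strand j i = strand j (i + (m j - 1) * k j + k j)"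
      by (simp add: strand_def)
    also have "\<dots> = trk n X (strand j (i + (m j - 1) * k j))"
      using k j by simp
    finally show ?thesis
      using assms(1) by simp
  qed
  then show ?thesis
    unfolding rotates_def by (intro exI[of _ "\<lambda>j. (m j - 1) * k j"]) blast
qed

text \<open>
The divisibility properties of reduced crossing numbers that hold in \<open>\<Gamma>\<^sub>q\<close>. They are stated together with
the shape of the permutation because closure under products needs that permutations preserve
adjacency.
\<close>

definition Gamma_like :: "nat word set set \<Rightarrow> bool" where
  "Gamma_like X \<longleftrightarrow> X \<in> carrier Q \<and> rotates (trk n X) \<and> (\<forall>a b.
    2 dvd reduced_crs X a b \<and> (\<not> adjacent a b \<longrightarrow> 2 * int q dvd reduced_crs X a b))"

lemma Gamma_like_inv: "Gamma_like X \<Longrightarrow> Gamma_like (inv\<^bsub>Q\<^esub> X)"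
proof -
  assume X: "Gamma_like X"
  then have c: "X \<in> carrier Q" and r: "rotates (trk n X)"
    by (auto simp: Gamma_like_def)
  have "\<not> adjacent (trk n (inv\<^bsub>Q\<^esub> X) a) (trk n (inv\<^bsub>Q\<^esub> X) b)" if "\<not> adjacent a b" for a b
  proof
    assume "adjacent (trk n (inv\<^bsub>Q\<^esub> X) a) (trk n (inv\<^bsub>Q\<^esub> X) b)"
    from adjacent_rotate[OF r this] show False
      using that c by simp
  qed
  then show ?thesis
    using X rotates_inv[OF c r] c by (simp add: Gamma_like_def)
qed

lemma Gamma_like_mult: "Gamma_like X \<Longrightarrow> Gamma_like Y \<Longrightarrow> Gamma_like (X \<otimes>\<^bsub>Q\<^esub> Y)"
proof -
  assume X: "Gamma_like X" and Y: "Gamma_like Y"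
  then have c: "X \<in> carrier Q" "Y \<in> carrier Q" and r: "rotates (trk n X)"
    by (auto simp: Gamma_like_def)
  have "\<not> adjacent (trk n X a) (trk n X b)" if "\<not> adjacent a b" for a b
  proof
    assume "adjacent (trk n X a) (trk n X b)"
    from adjacent_rotate[OF rotates_inv[OF c(1) r] this] show False
      using that c by simp
  qed
  moreover obtain k l where "\<forall>j\<in>{1..t}. \<forall>i. trk n X (strand j i) = strand j (i + k j)"
    "\<forall>j\<in>{1..t}. \<forall>i. trk n Y (strand j i) = strand j (i + l j)"
    using X Y unfolding Gamma_like_def rotates_def by blast
  then have "rotates (trk n (X \<otimes>\<^bsub>Q\<^esub> Y))"
    unfolding rotates_def using c by (intro exI[of _ "\<lambda>j. k j + l j"]) (simp add: add.assoc)
  ultimately show ?thesis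
    using X Y by (simp add: Gamma_like_def dvd_add)
qed

lemma Gamma_like_gens:
  assumes "X \<in> Gamma_gens"
  shows "Gamma_like X"
proof -
  consider j where "j \<in> {1..t}" "X = twist j"
    | a b where "1 \<le> a" "a < b" "b \<le> n" "X = A_cls n a b [^]\<^bsub>Q\<^esub> q"
    using assms unfolding Gamma_gens_def by blast
  then show ?thesis
  proof cases
    case (1 j)
    have "rotates (trk n (twist j))"
      unfolding rotates_def using 1(1)
      by (intro exI[of _ "\<lambda>l. if l = j then 1 else 0"]) (simp add: trk_twist_strand)
    moreover have "adjacent a b" if "{a, b} = {strand j 0, strand j 1}" for a b
      unfolding adjacent_def using that 1(1) by (intro bexI[of _ j] exI[of _ 0]) simp_all
    ultimately show ?thesis
      using 1 by (auto simp: Gamma_like_def reduced_crs_twist)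
  next
    case (2 a b)
    have "rotates id"
      unfolding rotates_def by (intro exI[of _ "\<lambda>_. 0"]) simp
    then show ?thesis
      using A_pow[OF 2(1-3)] unfolding 2(4) Gamma_like_def by (simp add: reduced_crs_pure)
  qed
qed

lemma Gamma_like_Gamma: "X \<in> carrier \<Gamma> \<Longrightarrow> Gamma_like X"
  unfolding carrier_Gamma
proof (induction rule: generate.induct)
  case one
  have "rotates (trk n \<one>\<^bsub>Q\<^esub>)"
    unfolding rotates_def by (intro exI[of _ "\<lambda>_. 0"]) simp
  then show ?case
    by (simp add: Gamma_like_def)
qed (simp_all add: Gamma_like_gens Gamma_like_inv Gamma_like_mult)

lemma pure_in_Gamma_crs:
  assumes "X \<in> carrier \<Gamma>" "trk n X = id"
  shows "2 dvd crs n X a b" "\<not> adjacent a b \<Longrightarrow> 2 * int q dvd crs n X a b"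
  using Gamma_like_Gamma[OF assms(1)] by (auto simp: Gamma_like_def reduced_crs_pure[OF assms(2)])

lemma n_ge_3: "3 \<le> n"
  using offset_le_n[of 1] block_ge_3[of 1] t_pos by simp

text \<open>
Commuting with \<open>A\<^bsub>a,b\<^esub>\<^bsup>q\<^esup>\<close> forces the permutation to preserve the pair \<open>{a, b}\<close>. With at least three
strands, a point is the intersection of two such pairs and so is fixed.
\<close>

lemma center_trk:
  assumes "X \<in> center \<Gamma>"
  shows "trk n X = id"
proof -
  have X: "X \<in> carrier \<Gamma>" "X \<in> carrier Q"
    using assms Gamma_closed by (auto simp: center_def)
  have pair: "{trk n X a, trk n X b} = {a, b}" if "a \<in> {1..n}" "b \<in> {1..n}" "a \<noteq> b" for a b
  proof -
    have less: "{trk n X a, trk n X b} = {a, b}" if ab: "1 \<le> a" "a < b" "b \<le> n" for a b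
    proof -
      let ?A = "A_cls n a b [^]\<^bsub>Q\<^esub> q"
      have "X \<otimes>\<^bsub>Q\<^esub> ?A = ?A \<otimes>\<^bsub>Q\<^esub> X"
        using assms A_pow_in_Gamma[OF ab] by (auto simp: center_def)
      then have "crs n (X \<otimes>\<^bsub>Q\<^esub> ?A) a b = crs n (?A \<otimes>\<^bsub>Q\<^esub> X) a b"
        by simp
      then have "crs n ?A (trk n X a) (trk n X b) = crs n ?A a b"
        using X A_pow(1,2)[OF ab] by simp
      then show ?thesis
        using q_pos by (simp add: A_pow(3)[OF ab] split: if_splits)
    qed
    show ?thesis
      using that less[of a b] less[of b a] by (cases "a < b") (simp_all add: insert_commute)
  qed
  have "trk n X a = a" for a
  proof (cases "a \<in> {1..n}")
    case True
    have "card ({1..n} - {a}) \<ge> 2"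
      using True n_ge_3 by simp
    then obtain b c where bc: "b \<in> {1..n} - {a}" "c \<in> {1..n} - {a}" "b \<noteq> c"
      by (meson card_2_iff' obtain_subset_with_card_n subsetD)
    then show ?thesis
      using pair[of a b] pair[of a c] True by (auto simp: doubleton_eq_iff)
  qed (simp add: trk_notin[OF X(2)])
  then show ?thesis
    by (simp add: fun_eq_iff)
qed

text \<open>
The two products have the same permutation, and by the cocycle rule their crossing numbers differ by the
change of those of \<open>X\<close> under the rotation.
\<close>

lemma commute_twist_iff:
  assumes "X \<in> carrier Q" "trk n X = id" "j \<in> {1..t}"
  shows "X \<otimes>\<^bsub>Q\<^esub> twist j = twist j \<otimes>\<^bsub>Q\<^esub> X \<longleftrightarrow>
    (\<forall>a\<in>{1..n}. \<forall>b\<in>{1..n}. crs n X (trk n (twist j) a) (trk n (twist j) b) = crs n X a b)"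
proof -
  have l: "crs n (X \<otimes>\<^bsub>Q\<^esub> twist j) a b = crs n X a b + crs n (twist j) a b"
    and r: "crs n (twist j \<otimes>\<^bsub>Q\<^esub> X) a b = crs n (twist j) a b + crs n X (trk n (twist j) a) (trk n (twist j) b)"
    for a b
    using assms by simp_all
  show ?thesis
  proof
    assume "X \<otimes>\<^bsub>Q\<^esub> twist j = twist j \<otimes>\<^bsub>Q\<^esub> X"
    then have "crs n (X \<otimes>\<^bsub>Q\<^esub> twist j) a b = crs n (twist j \<otimes>\<^bsub>Q\<^esub> X) a b" for a b
      by simp
    then show "\<forall>a\<in>{1..n}. \<forall>b\<in>{1..n}. crs n X (trk n (twist j) a) (trk n (twist j) b) = crs n X a b"
      unfolding l r by (metis add.commute add_left_cancel)
  next
    assume inv: "\<forall>a\<in>{1..n}. \<forall>b\<in>{1..n}. crs n X (trk n (twist j) a) (trk n (twist j) b) = crs n X a b"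
    show "X \<otimes>\<^bsub>Q\<^esub> twist j = twist j \<otimes>\<^bsub>Q\<^esub> X"
    proof (rule braid_quot_eqI)
      show "trk n (X \<otimes>\<^bsub>Q\<^esub> twist j) = trk n (twist j \<otimes>\<^bsub>Q\<^esub> X)"
        using assms by (simp add: fun_eq_iff)
      fix a b assume "1 \<le> a" "a < b" "b \<le> n"
      then show "crs n (X \<otimes>\<^bsub>Q\<^esub> twist j) a b = crs n (twist j \<otimes>\<^bsub>Q\<^esub> X) a b"
        unfolding l r using inv by simp
    qed (use assms in simp_all)
  qed
qed

lemma center_iff:
  "X \<in> center \<Gamma> \<longleftrightarrow> X \<in> carrier \<Gamma> \<and> trk n X = id \<and>
    (\<forall>j\<in>{1..t}. \<forall>a\<in>{1..n}. \<forall>b\<in>{1..n}. crs n X (trk n (twist j) a) (trk n (twist j) b) = crs n X a b)"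
proof
  assume X: "X \<in> center \<Gamma>"
  then have "X \<in> carrier \<Gamma>" "X \<in> carrier Q" "trk n X = id"
    using Gamma_closed center_trk by (auto simp: center_def)
  moreover have "X \<otimes>\<^bsub>Q\<^esub> twist j = twist j \<otimes>\<^bsub>Q\<^esub> X" if "j \<in> {1..t}" for j
    using X twist_in_Gamma[OF that] by (auto simp: center_def)
  ultimately show "X \<in> carrier \<Gamma> \<and> trk n X = id \<and>
    (\<forall>j\<in>{1..t}. \<forall>a\<in>{1..n}. \<forall>b\<in>{1..n}. crs n X (trk n (twist j) a) (trk n (twist j) b) = crs n X a b)"
    using commute_twist_iff by blast
next
  assume X: "X \<in> carrier \<Gamma> \<and> trk n X = id \<and>
    (\<forall>j\<in>{1..t}. \<forall>a\<in>{1..n}. \<forall>b\<in>{1..n}. crs n X (trk n (twist j) a) (trk n (twist j) b) = crs n X a b)"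
  then have c: "X \<in> carrier Q" using Gamma_closed by blast
  have gens: "X \<otimes>\<^bsub>Q\<^esub> Y = Y \<otimes>\<^bsub>Q\<^esub> X" if "Y \<in> Gamma_gens" for Y
    using that unfolding Gamma_gens_def
  proof (elim UnE imageE CollectE exE conjE)
    fix j assume "Y = twist j" "j \<in> {1..t}"
    then show ?thesis using X commute_twist_iff[OF c] by blast
  next
    fix a b assume "Y = A_cls n a b [^]\<^bsub>Q\<^esub> q" "1 \<le> a" "a < b" "b \<le> n"
    then show ?thesis using X c A_pow(1,2) pure_commute by blast
  qed
  have comm: "X \<otimes>\<^bsub>Q\<^esub> Y = Y \<otimes>\<^bsub>Q\<^esub> X" if "Y \<in> carrier \<Gamma>" for Y
    using that unfolding carrier_Gamma
  proof (induction rule: generate.induct)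
    case (inv h)
    then have h: "h \<in> carrier Q" using Gamma_gens_closed by blast
    show ?case
      by (rule Q.commute_inv[OF h c gens[OF inv, symmetric], symmetric])
  next
    case (eng h1 h2)
    then have h: "h1 \<in> carrier Q" "h2 \<in> carrier Q"
      using Q.generate_in_carrier[OF Gamma_gens_closed] by blast+
    have "X \<otimes>\<^bsub>Q\<^esub> (h1 \<otimes>\<^bsub>Q\<^esub> h2) = h1 \<otimes>\<^bsub>Q\<^esub> (X \<otimes>\<^bsub>Q\<^esub> h2)"
      using h c by (simp add: eng.IH(1) flip: Q.m_assoc)
    also have "\<dots> = h1 \<otimes>\<^bsub>Q\<^esub> h2 \<otimes>\<^bsub>Q\<^esub> X"
      using h c by (simp add: eng.IH(2) Q.m_assoc)
    finally show ?case .
  qed (use c gens in simp_all)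
  then show "X \<in> center \<Gamma>"
    using X by (simp add: center_def)
qed

end

context odd_blocks
begin

section \<open>Products over orbits of pairs\<close>

lemma delta_closed_trk:
  assumes "set ls \<subseteq> {..<t}" "distinct ls"
  shows "list_mult Q (map (\<lambda>l. D (Suc l)) ls) \<in> carrier Q \<and>
    (\<forall>j\<in>{1..t}. \<forall>i. trk n (list_mult Q (map (\<lambda>l. D (Suc l)) ls)) (strand j i) =
      strand j (if j \<in> Suc ` set ls then i + 1 else i))"
  using assms
proof (induction ls)
  case Nil
  then show ?case by (simp add: list_mult_def)
next
  case (Cons l ls)
  have l: "Suc l \<in> {1..t}" using Cons.prems by auto
  have "trk n (list_mult Q (map (\<lambda>l. D (Suc l)) (l # ls))) (strand j i) =
      strand j (if j \<in> Suc ` set (l # ls) then i + 1 else i)" if j: "j \<in> {1..t}" for j i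
    using Cons l j trk_D[OF l j, of i] D_closed[OF l] by (auto simp: list_mult_def)
  then show ?case
    using Cons l D_closed[OF l] by (simp add: list_mult_def)
qed

lemma delta_eq: "delta t m = list_mult Q (map (\<lambda>l. D (Suc l)) [0..<t])"
  by (simp add: delta_def Let_def flip: Suc_eq_plus1)

lemma delta_closed [simp]: "delta t m \<in> carrier Q"
  using delta_closed_trk[of "[0..<t]"] by (simp add: delta_eq atLeast0LessThan)

lemma trk_delta: "j \<in> {1..t} \<Longrightarrow> trk n (delta t m) (strand j i) = strand j (i + 1)"
proof -
  assume j: "j \<in> {1..t}"
  then have "j \<in> Suc ` {..<t}"
    by (intro image_eqI[of _ _ "j - 1"]) auto
  then show ?thesis
    using delta_closed_trk[of "[0..<t]"] j by (simp add: delta_eq atLeast0LessThan)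
qed

lemma trk_delta_pow:
  "j \<in> {1..t} \<Longrightarrow> trk n (delta t m [^]\<^bsub>Q\<^esub> (k::nat)) (strand j i) = strand j (i + k)"
  by (induction k arbitrary: i) (simp_all add: trk_delta flip: Suc_eq_plus1)

text \<open>
The conjugate lies in \<open>\<Gamma>\<^sub>q\<close>, although \<open>\<delta>\<close> does not, because it has the permutation and the crossing numbers
of another \<open>A\<^bsub>a',b'\<^esub>\<^bsup>q\<^esup>\<close> and therefore equals it.
\<close>

lemma delta_conj_A_pow:
  fixes k :: nat
  assumes "1 \<le> a" "a < b" "b \<le> n"
  defines "X \<equiv> delta_conj t m k (A_cls n a b [^]\<^bsub>Q\<^esub> q)"
  shows "X \<in> carrier \<Gamma>" "trk n X = id"
    and "crs n X c d = (if {trk n (delta t m [^]\<^bsub>Q\<^esub> k) c, trk n (delta t m [^]\<^bsub>Q\<^esub> k) d} = {a, b}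
      then 2 * int q else 0)"
proof -
  let ?d = "delta t m [^]\<^bsub>Q\<^esub> k" and ?A = "A_cls n a b [^]\<^bsub>Q\<^esub> q"
  have X: "X = ?d \<otimes>\<^bsub>Q\<^esub> ?A \<otimes>\<^bsub>Q\<^esub> inv\<^bsub>Q\<^esub> ?d"
    by (simp add: X_def delta_conj_def Let_def)
  have d: "?d \<in> carrier Q" by simp
  have Xc: "X \<in> carrier Q"
    using A_pow(1)[OF assms(1-3)] by (simp add: X)
  show id: "trk n X = id"
    unfolding X using trk_conj[OF A_pow(1)[OF assms(1-3)] d A_pow(2)[OF assms(1-3)]] .
  show crs: "crs n X c d = (if {trk n ?d c, trk n ?d d} = {a, b} then 2 * int q else 0)" for c d
    unfolding X crs_conj[OF A_pow(1)[OF assms(1-3)] d A_pow(2)[OF assms(1-3)]] A_pow(3)[OF assms(1-3)] ..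
  have "\<exists>a'\<in>{1..n}. trk n ?d a' = a" if "a \<in> {1..n}" for a
    using trk_in[of "inv\<^bsub>Q\<^esub> ?d" n a] that d by (intro bexI[of _ "trk n (inv\<^bsub>Q\<^esub> ?d) a"]) simp_all
  then obtain a' b' where ab': "a' \<in> {1..n}" "trk n ?d a' = a" "b' \<in> {1..n}" "trk n ?d b' = b"
    using assms(1-3) by (metis atLeastAtMost_iff le_trans less_imp_le_nat)
  have pair: "{trk n ?d c, trk n ?d d} = {a, b} \<longleftrightarrow> {c, d} = {a', b'}" for c d
    unfolding ab'(2,4)[symmetric] doubleton_eq_iff using trk_eq_iff[OF d] by simp
  have eq: "X = A_cls n x y [^]\<^bsub>Q\<^esub> q" if xy: "1 \<le> x" "x < y" "y \<le> n" "{x, y} = {a', b'}" for x y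
  proof (rule braid_quot_eqI[OF Xc A_pow(1)[OF xy(1-3)]])
    show "trk n X = trk n (A_cls n x y [^]\<^bsub>Q\<^esub> q)"
      unfolding id A_pow(2)[OF xy(1-3)] ..
    show "crs n X c d = crs n (A_cls n x y [^]\<^bsub>Q\<^esub> q) c d" for c d
      unfolding crs pair A_pow(3)[OF xy(1-3)] xy(4) ..
  qed
  have "a' \<noteq> b'" using ab' assms(2) by auto
  then consider "a' < b'" | "b' < a'" by linarith
  then show "X \<in> carrier \<Gamma>"
  proof cases
    case 1
    then show ?thesis
      using eq[of a' b'] A_pow_in_Gamma[of a' b'] ab' by simp
  next
    case 2
    then show ?thesis
      using eq[of b' a'] A_pow_in_Gamma[of b' a'] ab' by (simp add: insert_commute)
  qed
qed

lemma pure_list_mult: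
  assumes "\<And>X. X \<in> set Xs \<Longrightarrow> X \<in> carrier \<Gamma> \<and> trk n X = id"
  shows "list_mult \<Gamma> Xs \<in> carrier \<Gamma>" "trk n (list_mult \<Gamma> Xs) = id"
    and "crs n (list_mult \<Gamma> Xs) a b = (\<Sum>X\<leftarrow>Xs. crs n X a b)"
proof -
  have "list_mult \<Gamma> Xs \<in> carrier \<Gamma> \<and> trk n (list_mult \<Gamma> Xs) = id \<and>
      crs n (list_mult \<Gamma> Xs) a b = (\<Sum>X\<leftarrow>Xs. crs n X a b)"
    using assms
  proof (induction Xs)
    case Nil
    have "\<one>\<^bsub>Q\<^esub> \<in> carrier \<Gamma>" using G.one_closed by simp
    then show ?case by (simp add: list_mult_def fun_eq_iff)
  next
    case (Cons X Xs)
    let ?L = "list_mult \<Gamma> Xs"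
    have X: "X \<in> carrier \<Gamma>" "X \<in> carrier Q" "trk n X = id"
      and L: "?L \<in> carrier \<Gamma>" "?L \<in> carrier Q" "trk n ?L = id"
      using Cons Gamma_closed by auto
    have "list_mult \<Gamma> (X # Xs) = X \<otimes>\<^bsub>Q\<^esub> ?L"
      by (simp add: list_mult_def)
    moreover have "X \<otimes>\<^bsub>Q\<^esub> ?L \<in> carrier \<Gamma>"
      using G.m_closed[OF X(1) L(1)] by simp
    moreover have "trk n (X \<otimes>\<^bsub>Q\<^esub> ?L) = id"
      using X L by (simp add: fun_eq_iff)
    moreover have "crs n (X \<otimes>\<^bsub>Q\<^esub> ?L) a b = crs n X a b + crs n ?L a b"
      using X L by simp
    ultimately show ?case
      using Cons by simp
  qed
  then show "list_mult \<Gamma> Xs \<in> carrier \<Gamma>" "trk n (list_mult \<Gamma> Xs) = id"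
    "crs n (list_mult \<Gamma> Xs) a b = (\<Sum>X\<leftarrow>Xs. crs n X a b)"
    by blast+
qed

text \<open>
The common form of the products of the elements \<open>e\<^bsub>j,h,k\<^esub>\<close> over \<open>k\<close>, inside a block and between two blocks.
\<close>

definition orbit_prod :: "nat \<Rightarrow> nat \<Rightarrow> nat \<Rightarrow> nat word set set" where
  "orbit_prod a b M = list_mult \<Gamma> (map (\<lambda>k. delta_conj t m (k - 1) (A_cls n a b [^]\<^bsub>Q\<^esub> q)) [1..<M + 1])"

lemma orbit_prod_Gamma:
  assumes "1 \<le> a" "a < b" "b \<le> n"
  shows "orbit_prod a b M \<in> carrier \<Gamma>" "trk n (orbit_prod a b M) = id"
    and "crs n (orbit_prod a b M) c d = (\<Sum>k<M.
      if {trk n (delta t m [^]\<^bsub>Q\<^esub> k) c, trk n (delta t m [^]\<^bsub>Q\<^esub> k) d} = {a, b} then 2 * int q else 0)"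
proof -
  let ?Xs = "map (\<lambda>k. delta_conj t m (k - 1) (A_cls n a b [^]\<^bsub>Q\<^esub> q)) [1..<M + 1]"
  have Xs: "X \<in> carrier \<Gamma> \<and> trk n X = id" if "X \<in> set ?Xs" for X
    using that delta_conj_A_pow(1,2)[OF assms] by auto
  note pure = pure_list_mult[of ?Xs, OF Xs]
  show "orbit_prod a b M \<in> carrier \<Gamma>" "trk n (orbit_prod a b M) = id"
    unfolding orbit_prod_def using pure(1,2) by blast+
  have "crs n (orbit_prod a b M) c d = (\<Sum>k\<in>{1..<M + 1}. crs n (delta_conj t m (k - 1) (A_cls n a b [^]\<^bsub>Q\<^esub> q)) c d)"
    unfolding orbit_prod_def using pure(3)[of c d]
    by (simp add: comp_def interv_sum_list_conv_sum_set_nat)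
  also have "\<dots> = (\<Sum>k<M. crs n (delta_conj t m k (A_cls n a b [^]\<^bsub>Q\<^esub> q)) c d)"
    by (rule sum.reindex_bij_witness[of _ "\<lambda>k. k + 1" "\<lambda>k. k - 1"]) auto
  finally show "crs n (orbit_prod a b M) c d = (\<Sum>k<M.
      if {trk n (delta t m [^]\<^bsub>Q\<^esub> k) c, trk n (delta t m [^]\<^bsub>Q\<^esub> k) d} = {a, b} then 2 * int q else 0)"
    by (simp only: delta_conj_A_pow(3)[OF assms])
qed

text \<open>
The number of times that the pair of strands \<open>i\<close>, \<open>i'\<close> of block \<open>j\<close> meets the pair \<open>0\<close>, \<open>d\<close> during one
full rotation of the block.
\<close>

definition hits :: "nat \<Rightarrow> nat \<Rightarrow> nat \<Rightarrow> nat \<Rightarrow> int" where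
  "hits j d i i' = (\<Sum>k<m j. if {strand j (i + k), strand j (i' + k)} = {strand j 0, strand j d} then 1 else 0)"

lemma hits_Suc:
  assumes "j \<in> {1..t}"
  shows "hits j d (i + 1) (i' + 1) = hits j d i i'"
proof -
  let ?f = "\<lambda>k. if {strand j (i + k), strand j (i' + k)} = {strand j 0, strand j d} then 1 else 0 :: int"
  have "hits j d (i + 1) (i' + 1) = (\<Sum>k<m j. ?f (Suc k))"
    by (simp add: hits_def flip: Suc_eq_plus1)
  also have "\<dots> = (\<Sum>k<Suc (m j). ?f k) - ?f 0"
    by (simp only: sum.lessThan_Suc_shift)
  also have "\<dots> = (\<Sum>k<m j. ?f k) + ?f (m j) - ?f 0"
    by simp
  also have "?f (m j) = ?f 0"
    by (simp add: strand_def)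
  finally show ?thesis
    by (simp add: hits_def)
qed

text \<open>
A pair of distance \<open>d'\<close> below half the block size meets \<open>{0, d}\<close> only for equal distances, and then
only in the original position: meeting it with the two strands exchanged would need
\<open>d + d'\<close> to be divisible by the block size.
\<close>

lemma hits_rep:
  assumes "j \<in> {1..t}" "0 < d" "2 * d < m j" "0 < d'" "2 * d' < m j"
  shows "hits j d 0 d' = (if d = d' then 1 else 0)"
proof -
  have pair: "{strand j (0 + k), strand j (d' + k)} = {strand j 0, strand j d} \<longleftrightarrow> k = 0 \<and> d = d'"
    if k: "k < m j" for k
  proof -
    have "\<not> m j dvd d' + d"
      using assms dvd_imp_le[of "m j" "d' + d"] by auto
    then show ?thesis
      using assms k by (auto simp: doubleton_eq_iff strand_eq_iff)
  qed
  have "hits j d 0 d' = (\<Sum>k<m j. if k = 0 \<and> d = d' then 1 else 0)"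
    unfolding hits_def by (intro sum.cong HOL.refl) (simp only: lessThan_iff pair)
  also have "\<dots> = (if d = d' then 1 else 0)"
    using m_pos[OF assms(1)] by (simp add: sum.delta)
  finally show ?thesis .
qed

lemma crs_twist_pow:
  assumes "j \<in> {1..t}"
  shows "twist j [^]\<^bsub>\<Gamma>\<^esub> (M::nat) \<in> carrier \<Gamma>"
    and "l \<in> {1..t} \<Longrightarrow> trk n (twist j [^]\<^bsub>\<Gamma>\<^esub> M) (strand l i) = strand l (if l = j then i + M else i)"
    and "a \<notin> {1..n} \<Longrightarrow> trk n (twist j [^]\<^bsub>\<Gamma>\<^esub> M) a = a"
    and "reduced_crs (twist j [^]\<^bsub>\<Gamma>\<^esub> M) a b =
      (\<Sum>k<M. if {trk n (twist j [^]\<^bsub>\<Gamma>\<^esub> k) a, trk n (twist j [^]\<^bsub>\<Gamma>\<^esub> k) b} = {strand j 0, strand j 1} then 2 else 0)"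
proof -
  show c: "twist j [^]\<^bsub>\<Gamma>\<^esub> (M::nat) \<in> carrier \<Gamma>" for M
    using twist_in_Gamma[OF assms] by simp
  note c' = Gamma_closed[OF c]
  show "trk n (twist j [^]\<^bsub>\<Gamma>\<^esub> M) (strand l i) = strand l (if l = j then i + M else i)" if "l \<in> {1..t}"
    using c' assms that by (induction M) (simp_all add: trk_twist_strand flip: Suc_eq_plus1)
  show "trk n (twist j [^]\<^bsub>\<Gamma>\<^esub> M) a = a" if "a \<notin> {1..n}"
    using trk_notin[OF c' that] .
  show "reduced_crs (twist j [^]\<^bsub>\<Gamma>\<^esub> M) a b =
      (\<Sum>k<M. if {trk n (twist j [^]\<^bsub>\<Gamma>\<^esub> k) a, trk n (twist j [^]\<^bsub>\<Gamma>\<^esub> k) b} = {strand j 0, strand j 1} then 2 else 0)"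
    using c' assms by (induction M) (simp_all add: reduced_crs_twist)
qed

lemma pair_in_block_iff:
  assumes "l \<in> {1..t}" "l' \<in> {1..t}" "j \<in> {1..t}" "h \<in> {1..t}"
    "{strand l i, strand l' i'} = {strand j k, strand h k'}"
  shows "{l, l'} = {j, h}"
  using assms by (auto simp: doubleton_eq_iff strand_eq_iff)

text \<open>
The function \<open>F\<close> gives the crossing numbers in terms of blocks and cyclic positions, where invariance
under the rotations can be checked directly.
\<close>

lemma centerI:
  assumes "X \<in> carrier \<Gamma>" "trk n X = id"
    and "\<And>l l' i i'. l \<in> {1..t} \<Longrightarrow> l' \<in> {1..t} \<Longrightarrow> crs n X (strand l i) (strand l' i') = F l l' i i'"
    and "\<And>l l' i i' j. \<lbrakk>l \<in> {1..t}; l' \<in> {1..t}; j \<in> {1..t}\<rbrakk> \<Longrightarrow>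
      F l l' (if l = j then i + 1 else i) (if l' = j then i' + 1 else i') = F l l' i i'"
  shows "X \<in> center \<Gamma>"
  unfolding center_iff
proof (intro conjI ballI assms(1,2))
  fix j a b assume j: "j \<in> {1..t}" and "a \<in> {1..n}" "b \<in> {1..n}"
  then obtain l i l' i' where "l \<in> {1..t}" "a = strand l i" "l' \<in> {1..t}" "b = strand l' i'"
    by (metis strand_cases)
  then show "crs n X (trk n (twist j) a) (trk n (twist j) b) = crs n X a b"
    using j by (simp only: trk_twist_strand assms(3,4))
qed

text \<open>
Over one full rotation the crossing \<open>2\<close> of the first two strands is spread evenly over all cyclically
adjacent pairs of the block.
\<close>

lemma twist_power_center:
  assumes "j \<in> {1..t}"
  shows "twist j [^]\<^bsub>\<Gamma>\<^esub> m j \<in> center \<Gamma>"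
    and "l \<in> {1..t} \<Longrightarrow> l' \<in> {1..t} \<Longrightarrow>
      crs n (twist j [^]\<^bsub>\<Gamma>\<^esub> m j) (strand l i) (strand l' i') = 2 * (if l = j \<and> l' = j then hits j 1 i i' else 0)"
proof -
  let ?X = "twist j [^]\<^bsub>\<Gamma>\<^esub> m j"
  have "trk n ?X a = a" for a
  proof (cases "a \<in> {1..n}")
    case True
    then obtain l i where "l \<in> {1..t}" "a = strand l i" by (rule strand_cases)
    then show ?thesis
      using crs_twist_pow(2)[OF assms, of l "m j" i] by (auto simp: strand_def)
  qed (rule crs_twist_pow(3)[OF assms])
  then have id: "trk n ?X = id" by (simp add: fun_eq_iff)
  show crs: "crs n ?X (strand l i) (strand l' i') = 2 * (if l = j \<and> l' = j then hits j 1 i i' else 0)"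
    if l: "l \<in> {1..t}" "l' \<in> {1..t}" for l l' i i'
  proof -
    have "crs n ?X (strand l i) (strand l' i') = (\<Sum>k<m j. if {strand l (if l = j then i + k else i),
        strand l' (if l' = j then i' + k else i')} = {strand j 0, strand j 1} then 2 else 0)"
      using crs_twist_pow(4)[OF assms, of "m j" "strand l i" "strand l' i'"]
      by (simp only: reduced_crs_pure[OF id] crs_twist_pow(2)[OF assms] l)
    also have "\<dots> = 2 * (if l = j \<and> l' = j then hits j 1 i i' else 0)"
    proof (cases "l = j \<and> l' = j")
      case True
      then show ?thesis by (simp add: hits_def sum_distrib_left if_distrib cong: if_cong)
    next
      case False
      then have "{strand l x, strand l' y} \<noteq> {strand j 0, strand j 1}" for x y
        using pair_in_block_iff[OF l assms assms, of x y 0 1] by auto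
      then show ?thesis unfolding if_not_P[OF False] by simp
    qed
    finally show ?thesis .
  qed
  show "?X \<in> center \<Gamma>"
    by (rule centerI[OF crs_twist_pow(1)[OF assms] id crs]) (auto simp: hits_Suc[OF assms])
qed

lemma block_orbit_center:
  assumes "j \<in> {1..t}" "0 < d" "d < m j"
  shows "orbit_prod (strand j 0) (strand j d) (m j) \<in> center \<Gamma>"
    and "l \<in> {1..t} \<Longrightarrow> l' \<in> {1..t} \<Longrightarrow>
      crs n (orbit_prod (strand j 0) (strand j d) (m j)) (strand l i) (strand l' i') =
        2 * int q * (if l = j \<and> l' = j then hits j d i i' else 0)"
proof -
  let ?X = "orbit_prod (strand j 0) (strand j d) (m j)"
  note o = orbit_prod_Gamma[OF strand_0_less[OF assms], of "m j"]
  show crs: "crs n ?X (strand l i) (strand l' i') = 2 * int q * (if l = j \<and> l' = j then hits j d i i' else 0)"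
    if l: "l \<in> {1..t}" "l' \<in> {1..t}" for l l' i i'
  proof (cases "l = j \<and> l' = j")
    case True
    then show ?thesis
      using assms(1) by (simp add: o(3) trk_delta_pow hits_def sum_distrib_left if_distrib cong: if_cong)
  next
    case False
    then have "{strand l x, strand l' y} \<noteq> {strand j 0, strand j d}" for x y
      using pair_in_block_iff[OF l assms(1) assms(1), of x y 0 d] by auto
    then show ?thesis unfolding if_not_P[OF False] using l by (simp add: o(3) trk_delta_pow)
  qed
  show "?X \<in> center \<Gamma>"
    by (rule centerI[OF o(1,2) crs]) (auto simp: hits_Suc[OF assms(1)])
qed

lemma strand_0_iff:
  assumes "j \<in> {1..t}"
  shows "strand j (i + k) = strand j 0 \<longleftrightarrow> [k = (m j - 1) * i] (mod m j)"
proof -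
  have "(m j - 1) * i + i = m j * i"
    using m_pos[OF assms] by (cases "m j") simp_all
  then have "[(m j - 1) * i + i = 0] (mod m j)"
    by (simp add: cong_def)
  then have "[i + k = 0] (mod m j) \<longleftrightarrow> [i + k = (m j - 1) * i + i] (mod m j)"
    by (metis cong_sym cong_trans)
  also have "\<dots> \<longleftrightarrow> [k = (m j - 1) * i] (mod m j)"
    by (metis add.commute cong_add_rcancel_nat)
  finally show ?thesis
    using assms by (simp add: strand_eq_iff cong_def)
qed

text \<open>
The coprime rotations of the two blocks bring each pair between them to the base pair exactly once
in \<open>m j * m h\<close> steps, by the Chinese remainder theorem.
\<close>

lemma cross_orbit_center:
  assumes "j \<in> {1..t}" "h \<in> {1..t}" "j < h"
  shows "orbit_prod (strand j 0) (strand h 0) (m j * m h) \<in> center \<Gamma>"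
    and "l \<in> {1..t} \<Longrightarrow> l' \<in> {1..t} \<Longrightarrow>
      crs n (orbit_prod (strand j 0) (strand h 0) (m j * m h)) (strand l i) (strand l' i') =
        2 * int q * (if {l, l'} = {j, h} then 1 else 0)"
proof -
  let ?X = "orbit_prod (strand j 0) (strand h 0) (m j * m h)"
  note o = orbit_prod_Gamma[OF cross_less(1)[OF assms, of 0] cross_less(2)[OF assms, of 0 0]
      cross_less(3)[OF assms, of 0], of "m j * m h"]
  have unique: "\<exists>!k. k < m j * m h \<and> strand j (i + k) = strand j 0 \<and> strand h (i' + k) = strand h 0" for i i'
    unfolding strand_0_iff[OF assms(1)] strand_0_iff[OF assms(2)]
    using block_coprime[OF assms(1,2)] assms by (intro binary_chinese_remainder_unique_nat) simp_all
  have count: "(\<Sum>k<m j * m h. if strand j (i + k) = strand j 0 \<and> strand h (i' + k) = strand h 0 then 2 * int q else 0) = 2 * int q"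
    for i i'
  proof -
    obtain k0 where k0: "k0 < m j * m h" "\<And>k. k < m j * m h \<Longrightarrow>
        (strand j (i + k) = strand j 0 \<and> strand h (i' + k) = strand h 0) \<longleftrightarrow> k = k0"
      using unique[of i i'] by blast
    have "(\<Sum>k<m j * m h. if strand j (i + k) = strand j 0 \<and> strand h (i' + k) = strand h 0 then 2 * int q else 0) =
        (\<Sum>k<m j * m h. if k = k0 then 2 * int q else 0)"
      using k0(2) by (intro sum.cong) auto
    then show ?thesis
      using k0(1) by simp
  qed
  show crs: "crs n ?X (strand l i) (strand l' i') = 2 * int q * (if {l, l'} = {j, h} then 1 else 0)"
    if l: "l \<in> {1..t}" "l' \<in> {1..t}" for l l' i i'
  proof -
    have sum: "crs n ?X (strand l i) (strand l' i') =
        (\<Sum>k<m j * m h. if {strand l (i + k), strand l' (i' + k)} = {strand j 0, strand h 0} then 2 * int q else 0)"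
      using l by (simp add: o(3) trk_delta_pow)
    consider "l = j" "l' = h" | "l = h" "l' = j" | "{l, l'} \<noteq> {j, h}"
      by (auto simp: doubleton_eq_iff)
    then show ?thesis
    proof cases
      case 1
      have "{strand j x, strand h y} = {strand j 0, strand h 0} \<longleftrightarrow> strand j x = strand j 0 \<and> strand h y = strand h 0" for x y
        using assms by (auto simp: doubleton_eq_iff strand_eq_iff)
      then show ?thesis unfolding sum using 1 count[of i i'] by simp
    next
      case 2
      have "{strand h y, strand j x} = {strand j 0, strand h 0} \<longleftrightarrow> strand j x = strand j 0 \<and> strand h y = strand h 0" for x y
        using assms by (auto simp: doubleton_eq_iff strand_eq_iff)
      then show ?thesis unfolding sum using 2 count[of i' i] by (simp add: insert_commute)
    next
      case 3
      then have "{strand l x, strand l' y} \<noteq> {strand j 0, strand h 0}" for x y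
        using pair_in_block_iff[OF l assms(1,2), of x y 0 0] by auto
      then show ?thesis unfolding sum using 3 by simp
    qed
  qed
  show "?X \<in> center \<Gamma>"
    by (rule centerI[OF o(1,2) crs]) auto
qed

end

context odd_blocks
begin

section \<open>Coordinates on the center\<close>

text \<open>
The crossing numbers of a central element depend, inside a block, on the cyclic distance only, and
between two blocks they are constant.
\<close>

lemma center_crs_shift:
  assumes "X \<in> center \<Gamma>" "l \<in> {1..t}" "l' \<in> {1..t}"
  shows "crs n X (strand l (i + k)) (strand l (i' + k)) = crs n X (strand l i) (strand l i')"
    and "l \<noteq> l' \<Longrightarrow> crs n X (strand l (i + k)) (strand l' i') = crs n X (strand l i) (strand l' i')"
proof -
  have step: "crs n X (strand l (if l = j then i + 1 else i)) (strand l' (if l' = j then i' + 1 else i')) =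
      crs n X (strand l i) (strand l' i')"
    if "j \<in> {1..t}" "l \<in> {1..t}" "l' \<in> {1..t}" for j l l' i i'
  proof -
    have "crs n X (trk n (twist j) a) (trk n (twist j) b) = crs n X a b"
      if "a \<in> {1..n}" "b \<in> {1..n}" for a b
      using assms(1) that \<open>j \<in> {1..t}\<close> unfolding center_iff by blast
    from this[OF strand_in[OF that(2), of i] strand_in[OF that(3), of i']] show ?thesis
      by (simp only: trk_twist_strand that)
  qed
  show "crs n X (strand l (i + k)) (strand l (i' + k)) = crs n X (strand l i) (strand l i')"
  proof (induction k)
    case (Suc k)
    then show ?case using step[OF assms(2) assms(2) assms(2), of "i + k" "i' + k"]
      by (simp flip: Suc_eq_plus1)
  qed simp
  show "crs n X (strand l (i + k)) (strand l' i') = crs n X (strand l i) (strand l' i')" if "l \<noteq> l'"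
  proof (induction k)
    case (Suc k)
    then show ?case using step[OF assms(2) assms(2) assms(3), of "i + k" i'] that
      by (simp flip: Suc_eq_plus1)
  qed simp
qed

text \<open>
The pairs in the premises represent all orbits. A cyclic distance \<open>d\<close> above half the block size is the
distance \<open>m l - d\<close> of the same pair in the other order, and as \<open>m l\<close> is odd there is no
distance equal to one half.
\<close>

lemma center_eqI:
  assumes X: "X \<in> center \<Gamma>" and Y: "Y \<in> center \<Gamma>"
    and block: "\<And>l d. \<lbrakk>l \<in> {1..t}; 0 < d; 2 * d < m l\<rbrakk> \<Longrightarrow>
      crs n X (strand l 0) (strand l d) = crs n Y (strand l 0) (strand l d)"
    and cross: "\<And>l l'. \<lbrakk>l \<in> {1..t}; l' \<in> {1..t}; l < l'\<rbrakk> \<Longrightarrow>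
      crs n X (strand l 0) (strand l' 0) = crs n Y (strand l 0) (strand l' 0)"
  shows "X = Y"
proof (rule braid_quot_eqI)
  have c: "X \<in> carrier Q" "Y \<in> carrier Q" "trk n X = id" "trk n Y = id"
    using X Y Gamma_closed by (auto simp: center_iff)
  then show "X \<in> carrier Q" "Y \<in> carrier Q" "trk n X = trk n Y" by simp_all
  have sym: "crs n X a b = crs n X b a" "crs n Y a b = crs n Y b a" for a b
    using crs_sym[OF c(1)] crs_sym[OF c(2)] by blast+
  have dist: "crs n X (strand l 0) (strand l d) = crs n Y (strand l 0) (strand l d)"
    if l: "l \<in> {1..t}" and d: "0 < d" "d < m l" for l d
  proof (cases "2 * d < m l")
    case False
    \<comment> \<open>The distance is above one half: exchange the two strands.\<close>
    have "2 * d \<noteq> m l" using block_odd[OF l] by (metis dvd_triv_left)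
    then have "2 * (m l - d) < m l" using False d by simp
    then have rep: "crs n X (strand l 0) (strand l (m l - d)) = crs n Y (strand l 0) (strand l (m l - d))"
      using d by (intro block l) simp_all
    have "strand l (d + (m l - d)) = strand l 0"
      using d by (simp add: strand_def)
    have "crs n Z (strand l 0) (strand l d) = crs n Z (strand l 0) (strand l (m l - d))"
      if "Z \<in> center \<Gamma>" "\<And>a b. crs n Z a b = crs n Z b a" for Z
      using center_crs_shift(1)[OF that(1) l l, of 0 "m l - d" d] that(2)[of "strand l 0"]
      by (simp only: \<open>strand l (d + (m l - d)) = strand l 0\<close> add_0)
    from this[OF X sym(1)] this[OF Y sym(2)] rep show ?thesis
      by simp
  qed (rule block[OF l d(1)])
  fix a b assume ab: "1 \<le> a" "a < b" "b \<le> n"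
  then have "a \<in> {1..n}" "b \<in> {1..n}" by simp_all
  then obtain l i l' i' where l: "l \<in> {1..t}" "i < m l" "a = strand l i" "l' \<in> {1..t}" "i' < m l'" "b = strand l' i'"
    by (elim strand_cases)
  show "crs n X a b = crs n Y a b"
  proof (cases "l = l'")
    case True
    have "i < i'" using ab(2) l True by (simp add: strand_small)
    then have "crs n Z a b = crs n Z (strand l 0) (strand l (i' - i))" if "Z \<in> center \<Gamma>" for Z
      using center_crs_shift(1)[OF that l(1) l(1), of 0 i "i' - i"] l True by simp
    then show ?thesis
      using X Y dist[OF l(1), of "i' - i"] \<open>i < i'\<close> l(5) True by simp
  next
    case False
    then have "crs n Z a b = crs n Z (strand l 0) (strand l' 0)"
      if "Z \<in> center \<Gamma>" "\<And>a b. crs n Z a b = crs n Z b a" for Z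
      using center_crs_shift(2)[OF that(1) l(1,4), of 0 i i']
        center_crs_shift(2)[OF that(1) l(4,1), of 0 i' 0] that(2)[of "strand l 0"]
      by (simp only: l(3,6) add_0) simp
    then have "crs n X a b = crs n X (strand l 0) (strand l' 0)" "crs n Y a b = crs n Y (strand l 0) (strand l' 0)"
      using X Y sym by (simp, simp)
    moreover have "crs n X (strand l 0) (strand l' 0) = crs n Y (strand l 0) (strand l' 0)"
    proof (cases "l < l'")
      case True
      then show ?thesis by (rule cross[OF l(1,4)])
    next
      case l': False
      then have "l' < l" using False by simp
      then show ?thesis
        unfolding sym(1)[of "strand l 0"] sym(2)[of "strand l 0"] by (rule cross[OF l(4,1)])
    qed
    ultimately show ?thesis by simp
  qed
qed

lemma not_adjacent_block:
  assumes "l \<in> {1..t}" "1 < d" "2 * d < m l"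
  shows "\<not> adjacent (strand l 0) (strand l d)"
proof
  assume "adjacent (strand l 0) (strand l d)"
  then obtain j i where j: "j \<in> {1..t}" "{strand l 0, strand l d} = {strand j i, strand j (i + 1)}"
    unfolding adjacent_def by blast
  then have "l = j"
    using pair_in_block_iff[OF assms(1) assms(1) j(1) j(1) j(2)] by simp
  have "d mod m l = d"
    using assms by simp
  have step: "(i + 1) mod m l = (if i mod m l + 1 = m l then 0 else i mod m l + 1)"
    by (simp add: mod_Suc flip: Suc_eq_plus1)
  have "i mod m l = 0 \<and> (i + 1) mod m l = d \<or> i mod m l = d \<and> (i + 1) mod m l = 0"
    using j(2) \<open>d mod m l = d\<close> unfolding \<open>l = j\<close>[symmetric] doubleton_eq_iff
    by (simp only: strand_eq_iff[OF assms(1) assms(1)] mod_0) argo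
  then show False
    unfolding step using assms(2,3) by (auto split: if_splits)
qed

lemma not_adjacent_cross:
  assumes "l \<in> {1..t}" "l' \<in> {1..t}" "l \<noteq> l'"
  shows "\<not> adjacent (strand l i) (strand l' i')"
proof
  assume "adjacent (strand l i) (strand l' i')"
  then obtain j k where j: "j \<in> {1..t}" "{strand l i, strand l' i'} = {strand j k, strand j (k + 1)}"
    unfolding adjacent_def by blast
  then show False
    using pair_in_block_iff[OF assms(1,2) j(1) j(1) j(2)] assms(3) by auto
qed

text \<open>
This and the next two lemmas identify the elements \<open>e\<close> and their products with the central elements
constructed above. The distance in a block is \<open>h + 1\<close>, because distance one is already taken by
\<open>e\<^bsub>j,0,1\<^esub>\<close>.
\<close>

lemma e_elt_twist:
  assumes "j \<in> {1..t}"
  shows "e_elt t m j 0 1 = twist j [^]\<^bsub>\<Gamma>\<^esub> m j"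
proof -
  have "strand j 1 = offset m (j - 1) + 2"
    using assms block_ge_3[of j] by (simp add: strand_small)
  then show ?thesis
    unfolding Gamma_eq by (simp add: e_elt_def Let_def twist_def strand_0 pow_subgroup_generated)
qed

lemma e_elt_block:
  assumes "j \<in> {1..t}" "1 \<le> h" "h + 1 < m j"
  shows "list_mult \<Gamma> (map (e_elt t m j h) [1..<m j + 1]) = orbit_prod (strand j 0) (strand j (h + 1)) (m j)"
proof -
  have "strand j (h + 1) = offset m (j - 1) + h + 2"
    using assms by (simp add: strand_small)
  then show ?thesis
    using assms unfolding orbit_prod_def
    by (intro arg_cong[of _ _ "list_mult \<Gamma>"] map_cong HOL.refl) (simp add: e_elt_def Let_def strand_0)
qed

lemma e_elt_cross:
  assumes "1 \<le> j" "j < h" "h \<le> t"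
  shows "list_mult \<Gamma> (map (e_elt t m (t + j) (t + h)) [1..<m j * m h + 1]) =
    orbit_prod (strand j 0) (strand h 0) (m j * m h)"
  using assms unfolding orbit_prod_def
  by (intro arg_cong[of _ _ "list_mult \<Gamma>"] map_cong HOL.refl) (simp add: e_elt_def Let_def strand_0)

text \<open>
The coordinates are the crossing numbers of the base pairs of the orbits, divided by \<open>2\<close> for the adjacent
pairs of a block and by \<open>2 q\<close> for all others. Divisibility comes from \<open>pure_in_Gamma_crs\<close>, duality from
the crossing numbers of the listed elements, and joint injectivity from \<open>center_eqI\<close>.
\<close>

lemma center_Gamma:
  defines "x \<equiv> (\<lambda>j. e_elt t m j 0 1)"
    and "y \<equiv> (\<lambda>(j, h). list_mult \<Gamma> (map (e_elt t m j h) [1..<m j + 1]))"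
    and "z \<equiv> (\<lambda>(j, h). list_mult \<Gamma> (map (e_elt t m (t + j) (t + h)) [1..<m j * m h + 1]))"
    and "I \<equiv> {1..t}"
    and "J \<equiv> {(j, h). 1 \<le> j \<and> j \<le> t \<and> 1 \<le> h \<and> h \<le> (m j - 3) div 2}"
    and "K \<equiv> {(j, h). 1 \<le> j \<and> j < h \<and> h \<le> t}"
  shows "\<Gamma>\<lparr>carrier := center \<Gamma>\<rparr> \<cong> free_Abelian_group (I <+> J <+> K)"
    and "\<forall>i\<in>I <+> J <+> K. infinite_cyclic_on \<Gamma> (case_sum x (case_sum y z) i)"
    and "internal_direct_sum \<Gamma> (center \<Gamma>) (I <+> J <+> K) (\<lambda>i. generate \<Gamma> {case_sum x (case_sum y z) i})"
proof -
  let ?T = "I <+> J <+> K"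
  let ?g = "case_sum x (case_sum y z)"
  define u where "u i = (case i of Inl j \<Rightarrow> 2 | _ \<Rightarrow> 2 * int q)" for i :: "nat + nat \<times> nat + nat \<times> nat"
  define c where "c i X = (case i of Inl j \<Rightarrow> crs n X (strand j 0) (strand j 1)
    | Inr (Inl (j, h)) \<Rightarrow> crs n X (strand j 0) (strand j (h + 1))
    | Inr (Inr (j, h)) \<Rightarrow> crs n X (strand j 0) (strand h 0))" for i X
  have u_pos: "u i > 0" for i
    using q_pos by (auto simp: u_def split: sum.split)
  have J: "j \<in> {1..t}" "0 < h + 1" "2 * (h + 1) < m j" "h + 1 < m j" "1 < h + 1" "1 \<le> h" if "(j, h) \<in> J" for j h
    using that block_ge_3[of j] by (auto simp: J_def)
  have K: "j \<in> {1..t}" "h \<in> {1..t}" "j < h" if "(j, h) \<in> K" for j h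
    using that by (auto simp: K_def)
  have J_0: "(j, 0) \<notin> J" for j
    by (simp add: J_def)
  have K_asym: "(h, j) \<notin> K" if "(j, h) \<in> K" for j h
    using that by (simp add: K_def)
  have K_irrefl: "(j, j) \<notin> K" for j
    by (simp add: K_def)
  have I: "j \<in> {1..t}" "0 < (1::nat)" "2 * 1 < m j" if "j \<in> I" for j
    using that block_ge_3[of j] by (auto simp: I_def)
  have x: "x j = twist j [^]\<^bsub>\<Gamma>\<^esub> m j" if "j \<in> I" for j
    using that by (simp add: x_def I_def e_elt_twist)
  have y: "y (j, h) = orbit_prod (strand j 0) (strand j (h + 1)) (m j)" if "(j, h) \<in> J" for j h
    using J[OF that] by (simp add: y_def e_elt_block)
  have z: "z (j, h) = orbit_prod (strand j 0) (strand h 0) (m j * m h)" if "(j, h) \<in> K" for j h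
    using K[OF that] by (simp add: z_def e_elt_cross)
  have cases: thesis if "i \<in> ?T" "\<And>j. i = Inl j \<Longrightarrow> j \<in> I \<Longrightarrow> thesis"
    "\<And>j h. i = Inr (Inl (j, h)) \<Longrightarrow> (j, h) \<in> J \<Longrightarrow> thesis"
    "\<And>j h. i = Inr (Inr (j, h)) \<Longrightarrow> (j, h) \<in> K \<Longrightarrow> thesis" for i thesis
    using that by auto
  have dvd: "u i dvd c i X" if "i \<in> ?T" "X \<in> center \<Gamma>" for i X
  proof -
    have X: "X \<in> carrier \<Gamma>" "trk n X = id" using that(2) by (simp_all add: center_iff)
    from that(1) show ?thesis
    proof (rule cases)
      fix j assume "i = Inl j" "j \<in> I"
      then show ?thesis using pure_in_Gamma_crs(1)[OF X] by (simp add: u_def c_def)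
    next
      fix j h assume "i = Inr (Inl (j, h))" "(j, h) \<in> J"
      then show ?thesis
        using pure_in_Gamma_crs(2)[OF X not_adjacent_block[of j "h + 1"]] J by (simp add: u_def c_def)
    next
      fix j h assume "i = Inr (Inr (j, h))" "(j, h) \<in> K"
      then show ?thesis
        using pure_in_Gamma_crs(2)[OF X not_adjacent_cross[of j h]] K[of j h] by (simp add: u_def c_def)
    qed
  qed
  have dual: "c i (?g k) = (if i = k then u i else 0)" if "i \<in> ?T" "k \<in> ?T" for i k
    using that(2)
  proof (rule cases)
    fix j assume k: "k = Inl j" "j \<in> I"
    show ?thesis
      using that(1) unfolding k
      by (rule cases) (use k I J K K_irrefl in \<open>auto simp: c_def u_def x twist_power_center(2) hits_rep\<close>)
  next
    fix j h assume k: "k = Inr (Inl (j, h))" "(j, h) \<in> J"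
    note * = block_orbit_center(2)[OF J(1,2,4)[OF k(2)]]
    show ?thesis
      using that(1) unfolding k
      by (rule cases) (use k I J J_0 K K_irrefl in \<open>auto split: if_splits simp: c_def u_def y * hits_rep\<close>)
  next
    fix j h assume k: "k = Inr (Inr (j, h))" "(j, h) \<in> K"
    note * = cross_orbit_center(2)[OF K[OF k(2)]]
    show ?thesis
      using that(1) unfolding k
      by (rule cases) (use k I J K K_asym[OF k(2)] K_irrefl in \<open>auto simp: c_def u_def z * doubleton_eq_iff\<close>)
  qed
  have g: "?g i \<in> center \<Gamma>" if "i \<in> ?T" for i
    using that
  proof (rule cases)
    fix j assume "i = Inl j" "j \<in> I"
    then show ?thesis using I twist_power_center(1) by (simp add: x)
  next
    fix j h assume "i = Inr (Inl (j, h))" "(j, h) \<in> J"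
    then show ?thesis using block_orbit_center(1)[OF J(1,2,4)] by (simp add: y)
  next
    fix j h assume "i = Inr (Inr (j, h))" "(j, h) \<in> K"
    then show ?thesis using cross_orbit_center(1)[OF K] by (simp add: z)
  qed
  have add: "c i (X \<otimes>\<^bsub>\<Gamma>\<^esub> Y) = c i X + c i Y" if "X \<in> center \<Gamma>" "Y \<in> center \<Gamma>" for i X Y
  proof -
    have "X \<in> carrier Q" "Y \<in> carrier Q" "trk n X = id"
      using that Gamma_closed by (auto simp: center_iff)
    then show ?thesis
      by (simp add: c_def split: sum.split)
  qed
  have inj: "X = Y" if "X \<in> center \<Gamma>" "Y \<in> center \<Gamma>" "\<And>i. i \<in> ?T \<Longrightarrow> c i X = c i Y" for X Y
    using that(1,2)
  proof (rule center_eqI)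
    fix l d assume l: "l \<in> {1..t}" "0 < d" "2 * d < m l"
    show "crs n X (strand l 0) (strand l d) = crs n Y (strand l 0) (strand l d)"
    proof (cases "d = 1")
      case True
      have "l \<in> I" using l(1) by (simp add: I_def)
      then have "Inl l \<in> ?T" by blast
      from that(3)[OF this] show ?thesis using True by (simp add: c_def)
    next
      case False
      then have "(l, d - 1) \<in> J" "d - 1 + 1 = d"
        using l block_odd[OF l(1)] by (auto simp: J_def elim!: oddE)
      then have "Inr (Inl (l, d - 1)) \<in> ?T" by blast
      from that(3)[OF this] show ?thesis using \<open>d - 1 + 1 = d\<close> by (simp add: c_def)
    qed
  next
    fix l l' assume "l \<in> {1..t}" "l' \<in> {1..t}" "l < l'"
    then have "(l, l') \<in> K" by (simp add: K_def)
    then have "Inr (Inr (l, l')) \<in> ?T" by blast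
    from that(3)[OF this] show "crs n X (strand l 0) (strand l' 0) = crs n Y (strand l 0) (strand l' 0)"
      by (simp add: c_def)
  qed
  have fin: "finite ?T"
  proof (intro finite_Plus)
    show "finite I" by (simp add: I_def)
    show "finite J"
      by (rule finite_subset[of _ "Sigma {1..t} (\<lambda>j. {..m j})"]) (auto simp: J_def)
    show "finite K"
      by (rule finite_subset[of _ "{1..t} \<times> {1..t}"]) (auto simp: K_def)
  qed
  note coords = G.coordinates_imp_free_abelian[of "center \<Gamma>" ?T ?g "\<lambda>i X. c i X div u i"]
  have div: "c i X = u i * (c i X div u i)" if "i \<in> ?T" "X \<in> center \<Gamma>" for i X
    using dvd[OF that] by simp
  have 1: "c i (X \<otimes>\<^bsub>\<Gamma>\<^esub> Y) div u i = c i X div u i + c i Y div u i"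
    if "i \<in> ?T" "X \<in> center \<Gamma>" "Y \<in> center \<Gamma>" for i X Y
    unfolding add[OF that(2,3)] by (rule div_plus_div_distrib_dvd_left[OF dvd[OF that(1,2)]])
  have 2: "c i (?g k) div u i = (if i = k then 1 else 0)" if "i \<in> ?T" "k \<in> ?T" for i k
    using dual[OF that] u_pos[of i] by auto
  have 3: "X = Y" if "X \<in> center \<Gamma>" "Y \<in> center \<Gamma>" "\<And>i. i \<in> ?T \<Longrightarrow> c i X div u i = c i Y div u i" for X Y
    using that(1,2)
  proof (rule inj)
    fix i assume "i \<in> ?T"
    then show "c i X = c i Y"
      using div[of i X] div[of i Y] that by metis
  qed
  note coords' = coords[OF G.subgroup_center fin g 1 2 3]
  show "\<Gamma>\<lparr>carrier := center \<Gamma>\<rparr> \<cong> free_Abelian_group ?T"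
    by (rule coords'(1))
  show "\<forall>i\<in>?T. infinite_cyclic_on \<Gamma> (?g i)"
    by (rule coords'(2))
  show "internal_direct_sum \<Gamma> (center \<Gamma>) ?T (\<lambda>i. generate \<Gamma> {?g i})"
    by (rule coords'(3))
qed

text \<open>
Each block has one generator of the first family and \<open>(m j - 3) div 2\<close> of the second, in total
\<open>(m j - 1) div 2\<close>; the third family is indexed by the two-element sets of blocks.
\<close>

lemma card_basis:
  defines "I \<equiv> {1..t}"
    and "J \<equiv> {(j, h). 1 \<le> j \<and> j \<le> t \<and> 1 \<le> h \<and> h \<le> (m j - 3) div 2}"
    and "K \<equiv> {(j, h). 1 \<le> j \<and> j < h \<and> h \<le> t}"
  shows "finite (I <+> J <+> K)"
    "card (I <+> J <+> K) = (\<Sum>i = 1..t. (m i - 1) div 2) + t * (t - 1) div 2"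
proof -
  have J: "J = Sigma {1..t} (\<lambda>j. {1..(m j - 3) div 2})"
    by (auto simp: J_def)
  have K: "K = Sigma {1..t} (\<lambda>j. {j<..t})"
    by (auto simp: K_def)
  have fin: "finite I" "finite J" "finite K"
    unfolding I_def J K by (intro finite_SigmaI finite_atLeastAtMost finite_greaterThanAtMost)+
  then show "finite (I <+> J <+> K)"
    by (intro finite_Plus)
  have "card J + card I = (\<Sum>j = 1..t. (m j - 3) div 2 + 1)"
    by (simp add: J I_def card_SigmaI sum.distrib)
  also have "\<dots> = (\<Sum>j = 1..t. (m j - 1) div 2)"
  proof (rule sum.cong[OF HOL.refl])
    fix j assume "j \<in> {1..t}"
    then have "3 \<le> m j" by (rule block_ge_3)
    then show "(m j - 3) div 2 + 1 = (m j - 1) div 2" by linarith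
  qed
  finally have IJ: "card J + card I = (\<Sum>j = 1..t. (m j - 1) div 2)" .
  have "card K = (\<Sum>j = 1..t. t - j)"
    by (simp add: K card_SigmaI)
  also have "\<dots> = (\<Sum>i\<in>{0..<t}. i)"
    by (rule sum.reindex_bij_witness[of _ "\<lambda>i. t - i" "\<lambda>j. t - j"]) auto
  also have "\<dots> = t * (t - 1) div 2"
    by (simp add: Sum_Ico_nat)
  finally show "card (I <+> J <+> K) = (\<Sum>i = 1..t. (m i - 1) div 2) + t * (t - 1) div 2"
    using IJ fin by (simp add: card_Plus)
qed

end

theorem theorem13:
  fixes p r m :: "nat \<Rightarrow> nat" and t :: nat
  assumes "1 \<le> t"
    and "\<And>i. i \<in> {1..t} \<Longrightarrow> prime (p i) \<and> odd (p i)"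
    and "inj_on p {1..t}"
    and "\<And>i. i \<in> {1..t} \<Longrightarrow> 1 \<le> r i"
    and m_def: "m = (\<lambda>i. p i ^ r i)"
  defines "G \<equiv> Gamma t m"
    and "x \<equiv> (\<lambda>j. e_elt t m j 0 1)"
    and "y \<equiv> (\<lambda>(j, h). list_mult (Gamma t m) (map (e_elt t m j h) [1..<m j + 1]))"
    and "z \<equiv> (\<lambda>(j, h). list_mult (Gamma t m) (map (e_elt t m (t + j) (t + h)) [1..<m j * m h + 1]))"
    and "I \<equiv> {1..t}"
    and "J \<equiv> {(j, h). 1 \<le> j \<and> j \<le> t \<and> 1 \<le> h \<and> h \<le> (m j - 3) div 2}"
    and "K \<equiv> {(j, h). 1 \<le> j \<and> j < h \<and> h \<le> t}"
  shows "G\<lparr>carrier := center G\<rparr> \<cong>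
           free_Abelian_group {..<(\<Sum>i = 1..t. (m i - 1) div 2) + t * (t - 1) div 2}
       \<and> (\<forall>j\<in>I. infinite_cyclic_on G (x j))
       \<and> (\<forall>jh\<in>J. infinite_cyclic_on G (y jh))
       \<and> (\<forall>jh\<in>K. infinite_cyclic_on G (z jh))
       \<and> internal_direct_sum G (center G) (I <+> J <+> K)
           (\<lambda>i. generate G {case_sum x (case_sum y z) i})"
proof -
  have p: "prime (p i)" "odd (p i)" "1 \<le> r i" if "i \<in> {1..t}" for i
    using assms(2,4) that by blast+
  interpret odd_blocks t m
  proof
    show "1 \<le> t" by fact
    fix i assume i: "i \<in> {1..t}"
    show "odd (m i)" using p[OF i] by (simp add: m_def)
    have "3 \<le> p i"
      using prime_ge_2_nat[OF p(1)[OF i]] p(2)[OF i] by (cases "p i = 2") auto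
    also have "p i \<le> m i"
      using p(3)[OF i] prime_gt_0_nat[OF p(1)[OF i]] unfolding m_def by (intro self_le_power) auto
    finally show "3 \<le> m i" .
    fix j assume j: "j \<in> {1..t}" "i \<noteq> j"
    then have "p i \<noteq> p j"
      using i assms(3) by (auto dest: inj_onD)
    then show "coprime (m i) (m j)"
      using p(1)[OF i] p(1)[OF j(1)] by (simp add: m_def primes_coprime)
  qed
  have T: "finite (I <+> J <+> K)"
    "card (I <+> J <+> K) = (\<Sum>i = 1..t. (m i - 1) div 2) + t * (t - 1) div 2"
    unfolding I_def J_def K_def by (rule card_basis)+
  have "I <+> J <+> K \<approx> {..<(\<Sum>i = 1..t. (m i - 1) div 2) + t * (t - 1) div 2}"
    using T by (simp add: eqpoll_iff_card)
  then have "free_Abelian_group (I <+> J <+> K) \<cong>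
      free_Abelian_group {..<(\<Sum>i = 1..t. (m i - 1) div 2) + t * (t - 1) div 2}"
    by (simp add: isomorphic_free_Abelian_groups)
  moreover have "G\<lparr>carrier := center G\<rparr> \<cong> free_Abelian_group (I <+> J <+> K)"
    unfolding G_def I_def J_def K_def by (rule center_Gamma(1))
  moreover have cyclic: "\<forall>i\<in>I <+> J <+> K. infinite_cyclic_on G (case_sum x (case_sum y z) i)"
    unfolding G_def I_def J_def K_def x_def y_def z_def by (rule center_Gamma(2))
  moreover have "internal_direct_sum G (center G) (I <+> J <+> K)
      (\<lambda>i. generate G {case_sum x (case_sum y z) i})"
    unfolding G_def I_def J_def K_def x_def y_def z_def by (rule center_Gamma(3))
  moreover have "infinite_cyclic_on G (x j)" if "j \<in> I" for j
  proof -
    have "Inl j \<in> I <+> J <+> K"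
      using that by blast
    from bspec[OF cyclic this] show ?thesis
      by simp
  qed
  moreover have "infinite_cyclic_on G (y jh)" if "jh \<in> J" for jh
  proof -
    have "Inr (Inl jh) \<in> I <+> J <+> K"
      using that by blast
    from bspec[OF cyclic this] show ?thesis
      by simp
  qed
  moreover have "infinite_cyclic_on G (z jh)" if "jh \<in> K" for jh
  proof -
    have "Inr (Inr jh) \<in> I <+> J <+> K"
      using that by blast
    from bspec[OF cyclic this] show ?thesis
      by simp
  qed
  ultimately show ?thesis
    using iso_trans by blast
qed

end
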